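(* Consider the continuous-stage Runge-Kutta (csRK) method with $B_\tau\equiv 1$, $C_\tau\equiv\tau$ on $[0,1]$ and $$A_{\tau,\sigma}=\frac{1}{2}+\frac{\sqrt{3}}{6}P_1(\tau)+\sum_{i\geq 0,\,j\geq 1}\alpha_{(i,j)}P_i(\tau)P_j(\sigma),\qquad \alpha_{(i,j)}\in\mathbb{R},$$ where $P_\iota$ denotes the normalized shifted Legendre polynomial of degree $\iota$ on $[0,1]$. Then: (1) the method is of order at least $2$; (2) if, additionally, $\alpha_{(0,1)}=-\frac{\sqrt{3}}{6}$, then the method is of order at least $3$; (3) if, in addition to $\alpha_{(0,1)}=-\frac{\sqrt{3}}{6}$, one has $$\alpha_{(1,1)}=0,\qquad \alpha_{(0,2)}=0,\qquad \sum_{i\geq 3}\alpha_{(0,i)}\alpha_{(i,1)}=0,$$ then the method is of order at least $4$.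
   Context: Initial value problem: $\dot{z}=f(t,z)$, $z(t_0)=z_0\in\mathbb{R}^d$. csRK method: let $A_{\tau,\sigma}$ be a function of $(\tau,\sigma)\in[0,1]^2$ and $B_\tau, C_\tau$ functions of $\tau\in[0,1]$. The csRK method with coefficients $(A_{\tau,\sigma},B_\tau,C_\tau)$ and step size $h$ is the one-step method $\Phi_h: z_0\mapsto z_1$ given by $$Z_\tau=z_0+h\int_0^1 A_{\tau,\sigma}f(t_0+C_\sigma h,Z_\sigma)\,d\sigma,\ \tau\in[0,1],\qquad z_1=z_0+h\int_0^1 B_\tau f(t_0+C_\tau h,Z_\tau)\,d\tau .$$ (If $f$ is Lipschitz with constant $L$, the system has a unique solution for $h<1/(L\max_{\tau}\int_0^1|A_{\tau,\sigma}|\,d\sigma)$.) Order: the method is of order $p$ if, for all sufficiently regular problems, $z_1-z(t_0+h)=\mathcal{O}(h^{p+1})$ as $h\to 0$, where $z(t)$ is the exact solution. Legendre polynomials: $P_0(x)=1$, $P_\iota(x)=\frac{\sqrt{2\iota+1}}{\iota!}\frac{d^\iota}{dx^\iota}\big(x^\iota(x-1)^\iota\big)$ for $\iota\ge 1$; they satisfy $\int_0^1P_\iota P_\kappa\,dt=\delta_{\iota\kappa}$. The series for $A_{\tau,\sigma}$ is the expansion of a function $A\in L^2([0,1]\times[0,1])$ in the complete orthonormal basis $\{P_i(\tau)P_j(\sigma)\}_{i,j\ge 0}$. *)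

theory Defs
  imports "HOL-Analysis.Analysis"
begin

text \<open>Normalized shifted Legendre polynomials (Rodrigues formula); the formula gives
  \<open>legendre 0 x = 1\<close>.\<close>

definition legendre :: "nat \<Rightarrow> real \<Rightarrow> real" where
  "legendre n x = sqrt (2 * real n + 1) / fact n * (deriv ^^ n) (\<lambda>y. y ^ n * (y - 1) ^ n) x"


text \<open>Real functions on the unit square are curried; they are viewed as functions of a pair
  for integration with respect to two-dimensional Lebesgue measure.\<close>

definition L2_square :: "(real \<Rightarrow> real \<Rightarrow> real) \<Rightarrow> bool" where
  "L2_square A \<longleftrightarrow>
     set_borel_measurable lebesgue ({0..1} \<times> {0..1}) (\<lambda>p. A (fst p) (snd p)) \<and>
     set_integrable lebesgue ({0..1} \<times> {0..1}) (\<lambda>p. (A (fst p) (snd p))\<^sup>2)"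

text \<open>Unconditional convergence in \<open>L\<^sup>2\<close> of the unit square. It is only meaningful when
  \<open>G\<close> and all \<open>\<phi> i\<close> satisfy \<^const>\<open>L2_square\<close>, since the integral of
  a non-integrable function is \<open>0\<close>.\<close>

definition has_L2_sum ::
  "('i \<Rightarrow> real \<Rightarrow> real \<Rightarrow> real) \<Rightarrow> (real \<Rightarrow> real \<Rightarrow> real) \<Rightarrow> 'i set \<Rightarrow> bool" where
  "has_L2_sum \<phi> G I \<longleftrightarrow>
     ((\<lambda>F. LINT p:{0..1} \<times> {0..1}|lebesgue.
              (G (fst p) (snd p) - (\<Sum>i\<in>F. \<phi> i (fst p) (snd p)))\<^sup>2) \<longlongrightarrow> 0)
       (finite_subsets_at_top I)"

text \<open>Finiteness of \<open>sup\<^sub>\<tau> \<integral> \<bar>A \<tau> \<sigma>\<bar> d\<sigma>\<close>, the quantity which bounds the step sizes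
  for which the stage equations of a Runge-Kutta method are uniquely solvable. The integrals in
  the stage equations are taken for every \<open>\<tau>\<close>, so neither this condition
  nor the integrability of the sections follows from \<^const>\<open>L2_square\<close>.\<close>

definition bounded_row_integrals :: "(real \<Rightarrow> real \<Rightarrow> real) \<Rightarrow> bool" where
  "bounded_row_integrals A \<longleftrightarrow>
     (\<forall>\<tau>\<in>{0..1}. set_integrable lebesgue {0..1} (A \<tau>)) \<and>
     (\<exists>M. \<forall>\<tau>\<in>{0..1}. (LINT \<sigma>:{0..1}|lebesgue. \<bar>A \<tau> \<sigma>\<bar>) \<le> M)"


text \<open>Functions of class \<open>C\<^sup>k\<close> on an open set \<open>S\<close>, by recursion through all directional
  derivatives (in finite dimension).\<close>

primrec Ck_on ::
  "nat \<Rightarrow> ('a::euclidean_space \<Rightarrow> 'b::euclidean_space) \<Rightarrow> 'a set \<Rightarrow> bool" where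
  "Ck_on 0 f S \<longleftrightarrow> continuous_on S f"
| "Ck_on (Suc k) f S \<longleftrightarrow>
     (\<forall>x\<in>S. f differentiable (at x)) \<and>
     (\<forall>v. Ck_on k (\<lambda>x. frechet_derivative f (at x) v) S)"

definition ivp_solution ::
  "(real \<Rightarrow> 'a::euclidean_space \<Rightarrow> 'a) \<Rightarrow> (real \<times> 'a) set \<Rightarrow> real \<Rightarrow> 'a \<Rightarrow> real \<Rightarrow>
     (real \<Rightarrow> 'a) \<Rightarrow> bool" where
  "ivp_solution f U t0 z0 T z \<longleftrightarrow>
     z t0 = z0 \<and>
     (\<forall>t\<in>{t0..t0 + T}. (t, z t) \<in> U \<and>
        (z has_vector_derivative f t (z t)) (at t within {t0..t0 + T}))"


text \<open>One step of size \<open>h\<close> of the continuous-stage Runge-Kutta method with coefficients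
  \<open>A\<close>, \<open>B\<close>, \<open>C\<close>: internal stages \<open>Z\<close>, result \<open>z1\<close>. The integrability
  conditions exclude spurious solutions caused by the convention that
  the integral of a non-integrable function is \<open>0\<close>.\<close>

definition csRK_step ::
  "(real \<Rightarrow> real \<Rightarrow> real) \<Rightarrow> (real \<Rightarrow> real) \<Rightarrow> (real \<Rightarrow> real) \<Rightarrow>
     (real \<Rightarrow> 'a::euclidean_space \<Rightarrow> 'a) \<Rightarrow> real \<Rightarrow> 'a \<Rightarrow> real \<Rightarrow> (real \<Rightarrow> 'a) \<Rightarrow> 'a \<Rightarrow> bool" where
  "csRK_step A B C f t0 z0 h Z z1 \<longleftrightarrow>
     (\<forall>\<tau>\<in>{0..1}.
        set_integrable lebesgue {0..1} (\<lambda>\<sigma>. A \<tau> \<sigma> *\<^sub>R f (t0 + C \<sigma> * h) (Z \<sigma>)) \<and>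
        Z \<tau> = z0 + h *\<^sub>R (LINT \<sigma>:{0..1}|lebesgue. A \<tau> \<sigma> *\<^sub>R f (t0 + C \<sigma> * h) (Z \<sigma>))) \<and>
     set_integrable lebesgue {0..1} (\<lambda>\<tau>. B \<tau> *\<^sub>R f (t0 + C \<tau> * h) (Z \<tau>)) \<and>
     z1 = z0 + h *\<^sub>R (LINT \<tau>:{0..1}|lebesgue. B \<tau> *\<^sub>R f (t0 + C \<tau> * h) (Z \<tau>))"

text \<open>Order (at least) \<open>p\<close> for initial value problems with state space \<open>'a\<close>, that is,
  \<open>\<real>\<^sup>d\<close> with \<open>d = DIM('a)\<close>. ``Sufficiently regular'' means that the right-hand side is of
  class \<open>C\<^sup>p\<close> on an open set \<open>U\<close> around the initial data. As \<open>f\<close> need not be globally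
  Lipschitz, the implicit stage equations may have further solutions far from \<open>z0\<close>; the
  numerical solution is the one whose stages lie in some fixed ball around \<open>z0\<close>, and it is
  required to exist and to be unique for all small step sizes. If \<open>f\<close> is globally Lipschitz,
  the solution in the ball is the only bounded one once \<open>h\<close> is small.\<close>

definition csRK_order ::
  "'a::euclidean_space itself \<Rightarrow> (real \<Rightarrow> real \<Rightarrow> real) \<Rightarrow> (real \<Rightarrow> real) \<Rightarrow> (real \<Rightarrow> real) \<Rightarrow>
     nat \<Rightarrow> bool" where
  "csRK_order TYPE('a) A B C p \<longleftrightarrow>
     (\<forall>(f :: real \<Rightarrow> 'a \<Rightarrow> 'a) U t0 z0 T z.
        open U \<longrightarrow> (t0, z0) \<in> U \<longrightarrow> Ck_on p (\<lambda>x. f (fst x) (snd x)) U \<longrightarrow>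
        0 < T \<longrightarrow> ivp_solution f U t0 z0 T z \<longrightarrow>
        (\<exists>r>0. \<exists>h0>0. \<exists>K. h0 \<le> T \<and>
           (\<forall>h. 0 < h \<longrightarrow> h < h0 \<longrightarrow>
              (\<exists>!z1. \<exists>Z. (\<forall>\<tau>\<in>{0..1}. Z \<tau> \<in> ball z0 r) \<and> csRK_step A B C f t0 z0 h Z z1) \<and>
              (\<forall>z1 Z. (\<forall>\<tau>\<in>{0..1}. Z \<tau> \<in> ball z0 r) \<longrightarrow> csRK_step A B C f t0 z0 h Z z1 \<longrightarrow>
                 norm (z1 - z (t0 + h)) \<le> K * h ^ (p + 1)))))"

end

theory Submission
  imports Defs "HOL-Computational_Algebra.Polynomial"
begin

text \<open>
  As \<open>B = 1\<close>, the final quadrature is exact for the exact solution, so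
  \<open>z\<^sub>1 - z(t\<^sub>0 + h) = h \<integral> D\<close> with \<open>D(\<tau>) = f(t, Z\<^sub>\<tau>) - f(t, z(t))\<close>, \<open>t = t\<^sub>0 + \<tau> h\<close>. The stage
  errors \<open>E(\<tau>) = Z\<^sub>\<tau> - z(t)\<close> satisfy \<open>E = h \<A> D + R\<close>, where \<open>\<A>\<close> is the integral operator with
  kernel \<open>A\<close> and \<open>R\<close> is the residual of the exact solution in the stage equations. Expanding
  \<open>f(t, z(t))\<close> in powers of \<open>t - t\<^sub>0\<close> with coefficients \<open>c\<^sub>k\<close> gives
  \<open>R = \<Sum>\<^sub>k h\<^bsup>k+1\<^esup> r\<^sub>k c\<^sub>k\<close> with \<open>r\<^sub>k(\<tau>) = \<integral> A\<^sub>\<tau>\<^sub>\<sigma> \<sigma>\<^sup>k d\<sigma> - \<tau>\<^bsup>k+1\<^esup>/(k+1)\<close>. Iterating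
  \<open>D = J E + O(\<bar>E\<bar>\<^sup>2)\<close>, \<open>J = \<partial>f/\<partial>z\<close>, reduces order 2 to \<open>r\<^sub>0 = 0\<close> almost everywhere, order 3 to
  \<open>\<integral> r\<^sub>1 = 0\<close>, and order 4 to \<open>\<integral> r\<^sub>2 = \<integral> \<tau> r\<^sub>1 = \<integral> \<A> r\<^sub>1 = 0\<close>, without any enumeration of trees.
  Testing the expansion of \<open>A\<close> against products \<open>q(\<tau>) w(\<sigma>)\<close> and using orthonormality of the
  Legendre polynomials turns these identities into the conditions on \<open>\<alpha>\<close>; for \<open>\<integral> \<A> r\<^sub>1\<close> the
  function \<open>q\<close> is the column integral \<open>q(\<tau>) = \<integral> A\<^sub>\<rho>\<^sub>\<tau> d\<rho>\<close>, whose coefficients are \<open>\<alpha>\<^sub>(\<^sub>0\<^sub>,\<^sub>i\<^sub>)\<close>.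
\<close>

section \<open>Functions of class \<open>C\<^sup>k\<close> and expansions along solutions\<close>

text \<open>Since 1/2 + (sqrt 3 / 6) P_1(\<tau>) is the function \<tau> and the columns with j \<ge>
  1 are orthogonal to constants, r_0 vanishes. Hence the stage errors are O(h^2) and the quadratic
  remainder is O(h^4). This is why linear terms in the stage error suffice up to order 4; at the
  next order a term with the square of r_1 would appear. The obstacle is that the coefficients
  determine A only up to null sets of the square, while the stage equations use every row. So the
  identities for the r_k hold only for almost every \<tau>, the O-terms are stated almost
  everywhere, and a Borel version of A serves the Fubini arguments, whereas existence and uniqueness
  of the stages are proved for A itself at every \<tau>. Exceptional null sets are harmless in the
  end because D is only integrated. All bounds are uniform over pairs (h, Z) of a step size and a
  stage function, so one constant covers every admissible numerical solution.\<close>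

lemma frechet_derivative_cong_open:
  assumes "open S" "x \<in> S" "\<And>y. y \<in> S \<Longrightarrow> f y = g y"
  shows "frechet_derivative f (at x) = frechet_derivative g (at x)"
proof -
  \<comment> \<open>\<open>frechet_derivative\<close> is a choice among all derivatives, so equality
    of the predicates gives equality of the chosen maps, even where no derivative exists.\<close>
  have "(f has_derivative D) (at x) \<longleftrightarrow> (g has_derivative D) (at x)" for D
    using has_derivative_transform_within_open[of f D x UNIV S g]
      has_derivative_transform_within_open[of g D x UNIV S f] assms by auto
  then show ?thesis by (simp add: frechet_derivative_def)
qed

text \<open>\<open>frechet_derivative\<close> is a total function but is computed by formulas only
  on \<open>S\<close>; this rule lets such a formula replace it at every level of the
  recursion.\<close>

lemma Ck_on_cong:
  assumes "open S" "\<And>x. x \<in> S \<Longrightarrow> f x = g x"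
  shows "Ck_on k f S \<longleftrightarrow> Ck_on k g S"
  using assms(2)
proof (induction k arbitrary: f g)
  case 0
  then show ?case by (simp cong: continuous_on_cong)
next
  case (Suc k)
  have "f differentiable at x \<longleftrightarrow> g differentiable at x" if "x \<in> S" for x
    using has_derivative_transform_within_open[of f _ x UNIV S g]
      has_derivative_transform_within_open[of g _ x UNIV S f] assms(1) Suc.prems that
    unfolding differentiable_def by metis
  moreover have "Ck_on k (\<lambda>x. frechet_derivative f (at x) v) S
      \<longleftrightarrow> Ck_on k (\<lambda>x. frechet_derivative g (at x) v) S" for v
    by (rule Suc.IH) (metis frechet_derivative_cong_open assms(1) Suc.prems)
  ultimately show ?case by auto
qed

lemma Ck_on_SucD: "Ck_on (Suc k) f S \<Longrightarrow> Ck_on k f S"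
proof (induction k arbitrary: f)
  case 0
  then show ?case
    by (auto intro!: continuous_at_imp_continuous_on differentiable_imp_continuous_within)
next
  case (Suc k)
  have "\<forall>x\<in>S. f differentiable at x"
    and "Ck_on (Suc k) (\<lambda>x. frechet_derivative f (at x) v) S" for v
    using Suc.prems unfolding Ck_on.simps(2)[of "Suc k"] by blast+
  then show ?case using Suc.IH by (simp only: Ck_on.simps) blast
qed

lemma Ck_on_mono: "Ck_on k f S \<Longrightarrow> l \<le> k \<Longrightarrow> Ck_on l f S"
  by (induction k) (auto simp: le_Suc_eq dest: Ck_on_SucD simp del: Ck_on.simps)

lemma Ck_on_has_derivative:
  assumes "Ck_on (Suc k) f S" "x \<in> S"
  shows "(f has_derivative frechet_derivative f (at x)) (at x)"
  using assms frechet_derivative_works by auto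

lemma Ck_on_directional: "Ck_on (Suc k) f S \<Longrightarrow> Ck_on k (\<lambda>x. frechet_derivative f (at x) v) S"
  by simp

lemma Ck_on_imp_continuous_on: "Ck_on k f S \<Longrightarrow> continuous_on S f"
  using Ck_on_mono[of k f S 0] by simp

text \<open>Frees the closure proofs from the choice operator: by uniqueness of derivatives, any
  derivative \<open>D\<close> known on \<open>S\<close> may be used.\<close>

lemma Ck_on_SucI:
  assumes "open S" "\<And>x. x \<in> S \<Longrightarrow> (f has_derivative D x) (at x)"
    and "\<And>v. Ck_on k (\<lambda>x. D x v) S"
  shows "Ck_on (Suc k) f S"
proof -
  have "frechet_derivative f (at x) = D x" if "x \<in> S" for x
    using frechet_derivative_at assms(2) that by metis
  then have "Ck_on k (\<lambda>x. frechet_derivative f (at x) v) S" for v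
    using Ck_on_cong[OF assms(1), of "\<lambda>x. frechet_derivative f (at x) v" "\<lambda>x. D x v"] assms(3)
    by simp
  then show ?thesis using assms(2) by (auto simp: differentiable_def)
qed

lemma Ck_on_const: "open S \<Longrightarrow> Ck_on k (\<lambda>x. c) S"
proof (induction k arbitrary: c)
  case (Suc k)
  show ?case by (rule Ck_on_SucI[where D = "\<lambda>_ _. 0"]) (auto simp: Suc)
qed auto

lemma Ck_on_add:
  "open S \<Longrightarrow> Ck_on k f S \<Longrightarrow> Ck_on k g S \<Longrightarrow> Ck_on k (\<lambda>x. f x + g x) S"
proof (induction k arbitrary: f g)
  case (Suc k)
  note d = Ck_on_has_derivative Ck_on_directional
  show ?case
    by (rule Ck_on_SucI[OF Suc.prems(1) has_derivative_add[OF d(1)[OF Suc.prems(2)] d(1)[OF Suc.prems(3)]]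
        Suc.IH[OF Suc.prems(1) d(2)[OF Suc.prems(2)] d(2)[OF Suc.prems(3)]]])
qed (auto intro: continuous_intros)

lemma Ck_on_sum:
  "open S \<Longrightarrow> (\<And>i. i \<in> I \<Longrightarrow> Ck_on k (f i) S) \<Longrightarrow> Ck_on k (\<lambda>x. \<Sum>i\<in>I. f i x) S"
  by (induction I rule: infinite_finite_induct) (auto intro: Ck_on_add Ck_on_const)

lemma Ck_on_linear:
  "open S \<Longrightarrow> bounded_linear l \<Longrightarrow> Ck_on k f S \<Longrightarrow> Ck_on k (\<lambda>x. l (f x)) S"
proof (induction k arbitrary: f)
  case 0
  then show ?case using bounded_linear.continuous_on by auto
next
  case (Suc k)
  note d = Ck_on_has_derivative Ck_on_directional
  show ?case
    by (rule Ck_on_SucI[OF Suc.prems(1)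
        bounded_linear.has_derivative[OF Suc.prems(2) d(1)[OF Suc.prems(3)]]
        Suc.IH[OF Suc.prems(1,2) d(2)[OF Suc.prems(3)]]])
qed

lemma Ck_on_scaleR:
  "open S \<Longrightarrow> Ck_on k a S \<Longrightarrow> Ck_on k g S \<Longrightarrow> Ck_on k (\<lambda>x. a x *\<^sub>R g x) S"
proof (induction k arbitrary: a g)
  case (Suc k)
  note d = Ck_on_has_derivative Ck_on_directional
  have "Ck_on k a S" "Ck_on k g S" using Suc.prems Ck_on_SucD by blast+
  then show ?case
    by (intro Ck_on_SucI[OF Suc.prems(1)
          has_derivative_scaleR[OF d(1)[OF Suc.prems(2)] d(1)[OF Suc.prems(3)]]]
        Ck_on_add[OF Suc.prems(1)] Suc.IH[OF Suc.prems(1)] d(2)[OF Suc.prems(2)] d(2)[OF Suc.prems(3)])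
qed (auto intro: continuous_intros)

text \<open>\<open>Ck_on\<close> controls fixed directions. Writing the moving direction
  \<open>w x\<close> in the standard basis reduces to these. This is needed to differentiate along a
  solution, where the direction is the vector field.\<close>

lemma Ck_on_frechet_derivative_apply:
  fixes w :: "'x::euclidean_space \<Rightarrow> 'x"
  assumes "open S" "Ck_on (Suc k) f S" "Ck_on k w S"
  shows "Ck_on k (\<lambda>x. frechet_derivative f (at x) (w x)) S"
proof -
  have "frechet_derivative f (at x) (w x)
      = (\<Sum>b\<in>Basis. (w x \<bullet> b) *\<^sub>R frechet_derivative f (at x) b)" if "x \<in> S" for x
  proof -
    interpret bounded_linear "frechet_derivative f (at x)"
      using Ck_on_has_derivative[OF assms(2) that] has_derivative_bounded_linear by blast
    have "frechet_derivative f (at x) (w x)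
        = frechet_derivative f (at x) (\<Sum>b\<in>Basis. (w x \<bullet> b) *\<^sub>R b)"
      by (simp add: euclidean_representation)
    then show ?thesis by (simp add: sum scaleR)
  qed
  moreover have "Ck_on k (\<lambda>x. \<Sum>b\<in>Basis. (w x \<bullet> b) *\<^sub>R frechet_derivative f (at x) b) S"
    using assms
    by (auto intro!: Ck_on_sum Ck_on_scaleR Ck_on_linear[OF _ bounded_linear_inner_left])
  ultimately show ?thesis
    using Ck_on_cong[OF assms(1), of "\<lambda>x. frechet_derivative f (at x) (w x)"
        "\<lambda>x. \<Sum>b\<in>Basis. (w x \<bullet> b) *\<^sub>R frechet_derivative f (at x) b"] by simp
qed

text \<open>Continuity of the directional derivatives bounds each basis direction on a compact set,
  and linearity extends the bound to all \<open>v\<close>.\<close>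

lemma frechet_derivative_bounded_on_compact:
  fixes f :: "'x::euclidean_space \<Rightarrow> 'b::euclidean_space"
  assumes "Ck_on (Suc k) f S" "compact K" "K \<subseteq> S"
  shows "\<exists>B\<ge>0. \<forall>x\<in>K. \<forall>v. norm (frechet_derivative f (at x) v) \<le> B * norm v"
proof -
  have "\<exists>B. \<forall>x\<in>K. norm (frechet_derivative f (at x) b) \<le> B" for b
  proof -
    have "continuous_on K (\<lambda>x. frechet_derivative f (at x) b)"
      using Ck_on_imp_continuous_on[OF Ck_on_directional[OF assms(1)]] assms(3) continuous_on_subset
      by blast
    then have "bounded ((\<lambda>x. frechet_derivative f (at x) b) ` K)"
      using assms(2) compact_continuous_image compact_imp_bounded by blast
    then show ?thesis by (auto simp: bounded_iff)
  qed
  then obtain B where B: "\<And>b x. x \<in> K \<Longrightarrow> norm (frechet_derivative f (at x) b) \<le> B b" by metis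
  have "norm (frechet_derivative f (at x) v) \<le> (\<Sum>b\<in>Basis. \<bar>B b\<bar>) * norm v" if "x \<in> K" for x v
  proof -
    interpret bounded_linear "frechet_derivative f (at x)"
      using Ck_on_has_derivative[OF assms(1)] has_derivative_bounded_linear assms(3) that by blast
    have "norm (frechet_derivative f (at x) v)
        = norm (frechet_derivative f (at x) (\<Sum>b\<in>Basis. (v \<bullet> b) *\<^sub>R b))"
      by (simp add: euclidean_representation)
    also have "\<dots> = norm (\<Sum>b\<in>Basis. (v \<bullet> b) *\<^sub>R frechet_derivative f (at x) b)"
      by (simp add: sum scaleR)
    also have "\<dots> \<le> (\<Sum>b\<in>Basis. norm v * \<bar>B b\<bar>)"
    proof (rule sum_norm_le)
      fix b :: 'x assume "b \<in> Basis"
      then have "\<bar>v \<bullet> b\<bar> * norm (frechet_derivative f (at x) b) \<le> norm v * \<bar>B b\<bar>"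
        using B[OF that, of b] by (intro mult_mono Basis_le_norm) auto
      then show "norm ((v \<bullet> b) *\<^sub>R frechet_derivative f (at x) b) \<le> norm v * \<bar>B b\<bar>" by simp
    qed
    finally show ?thesis by (simp add: sum_distrib_left mult.commute)
  qed
  then show ?thesis by (intro exI[of _ "\<Sum>b\<in>Basis. \<bar>B b\<bar>"]) (auto intro: sum_nonneg)
qed

lemma Ck_on_Lipschitz:
  fixes f :: "'x::euclidean_space \<Rightarrow> 'b::euclidean_space"
  assumes "Ck_on (Suc k) f S" "compact K" "convex K" "K \<subseteq> S"
  shows "\<exists>L\<ge>0. \<forall>x\<in>K. \<forall>y\<in>K. norm (f x - f y) \<le> L * norm (x - y)"
proof -
  obtain B where "B \<ge> 0"
    and B: "\<And>x v. x \<in> K \<Longrightarrow> norm (frechet_derivative f (at x) v) \<le> B * norm v"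
    using frechet_derivative_bounded_on_compact[OF assms(1,2,4)] by blast
  have "norm (f x - f y) \<le> B * norm (x - y)" if "x \<in> K" "y \<in> K" for x y
  proof (rule differentiable_bound[OF assms(3) _ _ that])
    show "(f has_derivative frechet_derivative f (at x)) (at x within K)" if "x \<in> K" for x
      using Ck_on_has_derivative[OF assms(1)] assms(4) that has_derivative_at_withinI by blast
    show "onorm (frechet_derivative f (at x)) \<le> B" if "x \<in> K" for x
      using B that by (intro onorm_le) auto
  qed
  then show ?thesis using \<open>B \<ge> 0\<close> by blast
qed

text \<open>Each directional derivative is itself Lipschitz on \<open>K\<close>, hence so is the
  derivative as a linear map. The mean value inequality on the segment from \<open>x\<close> to
  \<open>y\<close>, with the linear part at \<open>x\<close> removed, then gives the square.\<close>

lemma Ck_on_quadratic_remainder: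
  fixes f :: "'x::euclidean_space \<Rightarrow> 'b::euclidean_space"
  assumes "Ck_on (Suc (Suc k)) f S" "compact K" "convex K" "K \<subseteq> S"
  shows "\<exists>Q\<ge>0. \<forall>x\<in>K. \<forall>y\<in>K.
    norm (f y - f x - frechet_derivative f (at x) (y - x)) \<le> Q * (norm (y - x))\<^sup>2"
proof -
  let ?D = "\<lambda>x. frechet_derivative f (at x)"
  have "\<exists>L\<ge>0. \<forall>x\<in>K. \<forall>y\<in>K. norm (?D x b - ?D y b) \<le> L * norm (x - y)" for b
    using assms by (intro Ck_on_Lipschitz[of k]) auto
  then obtain L where L0: "\<And>b. L b \<ge> 0"
    and L: "\<And>b x y. x \<in> K \<Longrightarrow> y \<in> K \<Longrightarrow> norm (?D x b - ?D y b) \<le> L b * norm (x - y)"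
    by metis
  define Q where "Q = (\<Sum>b\<in>Basis. L b)"
  have Q0: "Q \<ge> 0" using L0 by (auto simp: Q_def intro: sum_nonneg)
  have lin: "bounded_linear (?D x)" if "x \<in> K" for x
    using Ck_on_has_derivative[OF assms(1)] has_derivative_bounded_linear assms(4) that by blast
  have DQ: "norm (?D x v - ?D y v) \<le> Q * norm (x - y) * norm v" if "x \<in> K" "y \<in> K" for x y v
  proof -
    interpret bounded_linear "\<lambda>v. ?D x v - ?D y v"
      using lin that bounded_linear_sub by blast
    have "norm (?D x v - ?D y v)
        = norm ((\<lambda>v. ?D x v - ?D y v) (\<Sum>b\<in>Basis. (v \<bullet> b) *\<^sub>R b))"
      by (simp add: euclidean_representation)
    also have "\<dots> = norm (\<Sum>b\<in>Basis. (v \<bullet> b) *\<^sub>R (?D x b - ?D y b))"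
      by (simp only: sum scaleR)
    also have "\<dots> \<le> (\<Sum>b\<in>Basis. norm v * (L b * norm (x - y)))"
    proof (rule sum_norm_le)
      fix b :: 'x assume "b \<in> Basis"
      then have "\<bar>v \<bullet> b\<bar> * norm (?D x b - ?D y b) \<le> norm v * (L b * norm (x - y))"
        by (intro mult_mono Basis_le_norm L that) auto
      then show "norm ((v \<bullet> b) *\<^sub>R (?D x b - ?D y b)) \<le> norm v * (L b * norm (x - y))" by simp
    qed
    finally show ?thesis by (simp add: Q_def sum_distrib_left sum_distrib_right mult_ac)
  qed
  have "norm (f y - f x - ?D x (y - x)) \<le> Q * (norm (y - x))\<^sup>2" if xy: "x \<in> K" "y \<in> K" for x y
  proof -
    have sub: "closed_segment x y \<subseteq> K" using xy assms(3) closed_segment_subset by blast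
    have "norm (f y - f x - ?D x (y - x)) \<le> norm (y - x) * (Q * norm (y - x))"
    proof (rule differentiable_bound_linearization[where S = "closed_segment x y"])
      show "x + t *\<^sub>R (y - x) \<in> closed_segment x y" if "t \<in> {0..1}" for t
        using that by (auto simp: closed_segment_def algebra_simps intro!: exI[of _ t])
      show "(f has_derivative ?D u) (at u within closed_segment x y)"
        if "u \<in> closed_segment x y" for u
        using Ck_on_has_derivative[OF assms(1)] assms(4) sub that has_derivative_at_withinI
        by blast
      show "onorm (?D u - ?D x) \<le> Q * norm (y - x)" if u: "u \<in> closed_segment x y" for u
      proof (rule onorm_le)
        fix v :: 'x
        have "norm (u - x) \<le> norm (y - x)"
          using u segment_bound(1) by (simp add: norm_minus_commute)
        then have "Q * norm (u - x) * norm v \<le> Q * norm (y - x) * norm v"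
          using Q0 by (intro mult_right_mono mult_left_mono) auto
        then show "norm ((?D u - ?D x) v) \<le> Q * norm (y - x) * norm v"
          using DQ[of u x v] u sub xy by auto
      qed
    qed auto
    then show ?thesis by (simp add: power2_eq_square mult_ac)
  qed
  then show ?thesis using Q0 by blast
qed

section \<open>Power expansions along a solution\<close>

lemma integrate_power_expansion:
  fixes \<phi> \<psi> :: "real \<Rightarrow> 'b::real_normed_vector"
  assumes "\<And>t. t \<in> {t0..t0 + T} \<Longrightarrow> (\<phi> has_vector_derivative \<psi> t) (at t within {t0..t0 + T})"
    and "\<And>t. t \<in> {t0..t0 + T} \<Longrightarrow>
      norm (\<psi> t - (\<Sum>k<n. (t - t0) ^ k *\<^sub>R c k)) \<le> K * (t - t0) ^ n"
    and t: "t \<in> {t0..t0 + T}"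
  shows "norm (\<phi> t - \<phi> t0 - (\<Sum>k<n. ((t - t0) ^ Suc k / real (Suc k)) *\<^sub>R c k))
    \<le> K * (t - t0) ^ Suc n"
proof (cases "t = t0")
  case False
  then have tt: "t > t0" using t by auto
  \<comment> \<open>The sign of \<open>K\<close> is read off from the bound at \<open>t\<close>,
    where the power of \<open>t - t0\<close> is positive.\<close>
  have "0 \<le> K * (t - t0) ^ n" using order_trans[OF norm_ge_zero assms(2)[OF t]] .
  moreover have "0 < (t - t0) ^ n" using tt by simp
  ultimately have K: "0 \<le> K" by (metis mult_less_cancel_right mult_zero_left not_le)
  let ?P = "\<lambda>u. \<Sum>k<n. ((u - t0) ^ Suc k / real (Suc k)) *\<^sub>R c k"
  have P': "(?P has_vector_derivative (\<Sum>k<n. (u - t0) ^ k *\<^sub>R c k)) (at u within X)" for u X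
  proof (rule has_vector_derivative_sum)
    fix k
    have "((\<lambda>u. u - t0) has_real_derivative 1) (at u within X)"
      by (auto intro!: derivative_eq_intros)
    from DERIV_cdivide[OF DERIV_power[OF this, of "Suc k"], of "real (Suc k)"]
    have "((\<lambda>u. (u - t0) ^ Suc k / real (Suc k)) has_real_derivative (u - t0) ^ k) (at u within X)"
      by (simp del: of_nat_Suc power_Suc)
    from has_vector_derivative_scaleR[OF this has_vector_derivative_const]
    show "((\<lambda>u. ((u - t0) ^ Suc k / real (Suc k)) *\<^sub>R c k) has_vector_derivative
        (u - t0) ^ k *\<^sub>R c k) (at u within X)"
      by simp
  qed
  \<comment> \<open>Subtracting the integrated polynomial leaves a function whose derivative is at
    most \<open>K * (t - t0) ^ n\<close> on all of \<open>{t0..t}\<close>, so the mean value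
    inequality yields one more power with the same constant.\<close>
  have "norm ((\<phi> t - ?P t) - (\<phi> t0 - ?P t0)) \<le> (K * (t - t0) ^ n) * norm (t - t0)"
  proof (rule differentiable_bound[where S = "{t0..t}"])
    fix u assume u: "u \<in> {t0..t}"
    let ?d = "\<psi> u - (\<Sum>k<n. (u - t0) ^ k *\<^sub>R c k)"
    have "(\<phi> has_vector_derivative \<psi> u) (at u within {t0..t})"
      using assms(1)[of u] t u by (auto intro: has_vector_derivative_within_subset)
    then show "((\<lambda>u. \<phi> u - ?P u) has_derivative (\<lambda>x. x *\<^sub>R ?d)) (at u within {t0..t})"
      using has_vector_derivative_diff[OF _ P'] by (simp add: has_vector_derivative_def)
    have "norm ?d \<le> K * (u - t0) ^ n" using assms(2) u t by auto
    also have "\<dots> \<le> K * (t - t0) ^ n" using u K by (auto intro!: mult_left_mono power_mono)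
    finally show "onorm (\<lambda>x. x *\<^sub>R ?d) \<le> K * (t - t0) ^ n"
      by (intro onorm_le) (metis mult.commute mult_left_mono norm_ge_zero norm_scaleR real_norm_def)
  qed (use tt in auto)
  then show ?thesis using tt by (simp add: algebra_simps)
qed auto

text \<open>Because z' = f, the derivative of \<open>F\<close> along the solution is again a
  function \<open>G\<close> of (t, z t), one degree less smooth. Induction with \<open>F\<close>
  arbitrary thus replaces the computation of higher derivatives of \<open>z\<close>; the smoothness
  of \<open>f\<close> enters through \<open>G\<close>.\<close>

lemma ivp_power_expansion:
  fixes F :: "real \<times> 'a::euclidean_space \<Rightarrow> 'b::euclidean_space"
  assumes "open U" "Ck_on n F U" "Ck_on n (\<lambda>x. f (fst x) (snd x)) U"
    and sol: "ivp_solution f U t0 z0 T z"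
  shows "\<exists>c K. \<forall>t\<in>{t0..t0 + T}.
    norm (F (t, z t) - (\<Sum>k<n. (t - t0) ^ k *\<^sub>R c k)) \<le> K * (t - t0) ^ n"
  using assms(2,3)
proof (induction n arbitrary: F)
  case 0
  have "continuous_on {t0..t0 + T} z"
    by (rule continuous_on_vector_derivative[where f' = "\<lambda>t. f t (z t)"])
      (use sol in \<open>simp add: ivp_solution_def\<close>)
  then have "continuous_on {t0..t0 + T} (\<lambda>t. (t, z t))" by (intro continuous_intros)
  moreover have "(\<lambda>t. (t, z t)) ` {t0..t0 + T} \<subseteq> U"
    using sol by (auto simp: ivp_solution_def)
  ultimately have "continuous_on {t0..t0 + T} (\<lambda>t. F (t, z t))"
    using continuous_on_compose2[of U F] 0 by auto
  then have "bounded ((\<lambda>t. F (t, z t)) ` {t0..t0 + T})"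
    by (intro compact_imp_bounded compact_continuous_image) auto
  then show ?case by (auto simp: bounded_iff)
next
  case (Suc n)
  \<comment> \<open>The vector field of the autonomous system for the pair (t, z).\<close>
  define w where "w = (\<lambda>x. (1 :: real, f (fst x) (snd x)))"
  have "bounded_linear (\<lambda>v. (0 :: real, v :: 'a))"
    by (intro bounded_linear_Pair bounded_linear_zero bounded_linear_ident)
  then have "Ck_on n (\<lambda>x. (1, 0) + (0 :: real, f (fst x) (snd x))) U"
    by (intro Ck_on_add[OF assms(1) Ck_on_const[OF assms(1)]]
        Ck_on_linear[OF assms(1), of "\<lambda>v. (0, v)"] Ck_on_SucD[OF Suc.prems(2)])
  then have w: "Ck_on n w U" by (simp add: w_def)
  define G where "G = (\<lambda>x. frechet_derivative F (at x) (w x))"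
  have "Ck_on n G U"
    unfolding G_def by (intro Ck_on_frechet_derivative_apply w Suc.prems assms(1))
  then obtain c K where cK: "\<And>t. t \<in> {t0..t0 + T} \<Longrightarrow>
      norm (G (t, z t) - (\<Sum>k<n. (t - t0) ^ k *\<^sub>R c k)) \<le> K * (t - t0) ^ n"
    using Suc.IH[OF _ Ck_on_SucD[OF Suc.prems(2)]] by blast
  have deriv: "((\<lambda>t. F (t, z t)) has_vector_derivative G (t, z t)) (at t within {t0..t0 + T})"
    if t: "t \<in> {t0..t0 + T}" for t
  proof -
    have U: "(t, z t) \<in> U"
      and z': "(z has_vector_derivative f t (z t)) (at t within {t0..t0 + T})"
      using sol t by (auto simp: ivp_solution_def)
    let ?D = "frechet_derivative F (at (t, z t))"
    have D: "(F has_derivative ?D) (at (t, z t))"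
      using Ck_on_has_derivative[OF Suc.prems(1) U] .
    have "((\<lambda>t. (t, z t)) has_derivative (\<lambda>h. (h, h *\<^sub>R f t (z t)))) (at t within {t0..t0 + T})"
      using z' by (intro has_derivative_Pair) (auto simp: has_vector_derivative_def)
    from has_derivative_compose[OF this D]
    have "((\<lambda>t. F (t, z t)) has_derivative (\<lambda>h. ?D (h, h *\<^sub>R f t (z t)))) (at t within {t0..t0 + T})" .
    moreover have "?D (h, h *\<^sub>R f t (z t)) = h *\<^sub>R ?D (1, f t (z t))" for h
      using linear_scale[OF has_derivative_linear[OF D], of h "(1, f t (z t))"]
      by (simp add: scaleR_Pair)
    ultimately show ?thesis by (simp add: has_vector_derivative_def G_def w_def)
  qed
  \<comment> \<open>Integration shifts the coefficients by one place, and the value at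
    \<open>t0\<close> becomes the constant term.\<close>
  define c' where "c' = (\<lambda>k. case k of 0 \<Rightarrow> F (t0, z t0) | Suc k \<Rightarrow> (1 / real (Suc k)) *\<^sub>R c k)"
  have "norm (F (t, z t) - (\<Sum>k<Suc n. (t - t0) ^ k *\<^sub>R c' k)) \<le> K * (t - t0) ^ Suc n"
    if "t \<in> {t0..t0 + T}" for t
    using integrate_power_expansion[where \<phi> = "\<lambda>t. F (t, z t)" and \<psi> = "\<lambda>t. G (t, z t)",
        OF deriv cK that]
    by (simp add: c'_def sum.lessThan_Suc_shift diff_diff_eq del: sum.lessThan_Suc)
  then show ?case by blast
qed

section \<open>Orthonormality of the Legendre polynomials\<close>

text \<open>Integration is moved to polynomials so that the algebra of \<open>pderiv\<close> and
  degrees does the work; the fundamental theorem of calculus enters only through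
  \<open>poly_integral_pderiv\<close>.\<close>

definition poly_integral :: "real poly \<Rightarrow> real" where
  "poly_integral p = integral {0..1} (poly p)"

lemma poly_integral_add: "poly_integral (p + q) = poly_integral p + poly_integral q"
  unfolding poly_integral_def poly_add
  by (intro integral_add integrable_continuous_real continuous_intros)

lemma poly_integral_smult: "poly_integral (smult c p) = c * poly_integral p"
proof -
  have "poly (smult c p) = (\<lambda>x. c * poly p x)" by auto
  then show ?thesis by (simp add: poly_integral_def)
qed

lemma poly_integral_pderiv: "poly_integral (pderiv p) = poly p 1 - poly p 0"
proof -
  have "(poly (pderiv p) has_integral (poly p 1 - poly p 0)) {0..1}"
    by (rule fundamental_theorem_of_calculus)
      (auto intro: poly_DERIV DERIV_subset simp flip: has_real_derivative_iff_has_vector_derivative)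
  then show ?thesis by (simp add: poly_integral_def integral_unique)
qed

lemma poly_integral_by_parts:
  assumes "poly q 0 = 0" "poly q 1 = 0"
  shows "poly_integral (pderiv q * p) = - poly_integral (q * pderiv p)"
proof -
  have "poly_integral (pderiv (q * p)) = 0" using assms by (simp add: poly_integral_pderiv)
  then show ?thesis by (simp add: pderiv_mult poly_integral_add mult.commute)
qed

text \<open>The Beta integral; the sign comes from x - 1 in place of 1 - x. Integrating the
  derivative of x^(a+1) (x-1)^(b+1), which vanishes at both ends, moves one power from the second
  factor to the first.\<close>

lemma poly_integral_beta:
  "poly_integral ([:0, 1:] ^ a * [:-1, 1:] ^ b) = (-1) ^ b * fact a * fact b / fact (a + b + 1)"
proof (induction b arbitrary: a)
  case 0
  have "pderiv ([:0, 1:] ^ Suc a) = smult (real (Suc a)) ([:0, 1:] ^ a :: real poly)"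
    by (simp add: pderiv_power_Suc pderiv_pCons del: power_Suc)
  then have "real (Suc a) * poly_integral ([:0, 1:] ^ a) = 1"
    using poly_integral_pderiv[of "[:0, 1:] ^ Suc a"] poly_integral_smult by simp
  then have "poly_integral ([:0, 1:] ^ a) = 1 / real (Suc a)"
    by (simp add: eq_divide_eq mult.commute del: of_nat_Suc)
  then show ?case by simp
next
  case (Suc b)
  have "pderiv ([:0, 1:] ^ Suc a) = smult (real (Suc a)) ([:0, 1:] ^ a :: real poly)"
    "pderiv ([:-1, 1:] ^ Suc b) = smult (real (Suc b)) ([:-1, 1:] ^ b :: real poly)"
    by (simp_all add: pderiv_power_Suc pderiv_pCons del: power_Suc)
  moreover have "poly_integral (pderiv ([:0, 1:] ^ Suc a * [:-1, 1:] ^ Suc b)) = 0"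
    by (simp add: poly_integral_pderiv)
  ultimately have "real (Suc a) * poly_integral ([:0, 1:] ^ a * [:-1, 1:] ^ Suc b)
      = - (real (Suc b) * poly_integral ([:0, 1:] ^ Suc a * [:-1, 1:] ^ b))"
    by (simp only: pderiv_mult poly_integral_add mult_smult_left mult_smult_right
        poly_integral_smult mult.commute)
  also have "\<dots> = real (Suc a) * ((-1) ^ Suc b * fact a * fact (Suc b) / fact (a + Suc b + 1))"
    unfolding Suc.IH by simp
  finally show ?case by (simp only: mult_cancel_left of_nat_eq_0_iff) simp
qed

text \<open>The Legendre polynomial without its normalizing factor; \<open>[:0, -1, 1:]\<close> is
  x^2 - x = x (x - 1), the base in Rodrigues' formula.\<close>

definition rodrigues :: "nat \<Rightarrow> real poly" where
  "rodrigues n = (pderiv ^^ n) ([:0, -1, 1:] ^ n)"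

lemma power_dvd_pderiv:
  assumes "(w :: real poly) ^ Suc m dvd r"
  shows "w ^ m dvd pderiv r"
proof -
  obtain s where "r = w ^ Suc m * s" using assms by blast
  then have "pderiv r = w ^ Suc m * pderiv s + pderiv (w ^ Suc m) * s"
    by (simp add: pderiv_mult mult.commute del: power_Suc)
  moreover have "w ^ m dvd pderiv (w ^ Suc m) * s"
    unfolding pderiv_power_Suc by (intro dvd_mult2 dvd_smult dvd_refl)
  moreover have "w ^ m dvd w ^ Suc m * pderiv s"
    by (intro dvd_mult2 le_imp_power_dvd) simp
  ultimately show ?thesis by simp
qed

text \<open>Each differentiation costs at most one factor \<open>w\<close>, so fewer than
  \<open>n\<close> derivatives of \<open>w ^ n\<close> still vanish at the roots of
  \<open>w\<close>. This kills the boundary terms of the repeated integration by parts.\<close>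

lemma power_dvd_pderivs: "k \<le> n \<Longrightarrow> (w :: real poly) ^ (n - k) dvd (pderiv ^^ k) (w ^ n)"
proof (induction k)
  case (Suc k)
  then show ?case using power_dvd_pderiv[of w "n - Suc k"] by (simp add: Suc_diff_Suc)
qed auto

lemma pderivs_vanish:
  assumes "k < n" and "x = 0 \<or> x = 1"
  shows "poly ((pderiv ^^ k) ([:0, -1, 1:] ^ n)) x = (0 :: real)"
proof -
  have "[:0, -1, 1:] dvd ([:0, -1, 1:] ^ (n - k) :: real poly)" using assms by (simp add: dvd_power)
  then have "[:0, -1, 1:] dvd (pderiv ^^ k) ([:0, -1, 1:] ^ n :: real poly)"
    using power_dvd_pderivs[of k n "[:0, -1, 1:]"] assms(1) dvd_trans by auto
  then show ?thesis using assms(2) by (auto elim!: dvdE)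
qed

lemma poly_integral_rodrigues:
  "poly_integral (rodrigues n * p) = (-1) ^ n * poly_integral ([:0, -1, 1:] ^ n * (pderiv ^^ n) p)"
proof -
  \<comment> \<open>The claim after \<open>k\<close> integrations by parts; the case
    \<open>k = n\<close> is the lemma.\<close>
  have "poly_integral (rodrigues n * p) =
      (-1) ^ k * poly_integral ((pderiv ^^ (n - k)) ([:0, -1, 1:] ^ n) * (pderiv ^^ k) p)"
    if "k \<le> n" for k
    using that
  proof (induction k)
    case 0
    then show ?case by (simp add: rodrigues_def)
  next
    case (Suc k)
    have "n - k = Suc (n - Suc k)" using Suc.prems by simp
    then show ?case
      using Suc poly_integral_by_parts[of "(pderiv ^^ (n - Suc k)) ([:0, -1, 1:] ^ n)" "(pderiv ^^ k) p"]
      by (simp add: pderivs_vanish)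
  qed
  from this[of n] show ?thesis by simp
qed

lemma pderivs_degree: "degree p \<le> n \<Longrightarrow> (pderiv ^^ n) p = [:fact n * coeff p n:]"
  for p :: "real poly"
proof (induction n arbitrary: p)
  case 0
  then show ?case by (auto elim: degree_eq_zeroE)
next
  case (Suc n)
  have "degree (pderiv p) \<le> n" using Suc.prems by (simp add: degree_pderiv)
  then show ?case
    using Suc.IH[of "pderiv p"] by (simp add: funpow_swap1 coeff_pderiv algebra_simps)
qed

lemma degree_pderivs: "degree ((pderiv ^^ k) p) \<le> degree p - k" for p :: "real poly"
proof (induction k)
  case (Suc k)
  then show ?case by (simp add: degree_pderiv)
qed simp

lemma degree_rodrigues_le: "degree (rodrigues n) \<le> n"
  using degree_pderivs[of n "[:0, -1, 1:] ^ n"] degree_power_le[of "[:0, -1, 1:] :: real poly" n]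
  unfolding rodrigues_def by simp

text \<open>Integration by parts moves \<open>n\<close> derivatives onto a polynomial of degree at
  most \<open>m < n\<close>.\<close>

lemma poly_integral_rodrigues_less:
  assumes "m < n"
  shows "poly_integral (rodrigues n * rodrigues m) = 0"
proof -
  have "(pderiv ^^ n) (rodrigues m) = 0"
    using pderivs_degree[of "rodrigues m" n] degree_rodrigues_le[of m] assms
    by (simp add: coeff_eq_0)
  then show ?thesis using poly_integral_smult[of 0 0] by (simp add: poly_integral_rodrigues)
qed

text \<open>As \<open>[:0, -1, 1:] ^ n\<close> is monic of degree 2n, the \<open>n\<close>-th
  derivative of \<open>rodrigues n\<close> is the constant (2n)!, and the Beta integral with a = b =
  n remains.\<close>

lemma poly_integral_rodrigues_square:
  "poly_integral (rodrigues n * rodrigues n) = (fact n)\<^sup>2 / (2 * real n + 1)"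
proof -
  have w: "degree ([:0, -1, 1:] ^ n :: real poly) = 2 * n"
    by (simp add: degree_power_eq)
  have "lead_coeff ([:0, -1, 1:] ^ n :: real poly) = 1"
    by (simp add: lead_coeff_power)
  then have "coeff ([:0, -1, 1:] ^ n :: real poly) (2 * n) = 1" using w by simp
  then have "(pderiv ^^ (n + n)) ([:0, -1, 1:] ^ n) = [:fact (2 * n) :: real:]"
    using pderivs_degree[of "[:0, -1, 1:] ^ n" "2 * n"] w by (simp flip: mult_2)
  then have "(pderiv ^^ n) (rodrigues n) = [:fact (2 * n):]"
    by (simp add: rodrigues_def funpow_add)
  then have "poly_integral (rodrigues n * rodrigues n)
      = (-1) ^ n * (fact (2 * n) * poly_integral ([:0, -1, 1:] ^ n))"
    by (simp add: poly_integral_rodrigues poly_integral_smult)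
  also have "[:0, -1, 1:] ^ n = [:0, 1:] ^ n * ([:-1, 1:] ^ n :: real poly)"
  proof -
    have "[:0, -1, 1:] = [:0, 1:] * ([:-1, 1:] :: real poly)" by simp
    then show ?thesis by (metis power_mult_distrib)
  qed
  also have "(-1) ^ n * (fact (2 * n) * poly_integral \<dots>) = (fact n)\<^sup>2 / (2 * real n + 1)"
  proof -
    have "(fact (n + n + 1) :: real) = (2 * real n + 1) * fact (2 * n)"
      by (simp flip: mult_2)
    then have "fact (2 * n) * poly_integral ([:0, 1:] ^ n * [:-1, 1:] ^ n)
        = (-1) ^ n * ((fact n)\<^sup>2 / (2 * real n + 1))"
      unfolding poly_integral_beta by (simp add: power2_eq_square del: fact_Suc One_nat_def)
    \<comment> \<open>The sign of the Beta integral cancels the one left by the \<open>n\<close>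
      integrations by parts.\<close>
    then show ?thesis by (metis minus_one_mult_self mult.assoc mult_1)
  qed
  finally show ?thesis .
qed

section \<open>Comparison with the analytic form of the Legendre polynomials\<close>

lemma deriv_funpow_poly: "(deriv ^^ k) (poly p) = poly ((pderiv ^^ k) p)" for p :: "real poly"
proof (induction k)
  case (Suc k)
  have "deriv (poly q) = poly (pderiv q)" for q :: "real poly"
    by (rule ext) (simp add: DERIV_imp_deriv)
  then show ?case using Suc by simp
qed simp

lemma legendre_eq_poly: "legendre n x = sqrt (2 * real n + 1) / fact n * poly (rodrigues n) x"
proof -
  have "(\<lambda>y. y ^ n * (y - 1) ^ n) = poly ([:0, -1, 1:] ^ n :: real poly)"
  proof
    fix y :: real
    have "y * (y - 1) = poly [:0, -1, 1:] y" by (simp add: algebra_simps)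
    then show "y ^ n * (y - 1) ^ n = poly ([:0, -1, 1:] ^ n) y"
      by (metis poly_power power_mult_distrib)
  qed
  then show ?thesis by (simp add: legendre_def deriv_funpow_poly rodrigues_def)
qed

lemma continuous_on_legendre [continuous_intros]:
  "continuous_on S f \<Longrightarrow> continuous_on S (\<lambda>x. legendre n (f x))"
  unfolding legendre_eq_poly by (intro continuous_intros)

lemma legendre_orthonormal:
  "integral {0..1} (\<lambda>x. legendre i x * legendre j x) = (if i = j then 1 else 0)"
proof -
  define a where "a = (\<lambda>n. sqrt (2 * real n + 1) / fact n)"
  have "integral {0..1} (\<lambda>x. legendre i x * legendre j x)
      = poly_integral (smult (a i * a j) (rodrigues i * rodrigues j))"
    unfolding poly_integral_def legendre_eq_poly a_def by (intro arg_cong2[where f = integral] refl ext) simp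
  also have "\<dots> = a i * a j * poly_integral (rodrigues i * rodrigues j)"
    by (rule poly_integral_smult)
  also have "\<dots> = (if i = j then 1 else 0)"
  proof (cases i j rule: linorder_cases)
    case less
    then show ?thesis using poly_integral_rodrigues_less[of i j] by (simp add: mult.commute)
  next
    case equal
    have "a j * a j = (2 * real j + 1) / (fact j)\<^sup>2"
      by (simp add: a_def power2_eq_square)
    then show ?thesis using equal by (simp add: poly_integral_rodrigues_square)
  next
    case greater
    then show ?thesis using poly_integral_rodrigues_less[of j i] by simp
  qed
  finally show ?thesis .
qed

lemma legendre_0: "legendre 0 x = 1"
  by (simp add: legendre_def)

lemma legendre_1: "legendre (Suc 0) x = sqrt 3 * (2 * x - 1)"
  by (simp add: legendre_eq_poly rodrigues_def pderiv_pCons)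

lemma legendre_2: "legendre 2 x = sqrt 5 * (6 * x\<^sup>2 - 6 * x + 1)"
  by (simp add: legendre_eq_poly rodrigues_def pderiv_pCons numeral_2_eq_2 field_simps)

section \<open>Stage operators and error estimates\<close>

text \<open>Restricting the measure turns the set integrals of the definitions into plain Bochner
  integrals for a measure of total mass 1.\<close>

abbreviation unit_lebesgue :: "real measure" where
  "unit_lebesgue \<equiv> lebesgue_on {0..1}"

lemma finite_measure_unit_lebesgue: "finite_measure unit_lebesgue"
  by (rule finite_measureI) (simp add: emeasure_restrict_space)

lemma integrable_unit_lebesgue_bounded:
  fixes u :: "real \<Rightarrow> 'b::{banach, second_countable_topology}"
  assumes "u \<in> borel_measurable unit_lebesgue" "AE \<sigma> in unit_lebesgue. norm (u \<sigma>) \<le> c"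
  shows "integrable unit_lebesgue u"
  using finite_measure.integrable_const_bound[OF finite_measure_unit_lebesgue assms(2,1)] .

text \<open>The mass is 1, so the bound passes to the integral; for a non-integrable
  \<open>u\<close> the integral is 0 by convention, and \<open>0 \<le> c\<close> settles that
  case.\<close>

lemma norm_integral_unit_lebesgue_le:
  fixes u :: "real \<Rightarrow> 'b::{banach, second_countable_topology}"
  assumes "AE \<sigma> in unit_lebesgue. norm (u \<sigma>) \<le> c" "0 \<le> c"
  shows "norm (LINT \<sigma>|unit_lebesgue. u \<sigma>) \<le> c"
proof (cases "integrable unit_lebesgue u")
  case True
  have "norm (LINT \<sigma>|unit_lebesgue. u \<sigma>) \<le> (LINT \<sigma>|unit_lebesgue. norm (u \<sigma>))"
    by (rule integral_norm_bound)
  also have "\<dots> \<le> (LINT \<sigma>|unit_lebesgue. c)"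
    using True assms finite_measure.integrable_const[OF finite_measure_unit_lebesgue]
    by (intro integral_mono_AE) auto
  also have "\<dots> = c" by (simp add: measure_restrict_space)
  finally show ?thesis .
qed (simp add: not_integrable_integral_eq assms)

text \<open>Integrability of every row says nothing about measurability in \<tau>.
  \<open>measurable_apply\<close> records what joint measurability of \<open>A\<close> provides, so
  that stage iterates and defects are measurable functions of \<tau>.\<close>

locale csRK_kernel =
  fixes A :: "real \<Rightarrow> real \<Rightarrow> real" and M :: real
  assumes row_integrable: "\<tau> \<in> {0..1} \<Longrightarrow> integrable unit_lebesgue (A \<tau>)"
    and row_bound: "\<tau> \<in> {0..1} \<Longrightarrow> (LINT \<sigma>|unit_lebesgue. \<bar>A \<tau> \<sigma>\<bar>) \<le> M"
    and measurable_apply: "\<And>u c. u \<in> borel_measurable unit_lebesgue \<Longrightarrow>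
      (\<And>\<sigma>. \<sigma> \<in> {0..1} \<Longrightarrow> \<bar>u \<sigma>\<bar> \<le> c) \<Longrightarrow>
      (\<lambda>\<tau>. LINT \<sigma>|unit_lebesgue. A \<tau> \<sigma> * u \<sigma>) \<in> borel_measurable unit_lebesgue"
begin

text \<open>Vector valued, since it is applied both to right-hand sides and to scalar weights; on
  the reals \<open>*\<^sub>R\<close> is multiplication.\<close>

definition stage_op :: "(real \<Rightarrow> 'b::euclidean_space) \<Rightarrow> real \<Rightarrow> 'b" where
  "stage_op u \<tau> = (LINT \<sigma>|unit_lebesgue. A \<tau> \<sigma> *\<^sub>R u \<sigma>)"

lemma M_nonneg: "0 \<le> M"
  using order_trans[OF _ row_bound[of 0]] by (simp add: integral_nonneg_AE)

lemma stage_integrable: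
  fixes u :: "real \<Rightarrow> 'b::euclidean_space"
  assumes "u \<in> borel_measurable unit_lebesgue" "AE \<sigma> in unit_lebesgue. norm (u \<sigma>) \<le> c"
    and "\<tau> \<in> {0..1}"
  shows "integrable unit_lebesgue (\<lambda>\<sigma>. A \<tau> \<sigma> *\<^sub>R u \<sigma>)"
proof (rule Bochner_Integration.integrable_bound)
  show "integrable unit_lebesgue (\<lambda>\<sigma>. c * A \<tau> \<sigma>)"
    using row_integrable[OF assms(3)] by simp
  show "(\<lambda>\<sigma>. A \<tau> \<sigma> *\<^sub>R u \<sigma>) \<in> borel_measurable unit_lebesgue"
    using assms(1) row_integrable[OF assms(3)] by measurable
  show "AE \<sigma> in unit_lebesgue. norm (A \<tau> \<sigma> *\<^sub>R u \<sigma>) \<le> norm (c * A \<tau> \<sigma>)"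
    using assms(2)
  proof eventually_elim
    case (elim \<sigma>)
    then have "\<bar>A \<tau> \<sigma>\<bar> * norm (u \<sigma>) \<le> \<bar>A \<tau> \<sigma>\<bar> * \<bar>c\<bar>" by (intro mult_left_mono) auto
    then show ?case by (simp add: abs_mult mult.commute)
  qed
qed

lemma norm_stage_op_le:
  fixes u :: "real \<Rightarrow> 'b::euclidean_space"
  assumes "AE \<sigma> in unit_lebesgue. norm (u \<sigma>) \<le> c" "0 \<le> c" "\<tau> \<in> {0..1}"
  shows "norm (stage_op u \<tau>) \<le> c * M"
proof (cases "integrable unit_lebesgue (\<lambda>\<sigma>. A \<tau> \<sigma> *\<^sub>R u \<sigma>)")
  case True
  have "norm (stage_op u \<tau>) \<le> (LINT \<sigma>|unit_lebesgue. norm (A \<tau> \<sigma> *\<^sub>R u \<sigma>))"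
    unfolding stage_op_def by (rule integral_norm_bound)
  also have "\<dots> \<le> (LINT \<sigma>|unit_lebesgue. c * \<bar>A \<tau> \<sigma>\<bar>)"
  proof (rule integral_mono_AE)
    show "integrable unit_lebesgue (\<lambda>\<sigma>. c * \<bar>A \<tau> \<sigma>\<bar>)"
      using row_integrable[OF assms(3)] by simp
    show "AE \<sigma> in unit_lebesgue. norm (A \<tau> \<sigma> *\<^sub>R u \<sigma>) \<le> c * \<bar>A \<tau> \<sigma>\<bar>"
      using assms(1) by eventually_elim (simp add: mult.commute mult_right_mono)
  qed (rule integrable_norm[OF True])
  also have "\<dots> \<le> c * M" using row_bound[OF assms(3)] assms(2) by (simp add: mult_left_mono)
  finally show ?thesis .
qed (use assms(2) M_nonneg in \<open>simp add: stage_op_def not_integrable_integral_eq\<close>)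

text \<open>\<open>measurable_apply\<close> speaks of real functions, so the vector case is read off
  coordinate by coordinate; integrability of the stage integrand allows exchanging inner product and
  integral.\<close>

lemma measurable_stage_op:
  fixes u :: "real \<Rightarrow> 'b::euclidean_space"
  assumes u: "u \<in> borel_measurable unit_lebesgue" "\<And>\<sigma>. \<sigma> \<in> {0..1} \<Longrightarrow> norm (u \<sigma>) \<le> c"
  shows "stage_op u \<in> borel_measurable unit_lebesgue"
proof (subst borel_measurable_euclidean_space, intro ballI)
  fix b :: 'b assume b: "b \<in> Basis"
  have "(\<lambda>\<tau>. LINT \<sigma>|unit_lebesgue. A \<tau> \<sigma> * (u \<sigma> \<bullet> b)) \<in> borel_measurable unit_lebesgue"
  proof (rule measurable_apply)
    show "\<bar>u \<sigma> \<bullet> b\<bar> \<le> c" if "\<sigma> \<in> {0..1}" for \<sigma>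
      using Basis_le_norm[OF b, of "u \<sigma>"] u(2)[OF that] by linarith
  qed (use u(1) in measurable)
  moreover have "stage_op u \<tau> \<bullet> b = (LINT \<sigma>|unit_lebesgue. A \<tau> \<sigma> * (u \<sigma> \<bullet> b))"
    if "\<tau> \<in> {0..1}" for \<tau>
  proof -
    have "integrable unit_lebesgue (\<lambda>\<sigma>. A \<tau> \<sigma> *\<^sub>R u \<sigma>)"
      using u that by (intro stage_integrable[where c = c]) (auto intro!: AE_I2)
    then show ?thesis by (simp add: stage_op_def flip: integral_inner_left)
  qed
  ultimately show "(\<lambda>\<tau>. stage_op u \<tau> \<bullet> b) \<in> borel_measurable unit_lebesgue"
    by (subst measurable_cong) auto
qed

lemma stage_op_diff:
  fixes u v :: "real \<Rightarrow> 'b::euclidean_space"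
  assumes "integrable unit_lebesgue (\<lambda>\<sigma>. A \<tau> \<sigma> *\<^sub>R u \<sigma>)" "integrable unit_lebesgue (\<lambda>\<sigma>. A \<tau> \<sigma> *\<^sub>R v \<sigma>)"
  shows "stage_op (\<lambda>\<sigma>. u \<sigma> - v \<sigma>) \<tau> = stage_op u \<tau> - stage_op v \<tau>"
  using assms by (simp add: stage_op_def scaleR_diff_right)

lemma stage_op_scaleR:
  fixes u :: "real \<Rightarrow> 'b::euclidean_space"
  shows "stage_op (\<lambda>\<sigma>. c *\<^sub>R u \<sigma>) \<tau> = c *\<^sub>R stage_op u \<tau>"
  unfolding stage_op_def by (subst scaleR_left_commute) (rule integral_scaleR_right)

lemma stage_op_scaleR_left:
  assumes "integrable unit_lebesgue (\<lambda>\<sigma>. A \<tau> \<sigma> * r \<sigma>)"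
  shows "stage_op (\<lambda>\<sigma>. r \<sigma> *\<^sub>R v) \<tau> = stage_op r \<tau> *\<^sub>R (v :: 'b::euclidean_space)"
  unfolding stage_op_def using integral_scaleR_left[of v unit_lebesgue "\<lambda>\<sigma>. A \<tau> \<sigma> * r \<sigma>"] assms
  by simp

end

text \<open>Estimates which are uniform over a family of step sizes \<open>h w\<close>, \<open>w \<in> \<Omega>\<close>, and hold for almost
  every stage \<open>\<tau>\<close>.\<close>

locale csRK_family = csRK_kernel +
  fixes \<Omega> :: "'w set" and h :: "'w \<Rightarrow> real"
  assumes h_pos: "w \<in> \<Omega> \<Longrightarrow> 0 < h w" and h_le_1: "w \<in> \<Omega> \<Longrightarrow> h w \<le> 1"
begin

text \<open>The constant is uniform in \<open>w\<close>, whereas the exceptional null set may depend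
  on \<open>w\<close>. This suffices, as \<tau> is integrated out for each \<open>w\<close>
  separately.\<close>

definition bigO_h :: "nat \<Rightarrow> ('w \<Rightarrow> real \<Rightarrow> 'b::euclidean_space) \<Rightarrow> bool" where
  "bigO_h k X \<longleftrightarrow> (\<exists>K\<ge>0. \<forall>w\<in>\<Omega>. AE \<tau> in unit_lebesgue. norm (X w \<tau>) \<le> K * h w ^ k)"

lemma bigO_hI:
  assumes "\<And>w. w \<in> \<Omega> \<Longrightarrow> AE \<tau> in unit_lebesgue. norm (X w \<tau>) \<le> K * h w ^ k"
  shows "bigO_h k X"
  unfolding bigO_h_def
proof (intro exI[of _ "\<bar>K\<bar>"] conjI ballI)
  fix w assume w: "w \<in> \<Omega>"
  have "K * h w ^ k \<le> \<bar>K\<bar> * h w ^ k" using h_pos[OF w] by (intro mult_right_mono) auto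
  then show "AE \<tau> in unit_lebesgue. norm (X w \<tau>) \<le> \<bar>K\<bar> * h w ^ k"
    using assms[OF w] by (auto elim!: eventually_mono)
qed simp

lemma bigO_h_add:
  assumes "bigO_h k X" "bigO_h k Y"
  shows "bigO_h k (\<lambda>w \<tau>. X w \<tau> + Y w \<tau>)"
proof -
  obtain K1 K2 where
    1: "\<And>w. w \<in> \<Omega> \<Longrightarrow> AE \<tau> in unit_lebesgue. norm (X w \<tau>) \<le> K1 * h w ^ k" and
    2: "\<And>w. w \<in> \<Omega> \<Longrightarrow> AE \<tau> in unit_lebesgue. norm (Y w \<tau>) \<le> K2 * h w ^ k"
    using assms unfolding bigO_h_def by blast
  show ?thesis
  proof (rule bigO_hI[where K = "K1 + K2"])
    fix w assume w: "w \<in> \<Omega>"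
    show "AE \<tau> in unit_lebesgue. norm (X w \<tau> + Y w \<tau>) \<le> (K1 + K2) * h w ^ k"
      using 1[OF w] 2[OF w]
      by eventually_elim (simp add: distrib_right norm_triangle_mono)
  qed
qed

text \<open>Scalings by powers of \<open>h\<close>, bounded factors and weakening of the exponent are all
  instances of the following rule.\<close>

lemma bigO_h_bound:
  assumes "bigO_h l X" "k \<le> l + m"
    and "\<And>w \<tau>. w \<in> \<Omega> \<Longrightarrow> \<tau> \<in> {0..1} \<Longrightarrow> norm (Y w \<tau>) \<le> c * h w ^ m * norm (X w \<tau>)"
  shows "bigO_h k Y"
proof -
  obtain K where "K \<ge> 0"
    and K: "\<And>w. w \<in> \<Omega> \<Longrightarrow> AE \<tau> in unit_lebesgue. norm (X w \<tau>) \<le> K * h w ^ l"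
    using assms unfolding bigO_h_def by blast
  show ?thesis
  proof (rule bigO_hI[where K = "\<bar>c\<bar> * K"])
    fix w assume w: "w \<in> \<Omega>"
    note hw = h_pos[OF w] h_le_1[OF w]
    have "AE \<tau> in unit_lebesgue. \<tau> \<in> {0..1}" by (rule AE_I2) simp
    then show "AE \<tau> in unit_lebesgue. norm (Y w \<tau>) \<le> \<bar>c\<bar> * K * h w ^ k"
      using K[OF w]
    proof eventually_elim
      case (elim \<tau>)
      have "norm (Y w \<tau>) \<le> c * h w ^ m * norm (X w \<tau>)" by (rule assms(3)[OF w elim(1)])
      also have "\<dots> \<le> (\<bar>c\<bar> * h w ^ m) * (K * h w ^ l)"
        using elim(2) hw \<open>K \<ge> 0\<close> by (intro mult_mono mult_right_mono) auto
      also have "\<dots> = \<bar>c\<bar> * K * h w ^ (l + m)" by (simp add: power_add)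
      also have "\<dots> \<le> \<bar>c\<bar> * K * h w ^ k"
        using hw \<open>K \<ge> 0\<close> assms(2) by (intro mult_left_mono power_decreasing) auto
      finally show ?case .
    qed
  qed
qed

lemma bigO_h_mono: "bigO_h l X \<Longrightarrow> k \<le> l \<Longrightarrow> bigO_h k X"
  by (rule bigO_h_bound[where m = 0 and c = 1 and X = X]) auto

lemma bigO_h_cong:
  assumes "bigO_h k X" "\<And>w \<tau>. w \<in> \<Omega> \<Longrightarrow> \<tau> \<in> {0..1} \<Longrightarrow> Y w \<tau> = X w \<tau>"
  shows "bigO_h k Y"
  by (rule bigO_h_bound[OF assms(1), where m = 0 and c = 1]) (auto simp: assms(2))

text \<open>Integration absorbs the null set of \<open>X\<close>; with the row bound
  \<open>M\<close> the estimate even holds at every \<tau>.\<close>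

lemma bigO_h_stage_op:
  assumes "bigO_h k X"
  shows "bigO_h k (\<lambda>w. stage_op (X w))"
proof -
  obtain K where "K \<ge> 0"
    and K: "\<And>w. w \<in> \<Omega> \<Longrightarrow> AE \<tau> in unit_lebesgue. norm (X w \<tau>) \<le> K * h w ^ k"
    using assms unfolding bigO_h_def by blast
  show ?thesis
  proof (rule bigO_hI[where K = "K * M"])
    fix w assume w: "w \<in> \<Omega>"
    have "norm (stage_op (X w) \<tau>) \<le> K * M * h w ^ k" if "\<tau> \<in> {0..1}" for \<tau>
      using norm_stage_op_le[OF K[OF w] _ that] \<open>K \<ge> 0\<close> h_pos[OF w] by (simp add: mult_ac)
    then show "AE \<tau> in unit_lebesgue. norm (stage_op (X w) \<tau>) \<le> K * M * h w ^ k"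
      by (intro AE_I2) simp
  qed
qed

lemma bigO_h_integral:
  assumes "bigO_h k X"
  shows "\<exists>K. \<forall>w\<in>\<Omega>. norm (LINT \<tau>|unit_lebesgue. X w \<tau>) \<le> K * h w ^ k"
proof -
  obtain K where "K \<ge> 0"
    and K: "\<And>w. w \<in> \<Omega> \<Longrightarrow> AE \<tau> in unit_lebesgue. norm (X w \<tau>) \<le> K * h w ^ k"
    using assms unfolding bigO_h_def by blast
  then show ?thesis
    using norm_integral_unit_lebesgue_le[OF K] h_pos by (intro exI[of _ K]) (auto simp: less_imp_le)
qed

end

text \<open>\<open>E\<close> stands for the stage errors, \<open>D\<close> for the resulting errors of the right-hand side, \<open>R\<close> for
  the residual of the exact solution and \<open>J\<close> for the Jacobian along it. Below, \<open>c1\<close>, \<open>c2\<close> are the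
  coefficients of the expansion of \<open>R\<close>; in \<open>j10\<close>, \<open>j11\<close>, \<open>j20\<close> the first digit refers to \<open>J c1\<close> or
  \<open>J c2\<close> and the second to the power of \<open>h\<close>, and \<open>j100\<close> is the constant term of \<open>J j10\<close>.\<close>

locale csRK_error = csRK_family A M \<Omega> h
  for A M and \<Omega> :: "'w set" and h +
  fixes E D R :: "'w \<Rightarrow> real \<Rightarrow> 'a::euclidean_space" and J :: "'w \<Rightarrow> real \<Rightarrow> 'a \<Rightarrow> 'a" and L Q :: real
  assumes D_measurable: "w \<in> \<Omega> \<Longrightarrow> D w \<in> borel_measurable unit_lebesgue"
    and D_bounded: "w \<in> \<Omega> \<Longrightarrow> \<exists>c. \<forall>\<tau>\<in>{0..1}. norm (D w \<tau>) \<le> c"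
    and E_eq: "w \<in> \<Omega> \<Longrightarrow> \<tau> \<in> {0..1} \<Longrightarrow> E w \<tau> = h w *\<^sub>R stage_op (D w) \<tau> + R w \<tau>"
    and J_linear: "w \<in> \<Omega> \<Longrightarrow> \<tau> \<in> {0..1} \<Longrightarrow> linear (J w \<tau>)"
    and J_bounded: "w \<in> \<Omega> \<Longrightarrow> \<tau> \<in> {0..1} \<Longrightarrow> norm (J w \<tau> v) \<le> L * norm v"
    and D_Lipschitz: "w \<in> \<Omega> \<Longrightarrow> \<tau> \<in> {0..1} \<Longrightarrow> norm (D w \<tau>) \<le> L * norm (E w \<tau>)"
    and D_remainder: "w \<in> \<Omega> \<Longrightarrow> \<tau> \<in> {0..1} \<Longrightarrow>
      norm (D w \<tau> - J w \<tau> (E w \<tau>)) \<le> Q * (norm (E w \<tau>))\<^sup>2"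
    and E_bigO_1: "bigO_h 1 E"
    and R_bigO_2: "bigO_h 2 R"
begin

lemma D_AE_bounded: "w \<in> \<Omega> \<Longrightarrow> \<exists>c. AE \<tau> in unit_lebesgue. norm (D w \<tau>) \<le> c"
proof -
  assume "w \<in> \<Omega>"
  then obtain c where "\<forall>\<tau>\<in>{0..1}. norm (D w \<tau>) \<le> c" using D_bounded by blast
  then show ?thesis by (intro exI[of _ c] AE_I2) simp
qed

lemma integrable_D: "w \<in> \<Omega> \<Longrightarrow> integrable unit_lebesgue (D w)"
  using D_AE_bounded integrable_unit_lebesgue_bounded[OF D_measurable] by blast

lemma stage_integrable_D:
  "w \<in> \<Omega> \<Longrightarrow> \<tau> \<in> {0..1} \<Longrightarrow> integrable unit_lebesgue (\<lambda>\<sigma>. A \<tau> \<sigma> *\<^sub>R D w \<sigma>)"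
  using D_AE_bounded stage_integrable[OF D_measurable] by blast

lemma D_bigO: "bigO_h k E \<Longrightarrow> bigO_h k D"
  by (rule bigO_h_bound[where m = 0 and c = L and X = E]) (auto simp: D_Lipschitz)

text \<open>A bootstrap: the a priori bound \<open>E_bigO_1\<close> makes \<open>D\<close> of size
  h, and the factor h in \<open>E_eq\<close> gains one power.\<close>

lemma E_bigO_2: "bigO_h 2 E"
proof (rule bigO_h_cong[OF bigO_h_add E_eq])
  show "bigO_h 2 (\<lambda>w \<tau>. h w *\<^sub>R stage_op (D w) \<tau>)"
    by (rule bigO_h_bound[OF bigO_h_stage_op[OF D_bigO[OF E_bigO_1]], where m = 1 and c = 1])
      (auto simp: h_pos less_imp_le)
qed (rule R_bigO_2)

lemma D_bigO_2: "bigO_h 2 D"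
  by (rule D_bigO[OF E_bigO_2])

lemma remainder_bigO_4: "bigO_h 4 (\<lambda>w \<tau>. D w \<tau> - J w \<tau> (E w \<tau>))"
proof -
  obtain K where "K \<ge> 0"
    and K: "\<And>w. w \<in> \<Omega> \<Longrightarrow> AE \<tau> in unit_lebesgue. norm (E w \<tau>) \<le> K * h w ^ 2"
    using E_bigO_2 unfolding bigO_h_def by blast
  show ?thesis
  proof (rule bigO_hI[where K = "\<bar>Q\<bar> * K\<^sup>2"])
    fix w assume w: "w \<in> \<Omega>"
    have "AE \<tau> in unit_lebesgue. \<tau> \<in> {0..1}" by (rule AE_I2) simp
    then show "AE \<tau> in unit_lebesgue. norm (D w \<tau> - J w \<tau> (E w \<tau>)) \<le> \<bar>Q\<bar> * K\<^sup>2 * h w ^ 4"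
      using K[OF w]
    proof eventually_elim
      case (elim \<tau>)
      have "norm (D w \<tau> - J w \<tau> (E w \<tau>)) \<le> Q * (norm (E w \<tau>))\<^sup>2"
        by (rule D_remainder[OF w elim(1)])
      also have "\<dots> \<le> \<bar>Q\<bar> * (K * h w ^ 2)\<^sup>2"
        using elim(2) by (intro mult_mono power_mono) auto
      also have "\<dots> = \<bar>Q\<bar> * K\<^sup>2 * h w ^ 4"
        by (simp add: power_mult_distrib flip: power_mult)
      finally show ?case .
    qed
  qed
qed

lemma J_bigO: "bigO_h k X \<Longrightarrow> bigO_h k (\<lambda>w \<tau>. J w \<tau> (X w \<tau>))"
  by (rule bigO_h_bound[where m = 0 and c = L and X = X]) (auto simp: J_bounded)

lemma weight_bigO:
  fixes X :: "'w \<Rightarrow> real \<Rightarrow> 'b::euclidean_space"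
  assumes "bigO_h k X" "\<And>\<tau>. \<tau> \<in> {0..1} \<Longrightarrow> \<bar>r \<tau>\<bar> \<le> c" "l \<le> k + m"
  shows "bigO_h l (\<lambda>w \<tau>. (h w ^ m * r \<tau>) *\<^sub>R X w \<tau>)"
proof (rule bigO_h_bound[OF assms(1,3), where c = c])
  fix w and \<tau> :: real assume *: "w \<in> \<Omega>" "\<tau> \<in> {0..1}"
  have "\<bar>r \<tau>\<bar> * (h w ^ m * norm (X w \<tau>)) \<le> c * (h w ^ m * norm (X w \<tau>))"
    using assms(2)[OF *(2)] h_pos[OF *(1)] by (intro mult_right_mono) auto
  then show "norm ((h w ^ m * r \<tau>) *\<^sub>R X w \<tau>) \<le> c * h w ^ m * norm (X w \<tau>)"
    using h_pos[OF *(1)] by (simp add: abs_mult mult_ac)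
qed

lemma order_2: "\<exists>K. \<forall>w\<in>\<Omega>. norm (LINT \<tau>|unit_lebesgue. D w \<tau>) \<le> K * h w ^ 2"
  by (rule bigO_h_integral[OF D_bigO_2])

context
  fixes r1 :: "real \<Rightarrow> real" and c1 j10 :: 'a and C1 :: real
  assumes r1: "r1 \<in> borel_measurable unit_lebesgue" "\<And>\<tau>. \<tau> \<in> {0..1} \<Longrightarrow> \<bar>r1 \<tau>\<bar> \<le> C1"
    and int_r1: "(LINT \<tau>|unit_lebesgue. r1 \<tau>) = 0"
    and R3: "bigO_h 3 (\<lambda>w \<tau>. R w \<tau> - (h w ^ 2 * r1 \<tau>) *\<^sub>R c1)"
    and J10: "bigO_h 1 (\<lambda>w \<tau>. J w \<tau> c1 - j10)"
begin

lemma integrable_weight: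
  fixes r :: "real \<Rightarrow> real"
  assumes "r \<in> borel_measurable unit_lebesgue" "\<And>\<tau>. \<tau> \<in> {0..1} \<Longrightarrow> \<bar>r \<tau>\<bar> \<le> c"
  shows "integrable unit_lebesgue r"
  by (rule integrable_unit_lebesgue_bounded[OF assms(1), of c]) (auto intro!: AE_I2 assms(2))

lemma E_expansion_3: "bigO_h 3 (\<lambda>w \<tau>. E w \<tau> - (h w ^ 2 * r1 \<tau>) *\<^sub>R c1)"
proof (rule bigO_h_cong[OF bigO_h_add[OF _ R3]])
  show "bigO_h 3 (\<lambda>w \<tau>. h w *\<^sub>R stage_op (D w) \<tau>)"
    by (rule bigO_h_bound[OF bigO_h_stage_op[OF D_bigO_2], where m = 1 and c = 1])
      (auto simp: h_pos less_imp_le)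
qed (auto simp: E_eq)

lemma D_expansion_3: "bigO_h 3 (\<lambda>w \<tau>. D w \<tau> - (h w ^ 2 * r1 \<tau>) *\<^sub>R j10)"
proof (rule bigO_h_cong)
  \<comment> \<open>The errors of linearizing (order 4), of replacing \<open>E\<close> by its
    leading term (order 3) and of freezing \<open>J\<close> at its constant term (order 2 +
    1).\<close>
  show "bigO_h 3 (\<lambda>w \<tau>. (D w \<tau> - J w \<tau> (E w \<tau>)) + J w \<tau> (E w \<tau> - (h w ^ 2 * r1 \<tau>) *\<^sub>R c1)
      + (h w ^ 2 * r1 \<tau>) *\<^sub>R (J w \<tau> c1 - j10))"
    by (intro bigO_h_add bigO_h_mono[OF remainder_bigO_4] J_bigO E_expansion_3 weight_bigO[OF J10 r1(2)])
      auto
  fix w and \<tau> :: real assume *: "w \<in> \<Omega>" "\<tau> \<in> {0..1}"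
  show "D w \<tau> - (h w ^ 2 * r1 \<tau>) *\<^sub>R j10 = (D w \<tau> - J w \<tau> (E w \<tau>))
      + J w \<tau> (E w \<tau> - (h w ^ 2 * r1 \<tau>) *\<^sub>R c1) + (h w ^ 2 * r1 \<tau>) *\<^sub>R (J w \<tau> c1 - j10)"
    using J_linear[OF *] by (simp add: linear_diff linear_scale algebra_simps)
qed

text \<open>Subtracting the leading term leaves the integral unchanged because \<open>r1\<close> has
  mean zero, so the remainder estimate applies to the integral of \<open>D\<close> itself.\<close>

lemma order_3: "\<exists>K. \<forall>w\<in>\<Omega>. norm (LINT \<tau>|unit_lebesgue. D w \<tau>) \<le> K * h w ^ 3"
proof -
  have "(LINT \<tau>|unit_lebesgue. D w \<tau> - (h w ^ 2 * r1 \<tau>) *\<^sub>R j10) = (LINT \<tau>|unit_lebesgue. D w \<tau>)"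
    if "w \<in> \<Omega>" for w
    using integrable_D[OF that] integrable_weight[OF r1] by (simp add: int_r1)
  then show ?thesis using bigO_h_integral[OF D_expansion_3] by auto
qed

context
  fixes r2 :: "real \<Rightarrow> real" and c2 j11 j20 j100 :: 'a and C2 :: real
  assumes r2: "r2 \<in> borel_measurable unit_lebesgue" "\<And>\<tau>. \<tau> \<in> {0..1} \<Longrightarrow> \<bar>r2 \<tau>\<bar> \<le> C2"
    and int_r2: "(LINT \<tau>|unit_lebesgue. r2 \<tau>) = 0"
    and int_r1': "(LINT \<tau>|unit_lebesgue. \<tau> * r1 \<tau>) = 0"
    and int_op_r1: "(LINT \<tau>|unit_lebesgue. stage_op r1 \<tau>) = 0"
    and R4: "bigO_h 4 (\<lambda>w \<tau>. R w \<tau> - (h w ^ 2 * r1 \<tau>) *\<^sub>R c1 - (h w ^ 3 * r2 \<tau>) *\<^sub>R c2)"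
    and J11: "bigO_h 2 (\<lambda>w \<tau>. J w \<tau> c1 - j10 - (h w * \<tau>) *\<^sub>R j11)"
    and J20: "bigO_h 1 (\<lambda>w \<tau>. J w \<tau> c2 - j20)"
    and J100: "bigO_h 1 (\<lambda>w \<tau>. J w \<tau> j10 - j100)"
begin

lemma stage_op_r1: "stage_op r1 \<in> borel_measurable unit_lebesgue"
  "\<tau> \<in> {0..1} \<Longrightarrow> \<bar>stage_op r1 \<tau>\<bar> \<le> \<bar>C1\<bar> * M"
proof -
  have le: "\<bar>r1 \<sigma>\<bar> \<le> \<bar>C1\<bar>" if "\<sigma> \<in> {0..1}" for \<sigma> using r1(2)[OF that] by linarith
  then show "\<tau> \<in> {0..1} \<Longrightarrow> \<bar>stage_op r1 \<tau>\<bar> \<le> \<bar>C1\<bar> * M"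
    using norm_stage_op_le[of r1 "\<bar>C1\<bar>" \<tau>] AE_I2[of unit_lebesgue "\<lambda>\<sigma>. norm (r1 \<sigma>) \<le> \<bar>C1\<bar>"]
    by simp
  show "stage_op r1 \<in> borel_measurable unit_lebesgue"
    using measurable_stage_op[OF r1(1), of C1] r1(2) by simp
qed

text \<open>One more pass through \<open>E_eq\<close>: inserting the expansion of \<open>D\<close>
  adds \<open>stage_op r1\<close> at h^3 to the two terms of the residual.\<close>

lemma E_expansion_4: "bigO_h 4 (\<lambda>w \<tau>. E w \<tau> - ((h w ^ 2 * r1 \<tau>) *\<^sub>R c1 + (h w ^ 3 * r2 \<tau>) *\<^sub>R c2
    + (h w ^ 3 * stage_op r1 \<tau>) *\<^sub>R j10))"
proof (rule bigO_h_cong[OF bigO_h_add[OF R4]])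
  show "bigO_h 4 (\<lambda>w \<tau>. h w *\<^sub>R stage_op (\<lambda>\<sigma>. D w \<sigma> - (h w ^ 2 * r1 \<sigma>) *\<^sub>R j10) \<tau>)"
    by (rule bigO_h_bound[OF bigO_h_stage_op[OF D_expansion_3], where m = 1 and c = 1])
      (auto simp: h_pos less_imp_le)
  fix w and \<tau> :: real assume *: "w \<in> \<Omega>" "\<tau> \<in> {0..1}"
  have i: "integrable unit_lebesgue (\<lambda>\<sigma>. A \<tau> \<sigma> *\<^sub>R r1 \<sigma>)"
    using r1 by (intro stage_integrable[where c = C1] * AE_I2) auto
  have "stage_op (\<lambda>\<sigma>. (h w ^ 2 * r1 \<sigma>) *\<^sub>R j10) \<tau> = (h w ^ 2 * stage_op r1 \<tau>) *\<^sub>R j10"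
    using stage_op_scaleR[of "h w ^ 2" "\<lambda>\<sigma>. r1 \<sigma> *\<^sub>R j10" \<tau>] stage_op_scaleR_left[of \<tau> r1 j10] i
    by simp
  moreover have "stage_op (\<lambda>\<sigma>. D w \<sigma> - (h w ^ 2 * r1 \<sigma>) *\<^sub>R j10) \<tau>
      = stage_op (D w) \<tau> - stage_op (\<lambda>\<sigma>. (h w ^ 2 * r1 \<sigma>) *\<^sub>R j10) \<tau>"
  proof (rule stage_op_diff[OF stage_integrable_D[OF *]])
    have "integrable unit_lebesgue (\<lambda>\<sigma>. (h w ^ 2 * (A \<tau> \<sigma> *\<^sub>R r1 \<sigma>)) *\<^sub>R j10)"
      by (intro integrable_scaleR_left integrable_mult_right i)
    then show "integrable unit_lebesgue (\<lambda>\<sigma>. A \<tau> \<sigma> *\<^sub>R (h w ^ 2 * r1 \<sigma>) *\<^sub>R j10)"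
      by (simp add: mult_ac)
  qed
  ultimately show "E w \<tau> - ((h w ^ 2 * r1 \<tau>) *\<^sub>R c1 + (h w ^ 3 * r2 \<tau>) *\<^sub>R c2
      + (h w ^ 3 * stage_op r1 \<tau>) *\<^sub>R j10)
    = R w \<tau> - (h w ^ 2 * r1 \<tau>) *\<^sub>R c1 - (h w ^ 3 * r2 \<tau>) *\<^sub>R c2
      + h w *\<^sub>R stage_op (\<lambda>\<sigma>. D w \<sigma> - (h w ^ 2 * r1 \<sigma>) *\<^sub>R j10) \<tau>"
    using E_eq[OF *] by (simp add: scaleR_diff_right power2_eq_square power3_eq_cube mult_ac)
qed

text \<open>The weights at h^3 arise in three ways: the linear term of \<open>J c1\<close> against
  \<open>r1\<close> gives \<tau> times \<open>r1\<close>, the second residual term gives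
  \<open>r2\<close>, and the feedback through the stages gives \<open>stage_op r1\<close>. Only
  against h^2 must \<open>J\<close> be known beyond its constant term.\<close>

lemma D_expansion_4: "bigO_h 4 (\<lambda>w \<tau>. D w \<tau> - ((h w ^ 2 * r1 \<tau>) *\<^sub>R j10
    + (h w ^ 3 * (\<tau> * r1 \<tau>)) *\<^sub>R j11 + (h w ^ 3 * r2 \<tau>) *\<^sub>R j20
    + (h w ^ 3 * stage_op r1 \<tau>) *\<^sub>R j100))"
proof (rule bigO_h_cong)
  let ?e = "\<lambda>w \<tau>. (h w ^ 2 * r1 \<tau>) *\<^sub>R c1 + (h w ^ 3 * r2 \<tau>) *\<^sub>R c2
    + (h w ^ 3 * stage_op r1 \<tau>) *\<^sub>R j10"
  let ?X = "\<lambda>w \<tau>. (D w \<tau> - J w \<tau> (E w \<tau>)) + J w \<tau> (E w \<tau> - ?e w \<tau>)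
      + (h w ^ 2 * r1 \<tau>) *\<^sub>R (J w \<tau> c1 - j10 - (h w * \<tau>) *\<^sub>R j11)
      + (h w ^ 3 * r2 \<tau>) *\<^sub>R (J w \<tau> c2 - j20)
      + (h w ^ 3 * stage_op r1 \<tau>) *\<^sub>R (J w \<tau> j10 - j100)"
  show "bigO_h 4 ?X"
    by (intro bigO_h_add remainder_bigO_4 J_bigO E_expansion_4 weight_bigO[OF J11 r1(2)]
        weight_bigO[OF J20 r2(2)] weight_bigO[OF J100 stage_op_r1(2)]) auto
  fix w and \<tau> :: real assume *: "w \<in> \<Omega>" "\<tau> \<in> {0..1}"
  have "J w \<tau> (E w \<tau> - ?e w \<tau>) = J w \<tau> (E w \<tau>) - ((h w ^ 2 * r1 \<tau>) *\<^sub>R J w \<tau> c1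
      + (h w ^ 3 * r2 \<tau>) *\<^sub>R J w \<tau> c2 + (h w ^ 3 * stage_op r1 \<tau>) *\<^sub>R J w \<tau> j10)"
    using J_linear[OF *] by (simp add: linear_diff linear_add linear_scale)
  then show "D w \<tau> - ((h w ^ 2 * r1 \<tau>) *\<^sub>R j10
    + (h w ^ 3 * (\<tau> * r1 \<tau>)) *\<^sub>R j11 + (h w ^ 3 * r2 \<tau>) *\<^sub>R j20
    + (h w ^ 3 * stage_op r1 \<tau>) *\<^sub>R j100) = ?X w \<tau>"
    by (simp add: scaleR_diff_right power2_eq_square power3_eq_cube mult_ac)
qed

lemma order_4: "\<exists>K. \<forall>w\<in>\<Omega>. norm (LINT \<tau>|unit_lebesgue. D w \<tau>) \<le> K * h w ^ 4"
proof -
  have \<tau>r1: "(\<lambda>\<tau>. \<tau> * r1 \<tau>) \<in> borel_measurable unit_lebesgue"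
    by (intro borel_measurable_times id_borel_measurable_lebesgue_on[unfolded id_def] r1(1))
  have "\<bar>\<tau> * r1 \<tau>\<bar> \<le> C1" if "\<tau> \<in> {0..1}" for \<tau>
    using mult_mono[of "\<bar>\<tau>\<bar>" 1 "\<bar>r1 \<tau>\<bar>" C1] r1(2)[OF that] that by (auto simp: abs_mult)
  note i = integrable_weight[OF \<tau>r1 this] integrable_weight[OF r1] integrable_weight[OF r2]
    integrable_weight[OF stage_op_r1]
  have "(LINT \<tau>|unit_lebesgue. D w \<tau> - ((h w ^ 2 * r1 \<tau>) *\<^sub>R j10
    + (h w ^ 3 * (\<tau> * r1 \<tau>)) *\<^sub>R j11 + (h w ^ 3 * r2 \<tau>) *\<^sub>R j20
    + (h w ^ 3 * stage_op r1 \<tau>) *\<^sub>R j100)) = (LINT \<tau>|unit_lebesgue. D w \<tau>)"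
    if "w \<in> \<Omega>" for w
    using integrable_D[OF that] i by (simp add: int_r1 int_r2 int_r1' int_op_r1)
  then show ?thesis using bigO_h_integral[OF D_expansion_4] by auto
qed

end

end

end

section \<open>Square integrable functions on the unit square\<close>

definition square_integrable :: "'a measure \<Rightarrow> ('a \<Rightarrow> real) \<Rightarrow> bool" where
  "square_integrable M f \<longleftrightarrow> f \<in> borel_measurable M \<and> integrable M (\<lambda>x. (f x)\<^sup>2)"

lemma square_integrable_mult:
  assumes "square_integrable M f" "square_integrable M g"
  shows "integrable M (\<lambda>x. f x * g x)"
proof (rule Bochner_Integration.integrable_bound)
  show "integrable M (\<lambda>x. (f x)\<^sup>2 + (g x)\<^sup>2)"
    using assms by (auto simp: square_integrable_def)
  show "(\<lambda>x. f x * g x) \<in> borel_measurable M"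
    using assms by (auto simp: square_integrable_def)
  have "\<bar>a * b\<bar> \<le> a\<^sup>2 + b\<^sup>2" for a b :: real
  proof -
    have "0 \<le> (\<bar>a\<bar> - \<bar>b\<bar>)\<^sup>2" by simp
    also have "\<dots> = a\<^sup>2 + b\<^sup>2 - 2 * \<bar>a * b\<bar>" by (simp add: power2_diff abs_mult)
    finally show ?thesis by (smt (verit) abs_ge_zero)
  qed
  then show "AE x in M. norm (f x * g x) \<le> norm ((f x)\<^sup>2 + (g x)\<^sup>2)"
    by (intro AE_I2) (simp add: abs_of_nonneg)
qed

lemma square_integrable_cauchy_schwarz:
  assumes "square_integrable M f" "square_integrable M g"
  shows "(\<integral>x. f x * g x \<partial>M)\<^sup>2 \<le> (\<integral>x. (f x)\<^sup>2 \<partial>M) * (\<integral>x. (g x)\<^sup>2 \<partial>M)"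
proof -
  define a b c where "a = (\<integral>x. (f x)\<^sup>2 \<partial>M)" and "b = (\<integral>x. (g x)\<^sup>2 \<partial>M)"
    and "c = (\<integral>x. f x * g x \<partial>M)"
  have i: "integrable M (\<lambda>x. (f x)\<^sup>2)" "integrable M (\<lambda>x. (g x)\<^sup>2)" "integrable M (\<lambda>x. f x * g x)"
    using assms square_integrable_mult by (auto simp: square_integrable_def)
  have pos: "0 \<le> a - 2 * t * c + t\<^sup>2 * b" for t
  proof -
    have "0 \<le> (\<integral>x. (f x - t * g x)\<^sup>2 \<partial>M)" by (intro integral_nonneg_AE) auto
    also have "\<dots> = (\<integral>x. (f x)\<^sup>2 - 2 * t * (f x * g x) + t\<^sup>2 * (g x)\<^sup>2 \<partial>M)"
      by (intro Bochner_Integration.integral_cong refl) (simp add: power2_diff power_mult_distrib)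
    also have "\<dots> = a - 2 * t * c + t\<^sup>2 * b" using i by (simp add: a_def b_def c_def)
    finally show ?thesis .
  qed
  have "0 \<le> b" unfolding b_def by (intro integral_nonneg_AE) auto
  show ?thesis
  proof (cases "b = 0")
    case True
    \<comment> \<open>With \<open>b = 0\<close> the quadratic in \<open>t\<close> is affine; if
      \<open>c\<close> were nonzero, the chosen \<open>t\<close> would give it the value -1.\<close>
    have "c = 0"
    proof (rule ccontr)
      assume "c \<noteq> 0"
      then have "2 * ((a + 1) / (2 * c)) * c = a + 1" by simp
      then show False using pos[of "(a + 1) / (2 * c)"] True by simp
    qed
    then show ?thesis using True by (simp add: a_def b_def c_def)
  next
    case False
    then have "b > 0" using \<open>0 \<le> b\<close> by simp
    \<comment> \<open>The minimum of the quadratic, attained at \<open>t = c / b\<close>.\<close>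
    have "a - 2 * (c / b) * c + (c / b)\<^sup>2 * b = a - c\<^sup>2 / b"
      using \<open>b > 0\<close> by (simp add: power2_eq_square)
    then have "c\<^sup>2 / b \<le> a" using pos[of "c / b"] by simp
    then show ?thesis using \<open>b > 0\<close> by (simp add: a_def b_def c_def pos_divide_le_eq)
  qed
qed

lemma square_integrable_bounded_mult:
  assumes "square_integrable M f" "b \<in> borel_measurable M" "AE x in M. \<bar>b x\<bar> \<le> c"
  shows "square_integrable M (\<lambda>x. b x * f x)"
  unfolding square_integrable_def
proof
  show "(\<lambda>x. b x * f x) \<in> borel_measurable M" using assms by (auto simp: square_integrable_def)
  show "integrable M (\<lambda>x. (b x * f x)\<^sup>2)"
  proof (rule Bochner_Integration.integrable_bound)
    show "integrable M (\<lambda>x. c\<^sup>2 * (f x)\<^sup>2)" using assms by (auto simp: square_integrable_def)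
    show "(\<lambda>x. (b x * f x)\<^sup>2) \<in> borel_measurable M" using assms by (auto simp: square_integrable_def)
    show "AE x in M. norm ((b x * f x)\<^sup>2) \<le> norm (c\<^sup>2 * (f x)\<^sup>2)"
      using assms(3)
    proof eventually_elim
      case (elim x)
      then have "(b x)\<^sup>2 \<le> c\<^sup>2" by (metis abs_ge_zero order_trans power2_abs power_mono)
      then show ?case by (simp add: power_mult_distrib mult_right_mono)
    qed
  qed
qed

lemma square_integrable_add:
  assumes "square_integrable M f" "square_integrable M g"
  shows "square_integrable M (\<lambda>x. f x + g x)"
  using assms square_integrable_mult[OF assms]
  by (auto simp: square_integrable_def power2_sum mult.assoc)

lemma square_integrable_cmult:
  "square_integrable M f \<Longrightarrow> square_integrable M (\<lambda>x. c * f x)"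
  by (auto simp: square_integrable_def power_mult_distrib)

lemma square_integrable_zero: "square_integrable M (\<lambda>x. 0)"
  by (simp add: square_integrable_def)

lemma square_integrable_sum:
  "(\<And>i. i \<in> F \<Longrightarrow> square_integrable M (f i)) \<Longrightarrow> square_integrable M (\<lambda>x. \<Sum>i\<in>F. f i x)"
  by (induction F rule: infinite_finite_induct) (auto simp: square_integrable_zero square_integrable_add)

lemma square_integrable_diff:
  assumes "square_integrable M f" "square_integrable M g"
  shows "square_integrable M (\<lambda>x. f x - g x)"
  using square_integrable_add[OF assms(1) square_integrable_cmult[OF assms(2), of "-1"]] by simp

text \<open>A density of \<open>lborel\<close> keeps the Borel sets and the whole line as space, so
  product measures and Fubini apply directly. The product of \<open>unit_lebesgue\<close> with
  itself would not be Lebesgue measure on the square, as a product of complete measures need not be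
  complete.\<close>

definition unit_lborel :: "real measure" where
  "unit_lborel = density lborel (indicator {0..1})"

lemma space_unit_lborel [simp]: "space unit_lborel = UNIV"
  and sets_unit_lborel [simp, measurable_cong]: "sets unit_lborel = sets borel"
  by (auto simp: unit_lborel_def)

lemma emeasure_unit_lborel: "emeasure unit_lborel UNIV = 1"
  by (simp add: unit_lborel_def emeasure_density nn_integral_indicator)

interpretation unit_lborel: finite_measure unit_lborel
  by (rule finite_measureI) (simp add: emeasure_unit_lborel)

lemma measure_unit_lborel [simp]: "measure unit_lborel UNIV = 1"
  by (simp add: measure_def emeasure_unit_lborel)

interpretation unit_square: pair_sigma_finite unit_lborel unit_lborel ..

abbreviation unit_square :: "(real \<times> real) measure" where
  "unit_square \<equiv> unit_lborel \<Otimes>\<^sub>M unit_lborel"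

lemma sets_unit_square: "sets unit_square = sets borel"
  by (metis borel_prod sets_pair_measure_cong sets_unit_lborel)

lemma square_integrable_unit_lborel_measurable:
  "square_integrable unit_lborel f \<Longrightarrow> f \<in> borel_measurable borel"
  by (simp add: square_integrable_def measurable_cong_sets[OF sets_unit_lborel refl])

lemma AE_unit_lborel: "AE x in unit_lborel. x \<in> {0..1}"
  unfolding unit_lborel_def by (subst AE_density) (auto split: split_indicator_asm intro!: AE_I2)

text \<open>Links the iterated integrals of Fubini's theorem with two-dimensional Lebesgue measure,
  in which square integrability and the expansion of \<open>A\<close> are stated.\<close>

lemma unit_square_eq: "unit_square = density lborel (indicator ({0..1} \<times> {0..1}))"
proof -
  have "unit_square = density (lborel \<Otimes>\<^sub>M lborel)
      (\<lambda>(x, y). indicator {0..1} x * indicator {0..1} y)"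
    unfolding unit_lborel_def
    by (rule pair_measure_density)
      (use unit_lborel.sigma_finite_measure_axioms sigma_finite_lborel in \<open>auto simp: unit_lborel_def\<close>)
  also have "(\<lambda>(x, y). indicator {0..1} x * indicator {0..1} y) =
      (indicator ({0..1} \<times> {0..1}) :: real \<times> real \<Rightarrow> ennreal)"
    by (auto simp: fun_eq_iff split: split_indicator)
  finally show ?thesis by (simp only: lborel_prod)
qed

text \<open>Completeness: preimages under \<open>g\<close> differ from those under the Borel
  function \<open>f\<close> by subsets of null sets.\<close>

lemma AE_lebesgue_measurable:
  fixes f g :: "'a::euclidean_space \<Rightarrow> real"
  assumes "f \<in> borel_measurable borel" "AE x in lborel. g x = f x"
  shows "g \<in> borel_measurable lebesgue"
proof (rule measurableI)
  fix B :: "real set" assume B: "B \<in> sets borel"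
  have "f \<in> borel_measurable lborel" using assms(1) by simp
  then have "f -` B \<in> sets lebesgue"
    using measurable_sets[OF measurable_completion B, of f lborel] by simp
  moreover have "AE x in lebesgue. (x \<in> f -` B) = (x \<in> g -` B)"
    using AE_completion[OF assms(2)] by eventually_elim auto
  ultimately show "g -` B \<inter> space lebesgue \<in> sets lebesgue"
    using completion.in_sets_AE[of "f -` B" "g -` B" lborel] by auto
qed auto

text \<open>The bridge between the two kinds of measure, with \<open>S\<close> the interval or the
  square: statements about the Lebesgue measurable \<open>g\<close> become statements about a Borel
  version \<open>f\<close>.\<close>

lemma lebesgue_AE_eq_borel:
  fixes f g :: "'a::euclidean_space \<Rightarrow> real"
  assumes S: "S \<in> sets borel" and f: "f \<in> borel_measurable borel"
    and eq: "AE x in density lborel (indicator S). g x = f x"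
  shows "set_borel_measurable lebesgue S g"
    and "(LINT x:S|lebesgue. g x) = (\<integral>x. f x \<partial>density lborel (indicator S))"
    and "set_integrable lebesgue S g \<longleftrightarrow> integrable (density lborel (indicator S)) f"
proof -
  let ?F = "\<lambda>x. indicator S x *\<^sub>R f x" and ?G = "\<lambda>x. indicator S x *\<^sub>R g x"
  \<comment> \<open>The rules for integrals over densities expect the coercion of a real
    function.\<close>
  have d: "(\<lambda>x. ennreal (indicator S x)) = indicator S"
    by (auto simp: fun_eq_iff split: split_indicator)
  have F: "?F \<in> borel_measurable lborel" using S f by simp
  have "(\<lambda>x. indicator S x :: ennreal) \<in> borel_measurable lborel" using S by simp
  from eq[unfolded AE_density[OF this]] have "AE x in lborel. ?G x = ?F x"
    by eventually_elim (auto split: split_indicator)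
  note ae = this AE_completion[OF this]
  have G: "?G \<in> borel_measurable lebesgue"
    using AE_lebesgue_measurable[OF _ ae(1)] F by simp
  then show "set_borel_measurable lebesgue S g" by (simp add: set_borel_measurable_def)
  note F' = measurable_completion[OF F]
  have "(\<integral>x. ?G x \<partial>lebesgue) = (\<integral>x. ?F x \<partial>lebesgue)" by (rule integral_cong_AE[OF G F' ae(2)])
  also have "\<dots> = (\<integral>x. f x \<partial>density lborel (\<lambda>x. ennreal (indicator S x)))"
    using S f by (subst integral_density) (simp_all add: integral_completion[OF F, simplified])
  finally show "(LINT x:S|lebesgue. g x) = (\<integral>x. f x \<partial>density lborel (indicator S))"
    by (simp add: set_lebesgue_integral_def d)
  have "integrable lebesgue ?G \<longleftrightarrow> integrable lebesgue ?F" by (rule integrable_cong_AE[OF G F' ae(2)])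
  also have "\<dots> \<longleftrightarrow> integrable (density lborel (\<lambda>x. ennreal (indicator S x))) f"
    using S f by (subst integrable_density) (simp_all add: integrable_completion[OF F, simplified])
  finally show "set_integrable lebesgue S g \<longleftrightarrow> integrable (density lborel (indicator S)) f"
    by (simp add: set_integrable_def d)
qed

lemma unit_lebesgue_AE_eq_borel:
  fixes f g :: "real \<Rightarrow> real"
  assumes "f \<in> borel_measurable borel" "AE x in unit_lborel. g x = f x"
  shows "g \<in> borel_measurable unit_lebesgue"
    and "(LINT x|unit_lebesgue. g x) = (\<integral>x. f x \<partial>unit_lborel)"
    and "integrable unit_lebesgue g \<longleftrightarrow> integrable unit_lborel f"
  using lebesgue_AE_eq_borel[OF _ assms(1), of "{0..1}" g, folded unit_lborel_def] assms(2)
  by (simp_all add: unit_lborel_def set_borel_measurable_def set_lebesgue_integral_def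
      set_integrable_def integral_restrict_space integrable_restrict_space
      borel_measurable_restrict_space_iff)

lemma unit_lebesgue_borel_version:
  assumes "g \<in> borel_measurable unit_lebesgue"
  shows "\<exists>f\<in>borel_measurable borel. AE x in unit_lborel. g x = (f x :: real)"
proof -
  have "(\<lambda>x. indicator {0..1} x *\<^sub>R g x) \<in> borel_measurable lebesgue"
    using assms by (simp add: borel_measurable_restrict_space_iff)
  then obtain f where f: "f \<in> borel_measurable lborel" "AE x in lborel. indicator {0..1} x *\<^sub>R g x = f x"
    using completion_ex_borel_measurable_real by blast
  have "AE x in lborel. 0 < (indicator {0..1} x :: ennreal) \<longrightarrow> g x = f x"
    using f(2) by eventually_elim (simp split: split_indicator_asm)
  then have "AE x in unit_lborel. g x = f x"
    unfolding unit_lborel_def by (subst AE_density) simp_all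
  then show ?thesis using f(1) by auto
qed

lemma AE_unit_lebesgue: "AE x in unit_lborel. P x \<Longrightarrow> AE x in unit_lebesgue. P x"
proof -
  assume "AE x in unit_lborel. P x"
  then have "AE x in lborel. 0 < (indicator {0..1} x :: ennreal) \<longrightarrow> P x"
    unfolding unit_lborel_def by (subst (asm) AE_density) simp_all
  then have "AE x in lborel. x \<in> {0..1} \<longrightarrow> P x"
    by eventually_elim (simp split: split_indicator)
  then show ?thesis by (subst AE_restrict_space_iff) (auto intro: AE_completion)
qed

text \<open>The Hilbert-Schmidt argument: Cauchy-Schwarz on almost every row, then integration over
  the rows.\<close>

lemma square_integrable_partial_integral:
  assumes f: "square_integrable unit_square f" and w: "square_integrable unit_lborel w"
  shows "square_integrable unit_lborel (\<lambda>x. \<integral>y. f (x, y) * w y \<partial>unit_lborel)"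
  unfolding square_integrable_def
proof
  have [measurable]: "f \<in> borel_measurable unit_square" "w \<in> borel_measurable unit_lborel"
    and f2: "integrable unit_square (\<lambda>p. (f p)\<^sup>2)"
    using f w by (auto simp: square_integrable_def)
  have "(\<lambda>(x, y). f (x, y) * w y) \<in> borel_measurable unit_square" by measurable
  then show m: "(\<lambda>x. \<integral>y. f (x, y) * w y \<partial>unit_lborel) \<in> borel_measurable unit_lborel"
    by (rule unit_lborel.borel_measurable_lebesgue_integral)
  let ?W = "\<integral>y. (w y)\<^sup>2 \<partial>unit_lborel"
  show "integrable unit_lborel (\<lambda>x. (\<integral>y. f (x, y) * w y \<partial>unit_lborel)\<^sup>2)"
  proof (rule Bochner_Integration.integrable_bound)
    show "integrable unit_lborel (\<lambda>x. (\<integral>y. (f (x, y))\<^sup>2 \<partial>unit_lborel) * ?W)"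
      using unit_square.integrable_fst'[OF f2] by (rule integrable_mult_left)
    show "AE x in unit_lborel. norm ((\<integral>y. f (x, y) * w y \<partial>unit_lborel)\<^sup>2)
        \<le> norm ((\<integral>y. (f (x, y))\<^sup>2 \<partial>unit_lborel) * ?W)"
      using unit_square.AE_integrable_fst'[OF f2]
    proof eventually_elim
      case (elim x)
      have "square_integrable unit_lborel (\<lambda>y. f (x, y))"
        using elim measurable_Pair2[of f unit_lborel unit_lborel borel x] by (simp add: square_integrable_def)
      from square_integrable_cauchy_schwarz[OF this w] show ?case by simp
    qed
  qed (use m in measurable)
qed

lemma square_integrable_product:
  assumes "square_integrable unit_lborel q" "square_integrable unit_lborel w"
  shows "square_integrable unit_square (\<lambda>p. q (fst p) * w (snd p))"
  unfolding square_integrable_def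
proof
  have [measurable]: "q \<in> borel_measurable borel" "w \<in> borel_measurable borel"
    and i: "integrable unit_lborel (\<lambda>x. (q x)\<^sup>2)" "integrable unit_lborel (\<lambda>x. (w x)\<^sup>2)"
    using assms by (auto simp: square_integrable_def)
  show "(\<lambda>p. q (fst p) * w (snd p)) \<in> borel_measurable unit_square" by measurable
  show "integrable unit_square (\<lambda>p. (q (fst p) * w (snd p))\<^sup>2)"
    by (rule unit_square.Fubini_integrable) (use i in \<open>auto simp: power_mult_distrib\<close>)
qed

section \<open>Moments of the coefficient function\<close>

lemma square_integrable_continuous:
  assumes "continuous_on UNIV f"
  shows "square_integrable unit_lborel f"
proof -
  have "compact (f ` {0..1})"
    using assms by (intro compact_continuous_image) (auto intro: continuous_on_subset)
  then have "bounded (f ` {0..1})" by (rule compact_imp_bounded)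
  then obtain c where c: "\<And>x. x \<in> {0..1} \<Longrightarrow> \<bar>f x\<bar> \<le> c"
    unfolding bounded_iff real_norm_def by blast
  have "square_integrable unit_lborel (\<lambda>x. f x * 1)"
  proof (rule square_integrable_bounded_mult)
    show "square_integrable unit_lborel (\<lambda>x. 1)" by (simp add: square_integrable_def)
    show "f \<in> borel_measurable unit_lborel" using borel_measurable_continuous_onI[OF assms] by simp
    show "AE x in unit_lborel. \<bar>f x\<bar> \<le> c" using AE_unit_lborel by eventually_elim (rule c)
  qed
  then show ?thesis by simp
qed

lemma integral_unit_lborel_continuous:
  fixes f :: "real \<Rightarrow> real"
  assumes "continuous_on UNIV f"
  shows "(\<integral>x. f x \<partial>unit_lborel) = integral {0..1} f"
proof -
  have f: "continuous_on {0..1} f" using assms continuous_on_subset by blast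
  have d: "(\<lambda>x. ennreal (indicator {0..1} x)) = indicator {0..1 :: real}"
    by (auto simp: fun_eq_iff split: split_indicator)
  have "(\<integral>x. f x \<partial>density lborel (\<lambda>x. ennreal (indicator {0..1} x))) = (LINT x:{0..1}|lborel. f x)"
    unfolding set_lebesgue_integral_def
    using borel_measurable_continuous_onI[OF assms] by (subst integral_density) auto
  also have "\<dots> = integral {0..1} f"
    by (intro set_borel_integral_eq_integral(2) borel_integrable_atLeastAtMost' f)
  finally show ?thesis by (simp add: unit_lborel_def d)
qed

abbreviation unit_ip :: "(real \<Rightarrow> real) \<Rightarrow> (real \<Rightarrow> real) \<Rightarrow> real" where
  "unit_ip f g \<equiv> (\<integral>x. f x * g x \<partial>unit_lborel)"

lemma square_integrable_legendre: "square_integrable unit_lborel (legendre n)"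
  by (intro square_integrable_continuous continuous_intros)

lemma square_integrable_power: "square_integrable unit_lborel (\<lambda>x. x ^ k)"
  by (intro square_integrable_continuous continuous_intros)

lemma unit_ip_legendre: "unit_ip (legendre i) (legendre j) = (if i = j then 1 else 0)"
  using integral_unit_lborel_continuous[of "\<lambda>x. legendre i x * legendre j x"] legendre_orthonormal
  by (simp add: continuous_intros)

lemma unit_ip_powers: "unit_ip (\<lambda>x. x ^ k) (\<lambda>x. x ^ l) = 1 / real (k + l + 1)"
proof -
  have "integral {0..1} (\<lambda>x. x ^ (k + l)) = (1 :: real) / real (k + l + 1)"
  proof -
    have "poly ([:0, 1:] ^ (k + l)) = (\<lambda>x :: real. x ^ (k + l))" by auto
    then show ?thesis
      using poly_integral_beta[of "k + l" 0] by (simp add: poly_integral_def)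
  qed
  then show ?thesis
    using integral_unit_lborel_continuous[of "\<lambda>x. x ^ (k + l)"]
    by (simp add: continuous_intros power_add)
qed

lemma unit_ip_legendre_1: "unit_ip (legendre j) (\<lambda>x. 1) = (if j = 0 then 1 else 0)"
  using unit_ip_legendre[of j 0] by (simp add: legendre_0)

text \<open>Orthonormality applied to x = 1/2 P_0 + (sqrt 3 / 6) P_1, the origin of the constant
  sqrt 3 / 6.\<close>

lemma unit_ip_legendre_id:
  "unit_ip (legendre j) (\<lambda>x. x) = (if j = 0 then 1 / 2 else if j = 1 then sqrt 3 / 6 else 0)"
proof -
  have e: "legendre j x * x
      = 1 / 2 * (legendre j x * legendre 0 x) + sqrt 3 / 6 * (legendre j x * legendre 1 x)" for x
    by (simp add: legendre_0 legendre_1 field_simps)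
  have "unit_ip (legendre j) (\<lambda>x. x)
      = (\<integral>x. 1 / 2 * (legendre j x * legendre 0 x) + sqrt 3 / 6 * (legendre j x * legendre 1 x) \<partial>unit_lborel)"
    by (simp only: e)
  also have "\<dots> = 1 / 2 * unit_ip (legendre j) (legendre 0) + sqrt 3 / 6 * unit_ip (legendre j) (legendre 1)"
    using square_integrable_mult[OF square_integrable_legendre square_integrable_legendre] by simp
  finally show ?thesis unfolding unit_ip_legendre by auto
qed

text \<open>Compared with the identity, the square has one further Legendre coefficient, sqrt 5 / 30
  at degree 2; it brings \<alpha>(0,2) into the order conditions.\<close>

lemma unit_ip_legendre_square:
  "unit_ip (legendre j) (\<lambda>x. x ^ 2) = (if j = 0 then 1 / 3 else if j = 1 then sqrt 3 / 6
     else if j = 2 then sqrt 5 / 30 else 0)"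
proof -
  have e: "legendre j x * x ^ 2 = 1 / 3 * (legendre j x * legendre 0 x)
      + sqrt 3 / 6 * (legendre j x * legendre 1 x) + sqrt 5 / 30 * (legendre j x * legendre 2 x)" for x
  proof -
    have "x ^ 2 = 1 / 3 * legendre 0 x + sqrt 3 / 6 * legendre 1 x + sqrt 5 / 30 * legendre 2 x"
      by (simp add: legendre_0 legendre_1 legendre_2 field_simps)
    then show ?thesis by (simp only: distrib_left mult.left_commute)
  qed
  have "unit_ip (legendre j) (\<lambda>x. x ^ 2)
      = (\<integral>x. 1 / 3 * (legendre j x * legendre 0 x) + sqrt 3 / 6 * (legendre j x * legendre 1 x)
          + sqrt 5 / 30 * (legendre j x * legendre 2 x) \<partial>unit_lborel)"
    by (simp only: e)
  also have "\<dots> = 1 / 3 * unit_ip (legendre j) (legendre 0) + sqrt 3 / 6 * unit_ip (legendre j) (legendre 1)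
      + sqrt 5 / 30 * unit_ip (legendre j) (legendre 2)"
    using square_integrable_mult[OF square_integrable_legendre square_integrable_legendre] by simp
  finally show ?thesis unfolding unit_ip_legendre by auto
qed

text \<open>\<open>A\<close> itself must not be modified on a null set, since its rows enter the
  stage equations; \<open>g\<close> stands in for it only where null sets do not matter.\<close>

lemma L2_square_borel_version:
  assumes "L2_square A"
  shows "\<exists>g. square_integrable unit_square g \<and> (AE p in unit_square. A (fst p) (snd p) = g p)"
proof -
  let ?S = "{0..1} \<times> {0..1} :: (real \<times> real) set"
  have S: "?S \<in> sets borel" by (intro borel_closed closed_Times) auto
  have "(\<lambda>p. indicator ?S p *\<^sub>R A (fst p) (snd p)) \<in> borel_measurable lebesgue"
    using assms by (simp add: L2_square_def set_borel_measurable_def)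
  then obtain g where g: "g \<in> borel_measurable lborel"
    "AE p in lborel. indicator ?S p *\<^sub>R A (fst p) (snd p) = g p"
    using completion_ex_borel_measurable_real by blast
  have "AE p in lborel. 0 < (indicator ?S p :: ennreal) \<longrightarrow> A (fst p) (snd p) = g p"
    using g(2) by eventually_elim (simp split: split_indicator_asm)
  then have eq: "AE p in unit_square. A (fst p) (snd p) = g p"
    unfolding unit_square_eq by (subst AE_density) (use S in simp_all)
  then have eq2: "AE p in unit_square. (A (fst p) (snd p))\<^sup>2 = (g p)\<^sup>2"
    by eventually_elim simp
  have "integrable unit_square (\<lambda>p. (g p)\<^sup>2)"
    using lebesgue_AE_eq_borel(3)[OF S _ eq2[unfolded unit_square_eq]] g(1) assms
    by (simp add: L2_square_def unit_square_eq)
  moreover have "g \<in> borel_measurable unit_square"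
    using g(1) by (simp add: measurable_cong_sets[OF sets_unit_square refl])
  ultimately show ?thesis using eq by (auto simp: square_integrable_def)
qed

lemma has_sum_finite_support:
  fixes f :: "'i \<Rightarrow> real"
  assumes "(f has_sum s) S" "finite F" "F \<subseteq> S" "\<And>x. x \<in> S - F \<Longrightarrow> f x = 0"
  shows "s = sum f F"
proof -
  have "(f has_sum sum f F) S"
    by (rule has_sum_finite_neutralI[OF assms(2,3)]) (use assms(4) in auto)
  then show ?thesis using has_sum_unique[OF assms(1)] by blast
qed

text \<open>Collects what depends on \<open>A\<close> only up to null sets of the square; the row
  conditions are kept apart in \<open>csRK_kernel\<close>.\<close>

locale csRK_coefficients =
  fixes A :: "real \<Rightarrow> real \<Rightarrow> real" and \<alpha> :: "nat \<times> nat \<Rightarrow> real" and g :: "real \<times> real \<Rightarrow> real"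
  assumes g: "square_integrable unit_square g"
    and A_eq_g: "AE p in unit_square. A (fst p) (snd p) = g p"
    and expansion: "has_L2_sum (\<lambda>(i, j) \<tau> \<sigma>. \<alpha> (i, j) * legendre i \<tau> * legendre j \<sigma>)
      (\<lambda>\<tau> \<sigma>. A \<tau> \<sigma> - (1 / 2 + sqrt 3 / 6 * legendre 1 \<tau>)) (UNIV \<times> {1..})"
begin

text \<open>The stage operator with Borel measurable kernel; it agrees with that of \<open>A\<close> only for almost
  every \<open>\<tau>\<close>, since \<open>g\<close> is a version of \<open>A\<close> on the square.\<close>

definition borel_op :: "(real \<Rightarrow> real) \<Rightarrow> real \<Rightarrow> real" where
  "borel_op w \<tau> = (\<integral>\<sigma>. g (\<tau>, \<sigma>) * w \<sigma> \<partial>unit_lborel)"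

lemma g_measurable [measurable]: "g \<in> borel_measurable unit_square"
  using g by (simp add: square_integrable_def)

lemma borel_op_measurable:
  assumes [measurable]: "w \<in> borel_measurable borel"
  shows "borel_op w \<in> borel_measurable borel"
proof -
  have "(\<lambda>(\<tau>, \<sigma>). g (\<tau>, \<sigma>) * w \<sigma>) \<in> borel_measurable (unit_lborel \<Otimes>\<^sub>M unit_lborel)"
    by measurable
  then have "(\<lambda>\<tau>. \<integral>\<sigma>. g (\<tau>, \<sigma>) * w \<sigma> \<partial>unit_lborel) \<in> borel_measurable unit_lborel"
    by (rule unit_lborel.borel_measurable_lebesgue_integral)
  then show ?thesis unfolding borel_op_def by simp
qed

text \<open>By Fubini almost every row of \<open>A\<close> agrees almost everywhere with that of
  \<open>g\<close>; the exceptional rows are the reason why only almost every \<tau> is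
  reached.\<close>

lemma apply_eq_borel_op:
  assumes "w \<in> borel_measurable borel" "AE \<sigma> in unit_lborel. u \<sigma> = w \<sigma>"
  shows "AE \<tau> in unit_lborel. (LINT \<sigma>|unit_lebesgue. A \<tau> \<sigma> * u \<sigma>) = borel_op w \<tau>"
  using unit_square.AE_pair[OF A_eq_g]
proof eventually_elim
  case (elim \<tau>)
  have "AE \<sigma> in unit_lborel. A \<tau> \<sigma> * u \<sigma> = g (\<tau>, \<sigma>) * w \<sigma>"
    using elim assms(2) by eventually_elim simp
  moreover have "(\<lambda>\<sigma>. g (\<tau>, \<sigma>)) \<in> borel_measurable unit_lborel"
    using measurable_Pair2[OF g_measurable, of \<tau>] by simp
  then have "(\<lambda>\<sigma>. g (\<tau>, \<sigma>) * w \<sigma>) \<in> borel_measurable borel"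
    using assms(1) by simp
  ultimately show ?case unfolding borel_op_def by (intro unit_lebesgue_AE_eq_borel(2))
qed

lemma expansion_tendsto:
  "((\<lambda>F. \<integral>p. (g p - fst p - (\<Sum>(i, j)\<in>F. \<alpha> (i, j) * legendre i (fst p) * legendre j (snd p)))\<^sup>2 \<partial>unit_square)
    \<longlongrightarrow> 0) (finite_subsets_at_top (UNIV \<times> {1..}))"
proof -
  let ?S = "{0..1} \<times> {0..1} :: (real \<times> real) set"
  let ?s = "\<lambda>F p. \<Sum>(i, j)\<in>F. \<alpha> (i, j) * legendre i (fst p) * legendre j (snd p)"
  have S: "?S \<in> sets borel" by (intro borel_closed closed_Times) auto
  have "(LINT p:?S|lebesgue. (A (fst p) (snd p) - (1 / 2 + sqrt 3 / 6 * legendre 1 (fst p)) - ?s F p)\<^sup>2)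
      = (\<integral>p. (g p - fst p - ?s F p)\<^sup>2 \<partial>unit_square)" for F
    unfolding unit_square_eq
  proof (rule lebesgue_AE_eq_borel(2)[OF S])
    have [measurable]: "legendre i \<in> borel_measurable borel" for i
      by (intro borel_measurable_continuous_onI continuous_intros)
    have "(\<lambda>p. (g p - fst p - ?s F p)\<^sup>2) \<in> borel_measurable unit_square"
      unfolding case_prod_beta by measurable
    then show "(\<lambda>p. (g p - fst p - ?s F p)\<^sup>2) \<in> borel_measurable borel"
      by (simp add: measurable_cong_sets[OF sets_unit_square refl])
    \<comment> \<open>The leading part of the kernel is \<tau> itself, whence \<open>fst p\<close>
      on the Borel side.\<close>
    have e: "1 / 2 + sqrt 3 / 6 * legendre 1 x = x" for x
      by (simp add: legendre_1 field_simps)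
    show "AE p in density lborel (indicator ?S).
        (A (fst p) (snd p) - (1 / 2 + sqrt 3 / 6 * legendre 1 (fst p)) - ?s F p)\<^sup>2 = (g p - fst p - ?s F p)\<^sup>2"
      using A_eq_g[unfolded unit_square_eq] by eventually_elim (simp only: e)
  qed
  then show ?thesis
    using expansion by (simp add: has_L2_sum_def case_prod_beta)
qed

lemma square_integrable_1: "square_integrable unit_lborel (\<lambda>x. 1)"
  using square_integrable_power[of 0] by simp

lemma square_integrable_id: "square_integrable unit_lborel (\<lambda>x. x)"
  using square_integrable_power[of 1] by simp

lemma g_mult_integrable:
  assumes "square_integrable unit_lborel q" "square_integrable unit_lborel w"
  shows "integrable unit_square (\<lambda>p. g p * (q (fst p) * w (snd p)))"
  using square_integrable_mult[OF g square_integrable_product[OF assms]] .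

lemma integral_g_mult:
  assumes "square_integrable unit_lborel q" "square_integrable unit_lborel w"
  shows "(\<integral>p. g p * (q (fst p) * w (snd p)) \<partial>unit_square) = unit_ip q (borel_op w)"
proof -
  have "(\<integral>p. g p * (q (fst p) * w (snd p)) \<partial>unit_square)
      = (\<integral>x. (\<integral>y. g (x, y) * (q x * w y) \<partial>unit_lborel) \<partial>unit_lborel)"
    using unit_square.integral_fst'[OF g_mult_integrable[OF assms]] by simp
  also have "(\<lambda>x. \<integral>y. g (x, y) * (q x * w y) \<partial>unit_lborel) = (\<lambda>x. q x * borel_op w x)"
    unfolding borel_op_def by (intro ext) (simp add: mult.left_commute)
  finally show ?thesis .
qed

text \<open>Testing against q(\<tau>) w(\<sigma>) is continuous on L^2 by Cauchy-Schwarz, so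
  unconditional convergence of the expansion passes to the series of numbers. The term subtracted
  from \<open>unit_ip q (borel_op w)\<close> is the contribution of the leading part \<tau>.\<close>

lemma expansion_has_sum:
  assumes q: "square_integrable unit_lborel q" and w: "square_integrable unit_lborel w"
  shows "((\<lambda>(i, j). \<alpha> (i, j) * unit_ip (legendre i) q * unit_ip (legendre j) w) has_sum
    (unit_ip q (borel_op w) - unit_ip (\<lambda>x. x) q * (\<integral>x. w x \<partial>unit_lborel))) (UNIV \<times> {1..})"
proof -
  let ?Q = "\<lambda>p. q (fst p) * w (snd p)"
  let ?s = "\<lambda>F p. \<Sum>(i, j)\<in>F. \<alpha> (i, j) * legendre i (fst p) * legendre j (snd p)"
  let ?f = "\<lambda>(i, j). \<alpha> (i, j) * unit_ip (legendre i) q * unit_ip (legendre j) w"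
  let ?c = "unit_ip q (borel_op w) - unit_ip (\<lambda>x. x) q * (\<integral>x. w x \<partial>unit_lborel)"
  have Q: "square_integrable unit_square ?Q" by (rule square_integrable_product[OF q w])
  have fst: "square_integrable unit_square (\<lambda>p. fst p)"
    using square_integrable_product[OF square_integrable_id square_integrable_1] by simp
  have leg: "square_integrable unit_square (\<lambda>p. legendre i (fst p) * legendre j (snd p))" for i j
    by (rule square_integrable_product[OF square_integrable_legendre square_integrable_legendre])
  have s: "square_integrable unit_square (?s F)" for F
    unfolding case_prod_beta mult.assoc by (intro square_integrable_sum square_integrable_cmult leg)
  have W: "square_integrable unit_square (\<lambda>p. g p - fst p - ?s F p)" for F
    by (intro square_integrable_diff g fst s)
  have pair: "(\<integral>p. (a (fst p) * b (snd p)) * ?Q p \<partial>unit_square) = unit_ip a q * unit_ip b w"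
    if a: "square_integrable unit_lborel a" and b: "square_integrable unit_lborel b" for a b
  proof -
    have i: "integrable unit_square (\<lambda>p. (a (fst p) * b (snd p)) * ?Q p)"
      by (rule square_integrable_mult[OF square_integrable_product[OF a b] Q])
    have "(\<integral>p. (a (fst p) * b (snd p)) * ?Q p \<partial>unit_square)
      = (\<integral>x. (\<integral>y. (a x * q x) * (b y * w y) \<partial>unit_lborel) \<partial>unit_lborel)"
      unfolding unit_square.integral_fst'[OF i, symmetric]
      by (intro Bochner_Integration.integral_cong refl) (simp only: fst_conv snd_conv mult_ac)
    then show ?thesis by (simp only: integral_mult_right_zero integral_mult_left_zero)
  qed
  \<comment> \<open>By linearity, testing the remainder of a finite partial sum gives the remainder
    of the numerical series.\<close>
  have eq: "(\<integral>p. (g p - fst p - ?s F p) * ?Q p \<partial>unit_square) = ?c - sum ?f F" for F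
  proof -
    have "(\<integral>p. ?s F p * ?Q p \<partial>unit_square)
      = (\<integral>p. (\<Sum>x\<in>F. \<alpha> x * ((legendre (fst x) (fst p) * legendre (snd x) (snd p)) * ?Q p)) \<partial>unit_square)"
      by (intro Bochner_Integration.integral_cong refl)
        (simp add: case_prod_beta sum_distrib_right mult.assoc)
    also have "\<dots> = (\<Sum>x\<in>F. \<integral>p. \<alpha> x * ((legendre (fst x) (fst p) * legendre (snd x) (snd p)) * ?Q p) \<partial>unit_square)"
      by (rule Bochner_Integration.integral_sum) (intro integrable_mult_right square_integrable_mult leg Q)
    also have "\<dots> = (\<Sum>x\<in>F. \<alpha> x * (unit_ip (legendre (fst x)) q * unit_ip (legendre (snd x)) w))"
      by (simp only: integral_mult_right_zero pair[OF square_integrable_legendre square_integrable_legendre])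
    also have "\<dots> = sum ?f F" by (simp add: case_prod_beta mult.assoc)
    finally have 1: "(\<integral>p. ?s F p * ?Q p \<partial>unit_square) = sum ?f F" .
    have 2: "(\<integral>p. fst p * ?Q p \<partial>unit_square) = unit_ip (\<lambda>x. x) q * (\<integral>x. w x \<partial>unit_lborel)"
      using pair[OF square_integrable_id square_integrable_1] by simp
    note i1 = square_integrable_mult[OF g Q] and i2 = square_integrable_mult[OF fst Q]
      and i3 = square_integrable_mult[OF s Q, of F]
    have "(\<integral>p. (g p - fst p - ?s F p) * ?Q p \<partial>unit_square)
      = (\<integral>p. g p * ?Q p - fst p * ?Q p - ?s F p * ?Q p \<partial>unit_square)"
      by (simp only: left_diff_distrib)
    also have "\<dots> = (\<integral>p. g p * ?Q p \<partial>unit_square) - (\<integral>p. fst p * ?Q p \<partial>unit_square)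
        - (\<integral>p. ?s F p * ?Q p \<partial>unit_square)"
      using Bochner_Integration.integral_diff[OF Bochner_Integration.integrable_diff[OF i1 i2] i3]
        Bochner_Integration.integral_diff[OF i1 i2] by (simp only:)
    finally show ?thesis unfolding 1 2 integral_g_mult[OF q w] .
  qed
  let ?n = "\<lambda>F. \<integral>p. (g p - fst p - ?s F p)\<^sup>2 \<partial>unit_square"
  let ?b = "\<integral>p. (?Q p)\<^sup>2 \<partial>unit_square"
  have le: "norm (?c - sum ?f F) \<le> sqrt (?n F * ?b)" for F
  proof -
    have "(?c - sum ?f F)\<^sup>2 \<le> ?n F * ?b"
      using square_integrable_cauchy_schwarz[OF W Q, of F] unfolding eq .
    from real_sqrt_le_mono[OF this] show ?thesis unfolding real_sqrt_abs real_norm_def .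
  qed
  have "((\<lambda>F. sqrt (?n F * ?b)) \<longlongrightarrow> sqrt (0 * ?b)) (finite_subsets_at_top (UNIV \<times> {1..}))"
    by (intro tendsto_intros expansion_tendsto)
  then have "((\<lambda>F. sqrt (?n F * ?b)) \<longlongrightarrow> 0) (finite_subsets_at_top (UNIV \<times> {1..}))"
    by (simp only: mult_zero_left real_sqrt_zero)
  then have "((\<lambda>F. ?c - sum ?f F) \<longlongrightarrow> 0) (finite_subsets_at_top (UNIV \<times> {1..}))"
    by (rule Lim_null_comparison[rotated]) (intro always_eventually allI le)
  then have "((\<lambda>F. ?c - (?c - sum ?f F)) \<longlongrightarrow> ?c - 0) (finite_subsets_at_top (UNIV \<times> {1..}))"
    by (intro tendsto_intros)
  then show ?thesis by (simp add: has_sum_def)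
qed

end

section \<open>Order conditions in terms of the coefficients\<close>

context csRK_coefficients
begin

text \<open>Measurability in \<tau> comes from \<open>borel_op\<close> for a Borel version of
  \<open>u\<close>: Lebesgue measurability survives the change on a null set of \<tau>.\<close>

lemma kernel:
  assumes "bounded_row_integrals A"
  shows "\<exists>M. csRK_kernel A M"
proof -
  obtain M where i: "\<And>\<tau>. \<tau> \<in> {0..1} \<Longrightarrow> set_integrable lebesgue {0..1} (A \<tau>)"
    and M: "\<And>\<tau>. \<tau> \<in> {0..1} \<Longrightarrow> (LINT \<sigma>:{0..1}|lebesgue. \<bar>A \<tau> \<sigma>\<bar>) \<le> M"
    using assms unfolding bounded_row_integrals_def by blast
  have "csRK_kernel A M"
  proof
    show "integrable unit_lebesgue (A \<tau>)" if "\<tau> \<in> {0..1}" for \<tau>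
      using i[OF that] by (simp add: set_integrable_def integrable_restrict_space)
    show "(LINT \<sigma>|unit_lebesgue. \<bar>A \<tau> \<sigma>\<bar>) \<le> M" if "\<tau> \<in> {0..1}" for \<tau>
      using M[OF that] by (simp add: set_lebesgue_integral_def integral_restrict_space)
    fix u :: "real \<Rightarrow> real" and c
    assume "u \<in> borel_measurable unit_lebesgue"
    then obtain w where w: "w \<in> borel_measurable borel" "AE x in unit_lborel. u x = w x"
      using unit_lebesgue_borel_version by blast
    show "(\<lambda>\<tau>. LINT \<sigma>|unit_lebesgue. A \<tau> \<sigma> * u \<sigma>) \<in> borel_measurable unit_lebesgue"
      by (rule unit_lebesgue_AE_eq_borel(1)[OF borel_op_measurable[OF w(1)] apply_eq_borel_op[OF w]])
  qed
  then show ?thesis ..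
qed

lemma square_integrable_borel_op:
  assumes "square_integrable unit_lborel w"
  shows "square_integrable unit_lborel (borel_op w)"
  using square_integrable_partial_integral[OF g assms] unfolding borel_op_def .

text \<open>The adjoint of \<open>borel_op\<close> applied to the constant 1: it turns the mean of
  \<open>borel_op w\<close> into an inner product with \<open>w\<close>.\<close>

definition column_integral :: "real \<Rightarrow> real" where
  "column_integral \<sigma> = (\<integral>\<tau>. g (\<tau>, \<sigma>) \<partial>unit_lborel)"

lemma square_integrable_column_integral: "square_integrable unit_lborel column_integral"
proof -
  have "(\<lambda>p. g (snd p, fst p)) \<in> borel_measurable unit_square" by measurable
  moreover have "integrable unit_square (\<lambda>p. (g (snd p, fst p))\<^sup>2)"
    using unit_square.integrable_product_swap[of "\<lambda>p. (g p)\<^sup>2"] g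
    by (simp add: square_integrable_def case_prod_unfold)
  ultimately have "square_integrable unit_square (\<lambda>p. g (snd p, fst p))"
    by (simp add: square_integrable_def)
  from square_integrable_partial_integral[OF this square_integrable_1] show ?thesis
    unfolding column_integral_def by simp
qed

lemma integral_borel_op:
  assumes "square_integrable unit_lborel w"
  shows "(\<integral>x. borel_op w x \<partial>unit_lborel) = unit_ip column_integral w"
proof -
  have "integrable unit_square (\<lambda>(x, y). g (x, y) * w y)"
    using g_mult_integrable[OF square_integrable_1 assms] by (simp add: case_prod_unfold)
  from unit_square.Fubini_integral[OF this] show ?thesis
    by (simp add: borel_op_def column_integral_def)
qed

text \<open>In its uses orthogonality leaves at most two terms of the series, listed in
  \<open>F\<close>.\<close>

lemma moment_finite:
  assumes "square_integrable unit_lborel q" "square_integrable unit_lborel w"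
    and "finite F" "F \<subseteq> UNIV \<times> {1..}"
    and "\<And>i j. j \<ge> 1 \<Longrightarrow> (i, j) \<notin> F \<Longrightarrow> \<alpha> (i, j) * unit_ip (legendre i) q * unit_ip (legendre j) w = 0"
  shows "unit_ip q (borel_op w) = unit_ip (\<lambda>x. x) q * (\<integral>x. w x \<partial>unit_lborel)
    + (\<Sum>(i, j)\<in>F. \<alpha> (i, j) * unit_ip (legendre i) q * unit_ip (legendre j) w)"
  using has_sum_finite_support[OF expansion_has_sum[OF assms(1,2)] assms(3,4)] assms(5) by fastforce

lemma moments_of_powers:
  "(\<integral>x. x \<partial>unit_lborel) = 1 / 2" "(\<integral>x. x ^ 2 \<partial>unit_lborel) = 1 / 3"
  "(\<integral>x. x ^ 3 \<partial>unit_lborel) = 1 / 4" "unit_ip (\<lambda>x. x) (\<lambda>x. x) = 1 / 3"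
  using unit_ip_powers[of 0 1] unit_ip_powers[of 0 2] unit_ip_powers[of 0 3] unit_ip_powers[of 1 1]
  by simp_all

text \<open>The deviation \<open>q\<close> is tested against itself: the terms with j \<ge> 1 vanish
  because P_j is orthogonal to 1, so \<open>q\<close> has norm zero.\<close>

lemma borel_op_1: "AE \<tau> in unit_lborel. borel_op (\<lambda>\<sigma>. 1) \<tau> = \<tau>"
proof -
  define q where "q = (\<lambda>\<tau>. borel_op (\<lambda>\<sigma>. 1) \<tau> - \<tau>)"
  note b = square_integrable_borel_op[OF square_integrable_1]
  have q: "square_integrable unit_lborel q"
    unfolding q_def by (intro square_integrable_diff b square_integrable_id)
  have "unit_ip q (borel_op (\<lambda>\<sigma>. 1)) = unit_ip (\<lambda>x. x) q * (\<integral>x. 1 \<partial>unit_lborel) + 0"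
    using moment_finite[OF q square_integrable_1, of "{}"] unit_ip_legendre_1 by simp
  then have "unit_ip q (borel_op (\<lambda>\<sigma>. 1)) - unit_ip q (\<lambda>x. x) = 0"
    by (simp add: mult.commute)
  then have "(\<integral>x. q x * borel_op (\<lambda>\<sigma>. 1) x - q x * x \<partial>unit_lborel) = 0"
    using square_integrable_mult[OF q b] square_integrable_mult[OF q square_integrable_id] by simp
  then have "(\<integral>x. (q x)\<^sup>2 \<partial>unit_lborel) = 0"
    by (simp add: q_def power2_eq_square right_diff_distrib)
  then have "AE x in unit_lborel. (q x)\<^sup>2 = 0"
    using q by (subst (asm) integral_nonneg_eq_0_iff_AE) (auto simp: square_integrable_def)
  then show ?thesis by eventually_elim (simp add: q_def)
qed

lemma integral_legendre: "(\<integral>x. legendre j x \<partial>unit_lborel) = (if j = 0 then 1 else 0)"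
  using unit_ip_legendre_1[of j] by simp

text \<open>Order 3 demands the value 1/6, the mean of \<tau>^2/2; solving for the coefficient gives
  \<alpha>(0,1) = - sqrt 3 / 6.\<close>

lemma integral_borel_op_id: "(\<integral>x. borel_op (\<lambda>\<sigma>. \<sigma>) x \<partial>unit_lborel) = 1 / 4 + \<alpha> (0, 1) * sqrt 3 / 6"
proof -
  have "unit_ip (\<lambda>x. 1) (borel_op (\<lambda>\<sigma>. \<sigma>)) = unit_ip (\<lambda>x. x) (\<lambda>x. 1) * (\<integral>x. x \<partial>unit_lborel)
    + (\<Sum>(i, j)\<in>{(0, 1)}. \<alpha> (i, j) * unit_ip (legendre i) (\<lambda>x. 1) * unit_ip (legendre j) (\<lambda>x. x))"
    by (rule moment_finite[OF square_integrable_1 square_integrable_id])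
      (auto simp: integral_legendre unit_ip_legendre_id split: if_splits)
  then show ?thesis by (simp add: integral_legendre unit_ip_legendre_id moments_of_powers)
qed

text \<open>The target is 1/8, the integral of \<tau>^3/2. With \<alpha>(0,1) as prescribed the
  first two terms reach it, which leaves the condition \<alpha>(1,1) = 0.\<close>

lemma integral_id_borel_op_id: "unit_ip (\<lambda>x. x) (borel_op (\<lambda>\<sigma>. \<sigma>))
    = 1 / 6 + \<alpha> (0, 1) * sqrt 3 / 12 + \<alpha> (1, 1) / 12"
proof -
  have "unit_ip (\<lambda>x. x) (borel_op (\<lambda>\<sigma>. \<sigma>)) = unit_ip (\<lambda>x. x) (\<lambda>x. x) * (\<integral>x. x \<partial>unit_lborel)
    + (\<Sum>(i, j)\<in>{(0, 1), (1, 1)}. \<alpha> (i, j) * unit_ip (legendre i) (\<lambda>x. x) * unit_ip (legendre j) (\<lambda>x. x))"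
    by (rule moment_finite[OF square_integrable_id square_integrable_id])
      (auto simp: unit_ip_legendre_id split: if_splits)
  then show ?thesis by (simp add: unit_ip_legendre_id moments_of_powers)
qed

text \<open>The target is 1/12, the mean of \<tau>^3/3. With \<alpha>(0,1) as prescribed the first
  two terms reach it, which leaves the condition \<alpha>(0,2) = 0.\<close>

lemma integral_borel_op_square: "(\<integral>x. borel_op (\<lambda>\<sigma>. \<sigma> ^ 2) x \<partial>unit_lborel)
    = 1 / 6 + \<alpha> (0, 1) * sqrt 3 / 6 + \<alpha> (0, 2) * sqrt 5 / 30"
proof -
  have "unit_ip (\<lambda>x. 1) (borel_op (\<lambda>\<sigma>. \<sigma> ^ 2)) = unit_ip (\<lambda>x. x) (\<lambda>x. 1) * (\<integral>x. x ^ 2 \<partial>unit_lborel)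
    + (\<Sum>(i, j)\<in>{(0, 1), (0, 2)}. \<alpha> (i, j) * unit_ip (legendre i) (\<lambda>x. 1) * unit_ip (legendre j) (\<lambda>x. x ^ 2))"
    by (rule moment_finite[OF square_integrable_1 square_integrable_power])
      (auto simp: integral_legendre unit_ip_legendre_square split: if_splits)
  then show ?thesis by (simp add: integral_legendre unit_ip_legendre_square moments_of_powers)
qed

text \<open>For k > 0, testing with 1 and P_k isolates a single coefficient; for k = 0 the value is
  the mean of \<tau>, by \<open>borel_op_1\<close>.\<close>

lemma legendre_column_integral:
  "unit_ip (legendre k) column_integral = (if k = 0 then 1 / 2 else \<alpha> (0, k))"
proof (cases "k = 0")
  case True
  have "unit_ip (legendre 0) column_integral = (\<integral>x. borel_op (\<lambda>\<sigma>. 1) x \<partial>unit_lborel)"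
    using integral_borel_op[OF square_integrable_1] by (simp add: legendre_0)
  also have "\<dots> = (\<integral>x. x \<partial>unit_lborel)"
    using borel_op_1 square_integrable_borel_op[OF square_integrable_1] square_integrable_id
    by (intro integral_cong_AE) (auto simp: square_integrable_def)
  finally show ?thesis using True by (simp add: moments_of_powers)
next
  case False
  have "unit_ip (\<lambda>x. 1) (borel_op (legendre k)) = unit_ip (\<lambda>x. x) (\<lambda>x. 1) * (\<integral>x. legendre k x \<partial>unit_lborel)
    + (\<Sum>(i, j)\<in>{(0, k)}. \<alpha> (i, j) * unit_ip (legendre i) (\<lambda>x. 1) * unit_ip (legendre j) (legendre k))"
    by (rule moment_finite[OF square_integrable_1 square_integrable_legendre])
      (use False in \<open>auto simp: integral_legendre unit_ip_legendre split: if_splits\<close>)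
  then have "unit_ip (\<lambda>x. 1) (borel_op (legendre k)) = \<alpha> (0, k)"
    using False by (simp add: integral_legendre unit_ip_legendre)
  then show ?thesis
    using integral_borel_op[OF square_integrable_legendre, of k] False by (simp add: mult.commute)
qed

text \<open>By Fubini the double application becomes an inner product of
  \<open>column_integral\<close> with \<open>borel_op\<close> of the identity. Beyond the leading
  part only j = 1 survives, while i runs over all degrees; hence the infinite sum of products
  \<alpha>(0,i) \<alpha>(i,1).\<close>

lemma integral_borel_op_borel_op_id:
  assumes "\<alpha> (0, 1) = - sqrt 3 / 6" "\<alpha> (1, 1) = 0" "\<alpha> (0, 2) = 0"
    and "((\<lambda>i. \<alpha> (0, i) * \<alpha> (i, 1)) has_sum 0) {3..}"
  shows "(\<integral>x. borel_op (borel_op (\<lambda>\<sigma>. \<sigma>)) x \<partial>unit_lborel) = 1 / 24"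
proof -
  note u = square_integrable_column_integral
  let ?f = "\<lambda>(i, j). \<alpha> (i, j) * unit_ip (legendre i) column_integral * unit_ip (legendre j) (\<lambda>x. x)"
  let ?h = "\<lambda>i. \<alpha> (i, 1) * unit_ip (legendre i) column_integral * (sqrt 3 / 6)"
  let ?s = "unit_ip column_integral (borel_op (\<lambda>\<sigma>. \<sigma>)) - unit_ip (\<lambda>x. x) column_integral * (1 / 2)"
  have "(?f has_sum ?s) (UNIV \<times> {1..})"
    using expansion_has_sum[OF u square_integrable_id] by (simp add: moments_of_powers)
  \<comment> \<open>Terms with j > 1 vanish, as the identity has degree 1.\<close>
  also have "(?f has_sum ?s) (UNIV \<times> {1..}) \<longleftrightarrow> (?f has_sum ?s) ((\<lambda>i. (i, 1)) ` UNIV)"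
    by (rule has_sum_cong_neutral) (auto simp: unit_ip_legendre_id)
  also have "\<dots> \<longleftrightarrow> ((?f \<circ> (\<lambda>i. (i, 1))) has_sum ?s) UNIV"
    by (rule has_sum_reindex) (auto simp: inj_on_def)
  also have "?f \<circ> (\<lambda>i. (i, 1)) = ?h"
    by (auto simp: fun_eq_iff unit_ip_legendre_id)
  finally have 1: "(?h has_sum ?s) UNIV" .
  have "(?h has_sum (sqrt 3 / 6 * 0)) {3..} \<longleftrightarrow>
      ((\<lambda>i. sqrt 3 / 6 * (\<alpha> (0, i) * \<alpha> (i, 1))) has_sum (sqrt 3 / 6 * 0)) {3..}"
    by (intro has_sum_cong) (auto simp: legendre_column_integral)
  moreover have "((\<lambda>i. sqrt 3 / 6 * (\<alpha> (0, i) * \<alpha> (i, 1))) has_sum (sqrt 3 / 6 * 0)) {3..}"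
    by (rule has_sum_cmult_right[OF assms(4)])
  ultimately have "(?h has_sum 0) {3..}" by simp
  moreover have "(?h has_sum (\<Sum>i<3. ?h i)) {..<3}" by (rule has_sum_finite) simp
  ultimately have "(?h has_sum ((\<Sum>i<3. ?h i) + 0)) ({..<3} \<union> {3..})"
    by (intro has_sum_Un_disjoint) auto
  moreover have "{..<3} \<union> {3..} = (UNIV :: nat set)" by auto
  ultimately have "?s = (\<Sum>i<3. ?h i)" using has_sum_unique[OF 1] by simp
  \<comment> \<open>Of the three terms only i = 0 survives, namely \<alpha>(0,1) * 1/2 * sqrt 3 /
    6.\<close>
  also have "\<dots> = - (1 / 24)"
    using assms(1-3) by (simp add: numeral_3_eq_3 numeral_2_eq_2 legendre_column_integral)
  finally have s: "?s = - (1 / 24)" .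
  have "unit_ip (\<lambda>x. x) column_integral = (\<integral>x. borel_op (\<lambda>\<sigma>. \<sigma>) x \<partial>unit_lborel)"
    using integral_borel_op[OF square_integrable_id] by (simp add: mult.commute)
  also have "\<dots> = 1 / 6" using integral_borel_op_id assms(1) by simp
  finally show ?thesis
    using s integral_borel_op[OF square_integrable_borel_op[OF square_integrable_id]] by simp
qed

end

section \<open>Quadrature defects of the stages\<close>

locale csRK_method = csRK_coefficients A \<alpha> g + csRK_kernel A M
  for A \<alpha> g M
begin

text \<open>The function r_k of the overview, built from the pointwise kernel \<open>A\<close>
  because the residual belongs to the actual stages; its Borel counterpart agrees with it almost
  everywhere.\<close>

definition stage_defect :: "nat \<Rightarrow> real \<Rightarrow> real" where
  "stage_defect k \<tau> = stage_op (\<lambda>\<sigma>. \<sigma> ^ k) \<tau> - \<tau> ^ Suc k / real (Suc k)"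

lemma power_measurable: "(\<lambda>\<tau>. \<tau> ^ k) \<in> borel_measurable unit_lebesgue"
  by (intro borel_measurable_power id_borel_measurable_lebesgue_on[unfolded id_def])

lemma stage_defect_measurable: "stage_defect k \<in> borel_measurable unit_lebesgue"
proof -
  have "stage_op (\<lambda>\<sigma>. \<sigma> ^ k) \<in> borel_measurable unit_lebesgue"
    by (rule measurable_stage_op[OF power_measurable, of _ 1]) (auto simp: power_le_one)
  then show ?thesis
    unfolding stage_defect_def using power_measurable[of "Suc k"] by (simp del: power_Suc)
qed

lemma stage_defect_bounded:
  assumes "\<tau> \<in> {0..1}"
  shows "\<bar>stage_defect k \<tau>\<bar> \<le> M + 1"
proof -
  have "norm (stage_op (\<lambda>\<sigma>. \<sigma> ^ k) \<tau>) \<le> 1 * M"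
    by (rule norm_stage_op_le[OF AE_I2]) (use assms in \<open>auto simp: power_le_one\<close>)
  moreover have "0 \<le> \<tau> ^ Suc k / real (Suc k)" "\<tau> ^ Suc k / real (Suc k) \<le> 1"
    using assms power_le_one[of \<tau> "Suc k"] by (auto simp: divide_le_eq)
  ultimately show ?thesis unfolding stage_defect_def real_norm_def by linarith
qed

lemma stage_op_eq_borel_op:
  assumes "w \<in> borel_measurable borel" "AE \<sigma> in unit_lborel. u \<sigma> = w \<sigma>"
  shows "AE \<tau> in unit_lborel. stage_op u \<tau> = borel_op w \<tau>"
  using apply_eq_borel_op[OF assms] by (simp add: stage_op_def)

lemma stage_defect_eq:
  "AE \<tau> in unit_lborel. stage_defect k \<tau> = borel_op (\<lambda>\<sigma>. \<sigma> ^ k) \<tau> - \<tau> ^ Suc k / real (Suc k)"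
proof -
  have "AE \<tau> in unit_lborel. stage_op (\<lambda>\<sigma>. \<sigma> ^ k) \<tau> = borel_op (\<lambda>\<sigma>. \<sigma> ^ k) \<tau>"
    by (rule stage_op_eq_borel_op) auto
  then show ?thesis by eventually_elim (simp add: stage_defect_def)
qed

lemma stage_defect_0: "AE \<tau> in unit_lebesgue. stage_defect 0 \<tau> = 0"
  by (rule AE_unit_lebesgue) (use stage_defect_eq[of 0] borel_op_1 in eventually_elim, simp)

lemma borel_defect:
  defines "d \<equiv> \<lambda>k \<tau>. borel_op (\<lambda>\<sigma>. \<sigma> ^ k) \<tau> - \<tau> ^ Suc k / real (Suc k)"
  shows "square_integrable unit_lborel (d k)" "d k \<in> borel_measurable borel"
proof -
  have "square_integrable unit_lborel (\<lambda>\<tau>. (1 / real (Suc k)) * \<tau> ^ Suc k)"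
    by (intro square_integrable_cmult square_integrable_power)
  then show "square_integrable unit_lborel (d k)"
    unfolding d_def by (intro square_integrable_diff square_integrable_borel_op square_integrable_power) simp
  then show "d k \<in> borel_measurable borel" by (rule square_integrable_unit_lborel_measurable)
qed

lemma integral_weighted_defect:
  assumes "square_integrable unit_lborel q"
  shows "(LINT \<tau>|unit_lebesgue. q \<tau> * stage_defect k \<tau>)
    = unit_ip q (borel_op (\<lambda>\<sigma>. \<sigma> ^ k)) - unit_ip q (\<lambda>\<tau>. \<tau> ^ Suc k) / real (Suc k)"
proof -
  let ?d = "\<lambda>\<tau>. borel_op (\<lambda>\<sigma>. \<sigma> ^ k) \<tau> - \<tau> ^ Suc k / real (Suc k)"
  have q: "q \<in> borel_measurable borel" by (rule square_integrable_unit_lborel_measurable[OF assms])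
  have "AE \<tau> in unit_lborel. q \<tau> * stage_defect k \<tau> = q \<tau> * ?d \<tau>"
    using stage_defect_eq[of k] by eventually_elim (simp only:)
  from unit_lebesgue_AE_eq_borel(2)[OF borel_measurable_times[OF q borel_defect(2)] this]
  have "(LINT \<tau>|unit_lebesgue. q \<tau> * stage_defect k \<tau>)
      = (\<integral>\<tau>. q \<tau> * borel_op (\<lambda>\<sigma>. \<sigma> ^ k) \<tau> - (q \<tau> * \<tau> ^ Suc k) / real (Suc k) \<partial>unit_lborel)"
    by (simp only: right_diff_distrib times_divide_eq_right)
  also have "\<dots> = unit_ip q (borel_op (\<lambda>\<sigma>. \<sigma> ^ k)) - unit_ip q (\<lambda>\<tau>. \<tau> ^ Suc k) / real (Suc k)"
    using square_integrable_mult[OF assms square_integrable_borel_op[OF square_integrable_power]]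
      square_integrable_mult[OF assms square_integrable_power]
    by (simp del: power_Suc of_nat_Suc)
  finally show ?thesis .
qed

lemma integral_defect_1:
  assumes "\<alpha> (0, 1) = - sqrt 3 / 6"
  shows "(LINT \<tau>|unit_lebesgue. stage_defect 1 \<tau>) = 0"
  using integral_weighted_defect[OF square_integrable_1, of 1] assms integral_borel_op_id moments_of_powers
  by (simp add: power2_eq_square)

lemma integral_defect_2:
  assumes "\<alpha> (0, 1) = - sqrt 3 / 6" "\<alpha> (0, 2) = 0"
  shows "(LINT \<tau>|unit_lebesgue. stage_defect 2 \<tau>) = 0"
  using integral_weighted_defect[OF square_integrable_1, of 2] assms integral_borel_op_square
    moments_of_powers by (simp add: power3_eq_cube power2_eq_square mult.assoc)

lemma integral_id_defect_1:
  assumes "\<alpha> (0, 1) = - sqrt 3 / 6" "\<alpha> (1, 1) = 0"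
  shows "(LINT \<tau>|unit_lebesgue. \<tau> * stage_defect 1 \<tau>) = 0"
  using integral_weighted_defect[OF square_integrable_id, of 1] assms integral_id_borel_op_id
    moments_of_powers by (simp add: power3_eq_cube power2_eq_square mult.assoc)

lemma integral_stage_op_defect_1:
  assumes "\<alpha> (0, 1) = - sqrt 3 / 6" "\<alpha> (1, 1) = 0" "\<alpha> (0, 2) = 0"
    and "((\<lambda>i. \<alpha> (0, i) * \<alpha> (i, 1)) has_sum 0) {3..}"
  shows "(LINT \<tau>|unit_lebesgue. stage_op (stage_defect 1) \<tau>) = 0"
proof -
  let ?d = "\<lambda>\<tau>. borel_op (\<lambda>\<sigma>. \<sigma> ^ 1) \<tau> - \<tau> ^ Suc 1 / real (Suc 1)"
  note u = square_integrable_column_integral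
  note b = square_integrable_borel_op[OF square_integrable_id]
  have "(LINT \<tau>|unit_lebesgue. stage_op (stage_defect 1) \<tau>) = (\<integral>\<tau>. borel_op ?d \<tau> \<partial>unit_lborel)"
    by (rule unit_lebesgue_AE_eq_borel(2)[OF borel_op_measurable stage_op_eq_borel_op])
      (rule borel_defect(2) stage_defect_eq)+
  also have "\<dots> = unit_ip column_integral ?d" by (rule integral_borel_op[OF borel_defect(1)])
  also have "\<dots> = (\<integral>\<tau>. column_integral \<tau> * borel_op (\<lambda>\<sigma>. \<sigma>) \<tau> - column_integral \<tau> * \<tau> ^ 2 / 2 \<partial>unit_lborel)"
    by (simp add: right_diff_distrib power2_eq_square)
  also have "\<dots> = unit_ip column_integral (borel_op (\<lambda>\<sigma>. \<sigma>)) - unit_ip column_integral (\<lambda>\<tau>. \<tau> ^ 2) / 2"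
    using square_integrable_mult[OF u b] square_integrable_mult[OF u square_integrable_power] by simp
  also have "\<dots> = (\<integral>\<tau>. borel_op (borel_op (\<lambda>\<sigma>. \<sigma>)) \<tau> \<partial>unit_lborel)
      - (\<integral>\<tau>. borel_op (\<lambda>\<sigma>. \<sigma> ^ 2) \<tau> \<partial>unit_lborel) / 2"
    by (simp only: integral_borel_op[OF b] integral_borel_op[OF square_integrable_power])
  \<comment> \<open>The difference is 1/24 - (1/12) / 2.\<close>
  also have "\<dots> = 0"
    using integral_borel_op_borel_op_id[OF assms] integral_borel_op_square assms by simp
  finally show ?thesis .
qed

end

section \<open>The stage equation\<close>

text \<open>Continuity is known only on the box, so the composition is factored through a restricted
  Borel space.\<close>

lemma measurable_compose_stage:
  fixes \<Phi> :: "real \<Rightarrow> 'a::euclidean_space \<Rightarrow> 'b::euclidean_space"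
  assumes "continuous_on ({0..1} \<times> S) (\<lambda>p. \<Phi> (fst p) (snd p))"
    and "Z \<in> borel_measurable unit_lebesgue" "\<And>\<sigma>. \<sigma> \<in> {0..1} \<Longrightarrow> Z \<sigma> \<in> S"
  shows "(\<lambda>\<sigma>. \<Phi> \<sigma> (Z \<sigma>)) \<in> borel_measurable unit_lebesgue"
proof -
  have "(\<lambda>\<sigma>. (\<sigma>, Z \<sigma>)) \<in> borel_measurable unit_lebesgue"
    by (intro borel_measurable_Pair id_borel_measurable_lebesgue_on[unfolded id_def] assms(2))
  then have "(\<lambda>\<sigma>. (\<sigma>, Z \<sigma>)) \<in> unit_lebesgue \<rightarrow>\<^sub>M restrict_space borel ({0..1} \<times> S)"
    by (rule measurable_restrict_space2[rotated]) (use assms(3) in auto)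
  from measurable_compose[OF this borel_measurable_continuous_on_restrict[OF assms(1)]]
  show ?thesis by simp
qed

context csRK_kernel
begin

text \<open>Picard iteration, pointwise in \<tau>: the bound h m M \<le> r keeps the iterates in the
  ball, successive differences halve because h L M \<le> 1/2, and measurability passes to the
  pointwise limit.\<close>

lemma stage_equation_exists:
  fixes \<Phi> :: "real \<Rightarrow> 'a::euclidean_space \<Rightarrow> 'a"
  assumes cont: "continuous_on ({0..1} \<times> cball z0 r) (\<lambda>p. \<Phi> (fst p) (snd p))"
    and bound: "\<And>\<sigma> y. \<sigma> \<in> {0..1} \<Longrightarrow> y \<in> cball z0 r \<Longrightarrow> norm (\<Phi> \<sigma> y) \<le> m"
    and lip: "\<And>\<sigma> y y'. \<sigma> \<in> {0..1} \<Longrightarrow> y \<in> cball z0 r \<Longrightarrow> y' \<in> cball z0 r \<Longrightarrow>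
      norm (\<Phi> \<sigma> y - \<Phi> \<sigma> y') \<le> L * norm (y - y')"
    and h: "0 < h" "h * m * M \<le> r" "h * L * M \<le> 1 / 2" and mL: "0 \<le> m" "0 \<le> L"
  shows "\<exists>Z\<in>borel_measurable unit_lebesgue. \<forall>\<tau>\<in>{0..1}. Z \<tau> \<in> cball z0 r \<and>
    Z \<tau> = z0 + h *\<^sub>R stage_op (\<lambda>\<sigma>. \<Phi> \<sigma> (Z \<sigma>)) \<tau>"
proof -
  define N where "N = (\<lambda>Z \<tau>. z0 + h *\<^sub>R stage_op (\<lambda>\<sigma>. \<Phi> \<sigma> (Z \<sigma>)) \<tau>)"
  define X where "X = (\<lambda>n. (N ^^ n) (\<lambda>\<tau>. z0))"
  have X_Suc: "X (Suc n) = N (X n)" for n by (simp add: X_def)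
  have step: "N Z \<in> borel_measurable unit_lebesgue \<and> (\<forall>\<tau>\<in>{0..1}. N Z \<tau> \<in> cball z0 r)"
    if Z: "Z \<in> borel_measurable unit_lebesgue" "\<forall>\<tau>\<in>{0..1}. Z \<tau> \<in> cball z0 r" for Z
  proof
    have meas: "(\<lambda>\<sigma>. \<Phi> \<sigma> (Z \<sigma>)) \<in> borel_measurable unit_lebesgue"
      by (rule measurable_compose_stage[OF cont Z(1)]) (use Z(2) in blast)
    have "stage_op (\<lambda>\<sigma>. \<Phi> \<sigma> (Z \<sigma>)) \<in> borel_measurable unit_lebesgue"
      by (rule measurable_stage_op[OF meas, of m]) (use bound Z(2) in blast)
    then show "N Z \<in> borel_measurable unit_lebesgue" unfolding N_def by measurable
    show "\<forall>\<tau>\<in>{0..1}. N Z \<tau> \<in> cball z0 r"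
    proof
      fix \<tau> :: real assume "\<tau> \<in> {0..1}"
      then have "norm (stage_op (\<lambda>\<sigma>. \<Phi> \<sigma> (Z \<sigma>)) \<tau>) \<le> m * M"
        using bound Z(2) mL by (intro norm_stage_op_le AE_I2) auto
      then have "h * norm (stage_op (\<lambda>\<sigma>. \<Phi> \<sigma> (Z \<sigma>)) \<tau>) \<le> h * (m * M)"
        using h(1) by (intro mult_left_mono) auto
      also have "\<dots> \<le> r" using h(2) by (simp only: mult.assoc)
      finally show "N Z \<tau> \<in> cball z0 r" using h(1) by (simp add: N_def dist_norm)
    qed
  qed
  have r: "0 \<le> r" using h mL M_nonneg by (meson mult_nonneg_nonneg order_trans less_imp_le)
  have X: "X n \<in> borel_measurable unit_lebesgue \<and> (\<forall>\<tau>\<in>{0..1}. X n \<tau> \<in> cball z0 r)" for n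
  proof (induction n)
    case 0
    then show ?case using r by (simp add: X_def)
  next
    case (Suc n)
    then show ?case unfolding X_Suc using step by blast
  qed
  then have Xr: "X n \<tau> \<in> cball z0 r" if "\<tau> \<in> {0..1}" for n \<tau> using that by blast
  have i: "integrable unit_lebesgue (\<lambda>\<sigma>. A \<tau> \<sigma> *\<^sub>R \<Phi> \<sigma> (X n \<sigma>))" if "\<tau> \<in> {0..1}" for n \<tau>
  proof (rule stage_integrable[OF _ _ that])
    show "(\<lambda>\<sigma>. \<Phi> \<sigma> (X n \<sigma>)) \<in> borel_measurable unit_lebesgue"
      by (rule measurable_compose_stage[OF cont]) (use X in blast)+
    show "AE \<sigma> in unit_lebesgue. norm (\<Phi> \<sigma> (X n \<sigma>)) \<le> m"
      using bound X by (intro AE_I2) simp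
  qed
  have contr: "norm (X (Suc n) \<tau> - X n \<tau>) \<le> r * (1 / 2) ^ n" if "\<tau> \<in> {0..1}" for n \<tau>
    using that
  proof (induction n arbitrary: \<tau>)
    case 0
    have "X (Suc 0) \<tau> \<in> cball z0 r" using X[of "Suc 0"] 0 by blast
    then show ?case by (simp add: X_def dist_norm norm_minus_commute)
  next
    case (Suc n)
    have "norm (stage_op (\<lambda>\<sigma>. \<Phi> \<sigma> (X (Suc n) \<sigma>) - \<Phi> \<sigma> (X n \<sigma>)) \<tau>) \<le> (L * (r * (1 / 2) ^ n)) * M"
    proof (intro norm_stage_op_le AE_I2)
      fix \<sigma> assume "\<sigma> \<in> space unit_lebesgue"
      then have \<sigma>: "\<sigma> \<in> {0..1}" by simp
      have "norm (\<Phi> \<sigma> (X (Suc n) \<sigma>) - \<Phi> \<sigma> (X n \<sigma>)) \<le> L * norm (X (Suc n) \<sigma> - X n \<sigma>)"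
        by (rule lip[OF \<sigma> Xr[OF \<sigma>] Xr[OF \<sigma>]])
      also have "\<dots> \<le> L * (r * (1 / 2) ^ n)" by (rule mult_left_mono[OF Suc.IH[OF \<sigma>] mL(2)])
      finally show "norm (\<Phi> \<sigma> (X (Suc n) \<sigma>) - \<Phi> \<sigma> (X n \<sigma>)) \<le> L * (r * (1 / 2) ^ n)" .
    qed (use mL r Suc.prems in auto)
    moreover have "X (Suc (Suc n)) \<tau> - X (Suc n) \<tau>
        = h *\<^sub>R stage_op (\<lambda>\<sigma>. \<Phi> \<sigma> (X (Suc n) \<sigma>) - \<Phi> \<sigma> (X n \<sigma>)) \<tau>"
      unfolding stage_op_diff[OF i[OF Suc.prems] i[OF Suc.prems]]
      by (simp add: X_Suc[of "Suc n"] X_Suc[of n] N_def scaleR_diff_right)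
    ultimately have "norm (X (Suc (Suc n)) \<tau> - X (Suc n) \<tau>) \<le> h * ((L * (r * (1 / 2) ^ n)) * M)"
      using h(1) by (simp add: mult_left_mono)
    also have "\<dots> = (h * L * M) * (r * (1 / 2) ^ n)" by simp
    also have "\<dots> \<le> 1 / 2 * (r * (1 / 2) ^ n)" using h(3) r by (intro mult_right_mono) auto
    finally show ?case by simp
  qed
  define Z where "Z = (\<lambda>\<tau>. lim (\<lambda>n. X n \<tau>))"
  have conv: "(\<lambda>n. X n \<tau>) \<longlonglongrightarrow> Z \<tau>" if "\<tau> \<in> {0..1}" for \<tau>
  proof -
    have "summable (\<lambda>n. r * (1 / 2) ^ n)" by (rule summable_mult[OF summable_geometric]) simp
    then have "summable (\<lambda>n. X (Suc n) \<tau> - X n \<tau>)"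
      by (rule summable_comparison_test'[where N = 0]) (rule contr[OF that])
    then have "convergent (\<lambda>n. \<Sum>k<n. X (Suc k) \<tau> - X k \<tau>)" by (simp add: summable_iff_convergent)
    then have "convergent (\<lambda>n. X n \<tau> - X 0 \<tau>)" using sum_lessThan_telescope[of "\<lambda>k. X k \<tau>"] by simp
    from convergent_add[OF this convergent_const[of "X 0 \<tau>"]] have "convergent (\<lambda>n. X n \<tau>)" by simp
    then show ?thesis by (simp add: Z_def convergent_LIMSEQ_iff)
  qed
  have Zr: "Z \<tau> \<in> cball z0 r" if "\<tau> \<in> {0..1}" for \<tau>
    using closed_sequentially[OF closed_cball _ conv[OF that], of z0 r] X that by blast
  have Zm: "Z \<in> borel_measurable unit_lebesgue"
    by (rule borel_measurable_LIMSEQ_metric[where f = X]) (use X conv in auto)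
  have "Z \<tau> = z0 + h *\<^sub>R stage_op (\<lambda>\<sigma>. \<Phi> \<sigma> (Z \<sigma>)) \<tau>" if \<tau>: "\<tau> \<in> {0..1}" for \<tau>
  proof (rule LIMSEQ_unique)
    show "(\<lambda>n. X (Suc n) \<tau>) \<longlonglongrightarrow> Z \<tau>" using conv[OF \<tau>] by (rule LIMSEQ_Suc)
    \<comment> \<open>The limit in the fixed point equation is taken by dominated convergence, with
      the absolute value of the integrable row times \<open>m\<close> as majorant.\<close>
    have "(\<lambda>n. stage_op (\<lambda>\<sigma>. \<Phi> \<sigma> (X n \<sigma>)) \<tau>) \<longlonglongrightarrow> stage_op (\<lambda>\<sigma>. \<Phi> \<sigma> (Z \<sigma>)) \<tau>"
      unfolding stage_op_def
    proof (rule integral_dominated_convergence[where w = "\<lambda>\<sigma>. \<bar>A \<tau> \<sigma>\<bar> * m"])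
      have "(\<lambda>\<sigma>. \<Phi> \<sigma> (Z \<sigma>)) \<in> borel_measurable unit_lebesgue"
        by (rule measurable_compose_stage[OF cont Zm Zr])
      then show "(\<lambda>\<sigma>. A \<tau> \<sigma> *\<^sub>R \<Phi> \<sigma> (Z \<sigma>)) \<in> borel_measurable unit_lebesgue"
        using row_integrable[OF \<tau>] by measurable
      show "(\<lambda>\<sigma>. A \<tau> \<sigma> *\<^sub>R \<Phi> \<sigma> (X n \<sigma>)) \<in> borel_measurable unit_lebesgue" for n
        by (rule borel_measurable_integrable[OF i[OF \<tau>]])
      show "integrable unit_lebesgue (\<lambda>\<sigma>. \<bar>A \<tau> \<sigma>\<bar> * m)"
        using row_integrable[OF \<tau>] by simp
      show "AE \<sigma> in unit_lebesgue. norm (A \<tau> \<sigma> *\<^sub>R \<Phi> \<sigma> (X n \<sigma>)) \<le> \<bar>A \<tau> \<sigma>\<bar> * m" for n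
        using bound X by (intro AE_I2) (simp add: mult_left_mono)
      show "AE \<sigma> in unit_lebesgue. (\<lambda>n. A \<tau> \<sigma> *\<^sub>R \<Phi> \<sigma> (X n \<sigma>)) \<longlonglongrightarrow> A \<tau> \<sigma> *\<^sub>R \<Phi> \<sigma> (Z \<sigma>)"
      proof (rule AE_I2)
        fix \<sigma> assume "\<sigma> \<in> space unit_lebesgue"
        then have \<sigma>: "\<sigma> \<in> {0..1}" by simp
        have "(\<lambda>n. L * norm (X n \<sigma> - Z \<sigma>)) \<longlonglongrightarrow> L * norm (Z \<sigma> - Z \<sigma>)"
          by (intro tendsto_intros conv \<sigma>)
        then have lim: "(\<lambda>n. L * norm (X n \<sigma> - Z \<sigma>)) \<longlonglongrightarrow> 0" by simp
        have "\<forall>n. norm (\<Phi> \<sigma> (X n \<sigma>) - \<Phi> \<sigma> (Z \<sigma>)) \<le> L * norm (X n \<sigma> - Z \<sigma>)"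
          by (intro allI lip[OF \<sigma> Xr[OF \<sigma>] Zr[OF \<sigma>]])
        from Lim_null_comparison[OF always_eventually[OF this] lim]
        have "(\<lambda>n. \<Phi> \<sigma> (X n \<sigma>) - \<Phi> \<sigma> (Z \<sigma>)) \<longlonglongrightarrow> 0" .
        from tendsto_scaleR[OF tendsto_const LIM_zero_cancel[OF this]]
        show "(\<lambda>n. A \<tau> \<sigma> *\<^sub>R \<Phi> \<sigma> (X n \<sigma>)) \<longlonglongrightarrow> A \<tau> \<sigma> *\<^sub>R \<Phi> \<sigma> (Z \<sigma>)" .
      qed
    qed
    then show "(\<lambda>n. X (Suc n) \<tau>) \<longlonglongrightarrow> z0 + h *\<^sub>R stage_op (\<lambda>\<sigma>. \<Phi> \<sigma> (Z \<sigma>)) \<tau>"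
      unfolding X_Suc N_def by (intro tendsto_intros)
  qed
  then show ?thesis using Zm Zr by blast
qed

text \<open>Two solutions in the ball differ by at most 2r, and each use of the equation halves the
  bound. The integrability hypotheses are those provided by \<open>csRK_step\<close>, which does not
  speak of measurability of the stages.\<close>

lemma stage_equation_unique:
  fixes \<Phi> :: "real \<Rightarrow> 'a::euclidean_space \<Rightarrow> 'a"
  assumes lip: "\<And>\<sigma> y y'. \<sigma> \<in> {0..1} \<Longrightarrow> y \<in> cball z0 r \<Longrightarrow> y' \<in> cball z0 r \<Longrightarrow>
      norm (\<Phi> \<sigma> y - \<Phi> \<sigma> y') \<le> L * norm (y - y')"
    and h: "0 < h" "h * L * M \<le> 1 / 2" and L: "0 \<le> L"
    and Z: "\<And>\<tau>. \<tau> \<in> {0..1} \<Longrightarrow> Z \<tau> \<in> cball z0 r"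
      "\<And>\<tau>. \<tau> \<in> {0..1} \<Longrightarrow> integrable unit_lebesgue (\<lambda>\<sigma>. A \<tau> \<sigma> *\<^sub>R \<Phi> \<sigma> (Z \<sigma>))"
      "\<And>\<tau>. \<tau> \<in> {0..1} \<Longrightarrow> Z \<tau> = z0 + h *\<^sub>R stage_op (\<lambda>\<sigma>. \<Phi> \<sigma> (Z \<sigma>)) \<tau>"
    and Z': "\<And>\<tau>. \<tau> \<in> {0..1} \<Longrightarrow> Z' \<tau> \<in> cball z0 r"
      "\<And>\<tau>. \<tau> \<in> {0..1} \<Longrightarrow> integrable unit_lebesgue (\<lambda>\<sigma>. A \<tau> \<sigma> *\<^sub>R \<Phi> \<sigma> (Z' \<sigma>))"
      "\<And>\<tau>. \<tau> \<in> {0..1} \<Longrightarrow> Z' \<tau> = z0 + h *\<^sub>R stage_op (\<lambda>\<sigma>. \<Phi> \<sigma> (Z' \<sigma>)) \<tau>"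
    and \<tau>: "\<tau> \<in> {0..1}"
  shows "Z \<tau> = Z' \<tau>"
proof -
  have r: "0 \<le> r" using Z(1)[OF \<tau>] zero_le_dist[of z0 "Z \<tau>"] unfolding mem_cball by linarith
  have "norm (Z \<tau> - Z' \<tau>) \<le> 2 * r * (1 / 2) ^ n" if "\<tau> \<in> {0..1}" for n \<tau>
    using that
  proof (induction n arbitrary: \<tau>)
    case 0
    have "dist (Z \<tau>) (Z' \<tau>) \<le> dist z0 (Z \<tau>) + dist z0 (Z' \<tau>)"
      by (rule dist_triangle3)
    then show ?case using Z(1)[OF 0] Z'(1)[OF 0] by (simp add: dist_norm)
  next
    case (Suc n)
    let ?c = "2 * r * (1 / 2) ^ n"
    have "norm (stage_op (\<lambda>\<sigma>. \<Phi> \<sigma> (Z \<sigma>) - \<Phi> \<sigma> (Z' \<sigma>)) \<tau>) \<le> (L * ?c) * M"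
    proof (intro norm_stage_op_le AE_I2)
      fix \<sigma> assume "\<sigma> \<in> space unit_lebesgue"
      then have \<sigma>: "\<sigma> \<in> {0..1}" by simp
      show "norm (\<Phi> \<sigma> (Z \<sigma>) - \<Phi> \<sigma> (Z' \<sigma>)) \<le> L * ?c"
        using lip[OF \<sigma> Z(1)[OF \<sigma>] Z'(1)[OF \<sigma>]] mult_left_mono[OF Suc.IH[OF \<sigma>] L] by linarith
    qed (use L r Suc.prems in auto)
    moreover have "Z \<tau> - Z' \<tau> = h *\<^sub>R stage_op (\<lambda>\<sigma>. \<Phi> \<sigma> (Z \<sigma>) - \<Phi> \<sigma> (Z' \<sigma>)) \<tau>"
      unfolding stage_op_diff[OF Z(2)[OF Suc.prems] Z'(2)[OF Suc.prems]]
      by (subst Z(3)[OF Suc.prems], subst Z'(3)[OF Suc.prems]) (simp add: scaleR_diff_right)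
    ultimately have "norm (Z \<tau> - Z' \<tau>) \<le> h * ((L * ?c) * M)"
      using h(1) by (simp add: mult_left_mono)
    also have "\<dots> = (h * L * M) * ?c" by simp
    also have "\<dots> \<le> 1 / 2 * ?c" using h(2) r by (intro mult_right_mono) auto
    finally show ?case by simp
  qed
  from this[OF \<tau>] have le: "norm (Z \<tau> - Z' \<tau>) \<le> 2 * r * (1 / 2) ^ n" for n .
  have "(\<lambda>n. 2 * r * (1 / 2) ^ n) \<longlonglongrightarrow> 2 * r * 0"
    by (rule tendsto_mult_left[OF LIMSEQ_power_zero]) simp
  then have "norm (Z \<tau> - Z' \<tau>) \<le> 2 * r * 0"
    by (rule LIMSEQ_le_const) (use le in blast)
  then show ?thesis by simp
qed

end

section \<open>Convergence\<close>

text \<open>The situation in a box around the initial data. \<open>L\<close> bounds both the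
  Lipschitz constant in the state and the derivative; \<open>small\<close> makes the stage map a
  contraction on the ball of radius r/2.\<close>

locale csRK_ivp = csRK_method A \<alpha> g M for A \<alpha> g M +
  fixes f :: "real \<Rightarrow> 'a::euclidean_space \<Rightarrow> 'a" and U :: "(real \<times> 'a) set" and t0 :: real
    and z0 :: 'a and T :: real and z :: "real \<Rightarrow> 'a" and p :: nat and r h0 m L Q :: real
  assumes U: "open U" and Ck: "Ck_on p (\<lambda>x. f (fst x) (snd x)) U" and p: "2 \<le> p"
    and sol: "ivp_solution f U t0 z0 T z"
    and h0: "0 < h0" "h0 \<le> T" "h0 \<le> 1" and r: "0 < r" and mL: "0 \<le> m" "0 \<le> L"
    and box: "{t0..t0 + h0} \<times> cball z0 r \<subseteq> U"
    and z_near: "t \<in> {t0..t0 + h0} \<Longrightarrow> z t \<in> cball z0 r"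
    and f_bound: "t \<in> {t0..t0 + h0} \<Longrightarrow> y \<in> cball z0 r \<Longrightarrow> norm (f t y) \<le> m"
    and f_Lipschitz: "t \<in> {t0..t0 + h0} \<Longrightarrow> y \<in> cball z0 r \<Longrightarrow> y' \<in> cball z0 r \<Longrightarrow>
      norm (f t y - f t y') \<le> L * norm (y - y')"
    and f_deriv_bound: "t \<in> {t0..t0 + h0} \<Longrightarrow> y \<in> cball z0 r \<Longrightarrow>
      norm (frechet_derivative (\<lambda>x. f (fst x) (snd x)) (at (t, y)) v) \<le> L * norm v"
    and f_remainder: "t \<in> {t0..t0 + h0} \<Longrightarrow> y \<in> cball z0 r \<Longrightarrow> y' \<in> cball z0 r \<Longrightarrow>
      norm (f t y' - f t y - frechet_derivative (\<lambda>x. f (fst x) (snd x)) (at (t, y)) (0, y' - y))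
        \<le> Q * (norm (y' - y))\<^sup>2"
    and small: "h0 * m * M \<le> r / 2" "h0 * L * M \<le> 1 / 2"
begin

text \<open>The index set of the uniform estimates: every step size with every admissible stage
  function, so that the estimates do not presuppose uniqueness.\<close>

definition steps :: "(real \<times> (real \<Rightarrow> 'a)) set" where
  "steps = {(h, Z). 0 < h \<and> h < h0 \<and> (\<forall>\<tau>\<in>{0..1}. Z \<tau> \<in> ball z0 r \<and>
      integrable unit_lebesgue (\<lambda>\<sigma>. A \<tau> \<sigma> *\<^sub>R f (t0 + \<sigma> * h) (Z \<sigma>)) \<and>
      Z \<tau> = z0 + h *\<^sub>R stage_op (\<lambda>\<sigma>. f (t0 + \<sigma> * h) (Z \<sigma>)) \<tau>) \<and>
    integrable unit_lebesgue (\<lambda>\<sigma>. f (t0 + \<sigma> * h) (Z \<sigma>))}"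

definition num_rhs :: "real \<times> (real \<Rightarrow> 'a) \<Rightarrow> real \<Rightarrow> 'a" where
  "num_rhs w \<tau> = f (t0 + \<tau> * fst w) (snd w \<tau>)"

definition exact_stage :: "real \<times> (real \<Rightarrow> 'a) \<Rightarrow> real \<Rightarrow> 'a" where
  "exact_stage w \<tau> = z (t0 + \<tau> * fst w)"

definition exact_rhs :: "real \<times> (real \<Rightarrow> 'a) \<Rightarrow> real \<Rightarrow> 'a" where
  "exact_rhs w \<tau> = f (t0 + \<tau> * fst w) (exact_stage w \<tau>)"

definition stage_error :: "real \<times> (real \<Rightarrow> 'a) \<Rightarrow> real \<Rightarrow> 'a" where
  "stage_error w \<tau> = snd w \<tau> - exact_stage w \<tau>"

definition rhs_error :: "real \<times> (real \<Rightarrow> 'a) \<Rightarrow> real \<Rightarrow> 'a" where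
  "rhs_error w \<tau> = num_rhs w \<tau> - exact_rhs w \<tau>"

definition residual :: "real \<times> (real \<Rightarrow> 'a) \<Rightarrow> real \<Rightarrow> 'a" where
  "residual w \<tau> = z0 + fst w *\<^sub>R stage_op (exact_rhs w) \<tau> - exact_stage w \<tau>"

definition jacobian :: "real \<times> (real \<Rightarrow> 'a) \<Rightarrow> real \<Rightarrow> 'a \<Rightarrow> 'a" where
  "jacobian w \<tau> v =
    frechet_derivative (\<lambda>x. f (fst x) (snd x)) (at (t0 + \<tau> * fst w, exact_stage w \<tau>)) (0, v)"

lemma time_in:
  assumes "0 < h" "h < h0" "\<tau> \<in> {0..1}"
  shows "t0 + \<tau> * h \<in> {t0..t0 + h0}"
proof -
  have "\<tau> * h \<le> 1 * h" using assms by (intro mult_right_mono) auto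
  moreover have "0 \<le> \<tau> * h" using assms by simp
  ultimately show ?thesis using assms(2) unfolding atLeastAtMost_iff by linarith
qed

lemma stepsD:
  assumes "w \<in> steps"
  shows "0 < fst w" "fst w < h0" "fst w \<le> 1"
    and "\<tau> \<in> {0..1} \<Longrightarrow> snd w \<tau> \<in> cball z0 r"
    and "\<tau> \<in> {0..1} \<Longrightarrow> integrable unit_lebesgue (\<lambda>\<sigma>. A \<tau> \<sigma> *\<^sub>R num_rhs w \<sigma>)"
    and "\<tau> \<in> {0..1} \<Longrightarrow> snd w \<tau> = z0 + fst w *\<^sub>R stage_op (num_rhs w) \<tau>"
    and "integrable unit_lebesgue (num_rhs w)"
    and "\<tau> \<in> {0..1} \<Longrightarrow> t0 + \<tau> * fst w \<in> {t0..t0 + h0}"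
    and "\<tau> \<in> {0..1} \<Longrightarrow> exact_stage w \<tau> \<in> cball z0 r"
proof -
  obtain h Z where w: "w = (h, Z)" by (cases w)
  then have hZ: "(h, Z) \<in> steps" using assms by simp
  have n: "num_rhs w = (\<lambda>\<sigma>. f (t0 + \<sigma> * h) (Z \<sigma>))" by (auto simp: num_rhs_def w)
  show 1: "0 < fst w" "fst w < h0" "fst w \<le> 1" using hZ h0 by (auto simp: steps_def w)
  show "\<tau> \<in> {0..1} \<Longrightarrow> snd w \<tau> \<in> cball z0 r"
    using hZ ball_subset_cball[of z0 r] unfolding steps_def w snd_conv by blast
  show "\<tau> \<in> {0..1} \<Longrightarrow> integrable unit_lebesgue (\<lambda>\<sigma>. A \<tau> \<sigma> *\<^sub>R num_rhs w \<sigma>)"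
    using hZ unfolding n by (simp add: steps_def)
  show "\<tau> \<in> {0..1} \<Longrightarrow> snd w \<tau> = z0 + fst w *\<^sub>R stage_op (num_rhs w) \<tau>"
    using hZ unfolding n by (simp add: steps_def w)
  show "integrable unit_lebesgue (num_rhs w)"
    using hZ unfolding n by (simp add: steps_def)
  show t: "\<tau> \<in> {0..1} \<Longrightarrow> t0 + \<tau> * fst w \<in> {t0..t0 + h0}" using time_in 1 by blast
  then show "\<tau> \<in> {0..1} \<Longrightarrow> exact_stage w \<tau> \<in> cball z0 r"
    unfolding exact_stage_def by (intro z_near)
qed

sublocale csRK_family A M steps fst
  by unfold_locales (auto intro: stepsD)

lemma sol_at:
  assumes "t \<in> {t0..t0 + h0}"
  shows "(t, z t) \<in> U"
    and "(z has_vector_derivative f t (z t)) (at t within {t0..t0 + h0})"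
  using sol assms h0 unfolding ivp_solution_def
  by (auto intro: has_vector_derivative_within_subset[of _ _ _ "{t0..t0 + T}"])

lemma z_t0: "z t0 = z0"
  using sol by (simp add: ivp_solution_def)

lemma sol_h0: "ivp_solution f U t0 z0 h0 z"
  using sol_at z_t0 by (auto simp: ivp_solution_def)

lemma continuous_on_z: "continuous_on {t0..t0 + h0} z"
  by (rule continuous_on_vector_derivative) (rule sol_at)

lemma continuous_on_f: "continuous_on U (\<lambda>x. f (fst x) (snd x))"
  by (rule Ck_on_imp_continuous_on[OF Ck])

lemma exact_rhs_measurable:
  assumes "w \<in> steps"
  shows "exact_rhs w \<in> borel_measurable unit_lebesgue"
proof -
  have "continuous_on {0..1} (\<lambda>\<tau>. z (t0 + \<tau> * fst w))"
    by (rule continuous_on_compose2[OF continuous_on_z])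
      (auto intro!: continuous_intros simp: stepsD(8)[OF assms, simplified])
  then have "continuous_on {0..1} (\<lambda>\<tau>. (t0 + \<tau> * fst w, z (t0 + \<tau> * fst w)))"
    by (intro continuous_intros)
  then have "continuous_on {0..1} (\<lambda>\<tau>. f (fst (t0 + \<tau> * fst w, z (t0 + \<tau> * fst w)))
      (snd (t0 + \<tau> * fst w, z (t0 + \<tau> * fst w))))"
    by (rule continuous_on_compose2[OF continuous_on_f]) (use sol_at(1) stepsD(8)[OF assms] in blast)
  then show ?thesis
    unfolding exact_rhs_def exact_stage_def fst_conv snd_conv
    by (intro continuous_imp_measurable_on_sets_lebesgue) auto
qed

lemma exact_rhs_bounded: "w \<in> steps \<Longrightarrow> \<tau> \<in> {0..1} \<Longrightarrow> norm (exact_rhs w \<tau>) \<le> m"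
  unfolding exact_rhs_def by (intro f_bound stepsD)

lemma num_rhs_bounded: "w \<in> steps \<Longrightarrow> \<tau> \<in> {0..1} \<Longrightarrow> norm (num_rhs w \<tau>) \<le> m"
  unfolding num_rhs_def by (intro f_bound stepsD)

lemma exact_rhs_integrable:
  assumes "w \<in> steps"
  shows "integrable unit_lebesgue (exact_rhs w)"
    and "\<tau> \<in> {0..1} \<Longrightarrow> integrable unit_lebesgue (\<lambda>\<sigma>. A \<tau> \<sigma> *\<^sub>R exact_rhs w \<sigma>)"
proof -
  have "AE \<tau> in unit_lebesgue. norm (exact_rhs w \<tau>) \<le> m"
    using exact_rhs_bounded[OF assms] by (intro AE_I2) simp
  note b = exact_rhs_measurable[OF assms] this
  show "integrable unit_lebesgue (exact_rhs w)" by (rule integrable_unit_lebesgue_bounded[OF b])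
  show "\<tau> \<in> {0..1} \<Longrightarrow> integrable unit_lebesgue (\<lambda>\<sigma>. A \<tau> \<sigma> *\<^sub>R exact_rhs w \<sigma>)"
    by (rule stage_integrable[OF b])
qed

section \<open>Expansions of the residual and of the Jacobian\<close>

lemma stage_op_power_sum:
  fixes c :: "nat \<Rightarrow> 'a"
  assumes "\<tau> \<in> {0..1}"
  shows "integrable unit_lebesgue (\<lambda>\<sigma>. A \<tau> \<sigma> *\<^sub>R (\<Sum>k<n. (\<sigma> * h) ^ k *\<^sub>R c k))"
    and "stage_op (\<lambda>\<sigma>. \<Sum>k<n. (\<sigma> * h) ^ k *\<^sub>R c k) \<tau>
      = (\<Sum>k<n. (h ^ k * stage_op (\<lambda>\<sigma>. \<sigma> ^ k) \<tau>) *\<^sub>R c k)"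
proof -
  have e: "A \<tau> \<sigma> *\<^sub>R (\<Sum>k<n. (\<sigma> * h) ^ k *\<^sub>R c k)
      = (\<Sum>k<n. (h ^ k * (A \<tau> \<sigma> *\<^sub>R \<sigma> ^ k)) *\<^sub>R c k)" for \<sigma>
    by (simp add: scaleR_sum_right power_mult_distrib mult_ac)
  have i: "integrable unit_lebesgue (\<lambda>\<sigma>. A \<tau> \<sigma> *\<^sub>R \<sigma> ^ k)" for k
    by (rule stage_integrable[OF power_measurable _ assms, of _ 1]) (auto intro!: AE_I2 simp: power_le_one)
  have i': "integrable unit_lebesgue (\<lambda>\<sigma>. (h ^ k * (A \<tau> \<sigma> *\<^sub>R \<sigma> ^ k)) *\<^sub>R c k)" for k
    by (intro integrable_scaleR_left integrable_mult_right i)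
  show "integrable unit_lebesgue (\<lambda>\<sigma>. A \<tau> \<sigma> *\<^sub>R (\<Sum>k<n. (\<sigma> * h) ^ k *\<^sub>R c k))"
    unfolding e by (intro Bochner_Integration.integrable_sum i')
  show "stage_op (\<lambda>\<sigma>. \<Sum>k<n. (\<sigma> * h) ^ k *\<^sub>R c k) \<tau>
      = (\<Sum>k<n. (h ^ k * stage_op (\<lambda>\<sigma>. \<sigma> ^ k) \<tau>) *\<^sub>R c k)"
  proof -
    have "stage_op (\<lambda>\<sigma>. \<Sum>k<n. (\<sigma> * h) ^ k *\<^sub>R c k) \<tau>
        = (\<Sum>k<n. LINT \<sigma>|unit_lebesgue. (h ^ k * (A \<tau> \<sigma> *\<^sub>R \<sigma> ^ k)) *\<^sub>R c k)"
      unfolding stage_op_def e by (rule Bochner_Integration.integral_sum) (rule i')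
    also have "\<dots> = (\<Sum>k<n. (h ^ k * stage_op (\<lambda>\<sigma>. \<sigma> ^ k) \<tau>) *\<^sub>R c k)"
    proof (rule sum.cong[OF refl])
      fix k
      have "(LINT \<sigma>|unit_lebesgue. (h ^ k * (A \<tau> \<sigma> *\<^sub>R \<sigma> ^ k)) *\<^sub>R c k)
          = (LINT \<sigma>|unit_lebesgue. h ^ k * (A \<tau> \<sigma> *\<^sub>R \<sigma> ^ k)) *\<^sub>R c k"
        by (rule integral_scaleR_left) (intro integrable_mult_right i)
      then show "(LINT \<sigma>|unit_lebesgue. (h ^ k * (A \<tau> \<sigma> *\<^sub>R \<sigma> ^ k)) *\<^sub>R c k)
          = (h ^ k * stage_op (\<lambda>\<sigma>. \<sigma> ^ k) \<tau>) *\<^sub>R c k"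
        unfolding stage_op_def integral_mult_right_zero .
    qed
    finally show ?thesis .
  qed
qed

text \<open>The same coefficients c_k serve the right-hand side along the solution and, after
  integration, the solution itself. For the power (t - t0)^k the stage quadrature minus the exact
  integral is h^(k+1) times \<open>stage_defect k\<close>.\<close>

lemma residual_expansion_all:
  assumes "n \<le> p"
  shows "\<exists>c. bigO_h (Suc n) (\<lambda>w \<tau>. residual w \<tau>
    - (\<Sum>k<n. (fst w ^ Suc k * stage_defect k \<tau>) *\<^sub>R c k))"
proof -
  have Ckn: "Ck_on n (\<lambda>x. f (fst x) (snd x)) U" by (rule Ck_on_mono[OF Ck assms])
  obtain c K where "\<forall>t\<in>{t0..t0 + h0}.
      norm (f t (z t) - (\<Sum>k<n. (t - t0) ^ k *\<^sub>R c k)) \<le> K * (t - t0) ^ n"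
    using ivp_power_expansion[OF U Ckn Ckn sol_h0] by auto
  note cK = this[rule_format]
  have cK': "norm (z t - z0 - (\<Sum>k<n. ((t - t0) ^ Suc k / real (Suc k)) *\<^sub>R c k)) \<le> K * (t - t0) ^ Suc n"
    if "t \<in> {t0..t0 + h0}" for t
    using integrate_power_expansion[OF sol_at(2) cK that] unfolding z_t0 .
  have "bigO_h (Suc n) (\<lambda>w \<tau>. residual w \<tau> - (\<Sum>k<n. (fst w ^ Suc k * stage_defect k \<tau>) *\<^sub>R c k))"
  proof (rule bigO_hI[where K = "\<bar>K\<bar> * M + \<bar>K\<bar>"], intro AE_I2)
    fix w \<tau> assume w: "w \<in> steps" and "\<tau> \<in> space unit_lebesgue"
    then have \<tau>: "\<tau> \<in> {0..1}" by simp
    define h where "h = fst w"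
    have h: "0 < h" "h \<le> 1" using stepsD[OF w] by (simp_all add: h_def)
    have pow: "K * (\<sigma> * h) ^ j \<le> \<bar>K\<bar> * h ^ j" if "\<sigma> \<in> {0..1}" for \<sigma> j
    proof -
      have "(\<sigma> * h) ^ j \<le> h ^ j"
        using that h mult_right_mono[of \<sigma> 1 h] by (intro power_mono) auto
      moreover have "0 \<le> (\<sigma> * h) ^ j" using that h by simp
      ultimately show ?thesis by (intro mult_mono) auto
    qed
    let ?P = "\<lambda>\<sigma>. \<Sum>k<n. (\<sigma> * h) ^ k *\<^sub>R c k"
    let ?Z = "\<Sum>k<n. ((\<tau> * h) ^ Suc k / real (Suc k)) *\<^sub>R c k"
    have G: "norm (exact_rhs w \<sigma> - ?P \<sigma>) \<le> \<bar>K\<bar> * h ^ n" if "\<sigma> \<in> {0..1}" for \<sigma>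
      using cK[OF stepsD(8)[OF w that]] pow[OF that, of n]
      by (simp add: exact_rhs_def exact_stage_def h_def)
    have "norm (stage_op (\<lambda>\<sigma>. exact_rhs w \<sigma> - ?P \<sigma>) \<tau>) \<le> (\<bar>K\<bar> * h ^ n) * M"
      by (rule norm_stage_op_le[OF AE_I2 _ \<tau>]) (use G h in auto)
    then have "h * norm (stage_op (\<lambda>\<sigma>. exact_rhs w \<sigma> - ?P \<sigma>) \<tau>) \<le> h * ((\<bar>K\<bar> * h ^ n) * M)"
      using h by (intro mult_left_mono) auto
    then have 1: "norm (h *\<^sub>R stage_op (\<lambda>\<sigma>. exact_rhs w \<sigma> - ?P \<sigma>) \<tau>) \<le> \<bar>K\<bar> * M * h ^ Suc n"
      using h by (simp add: mult_ac)
    have 2: "norm (exact_stage w \<tau> - z0 - ?Z) \<le> \<bar>K\<bar> * h ^ Suc n"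
      using cK'[OF stepsD(8)[OF w \<tau>]] pow[OF \<tau>, of "Suc n"]
      by (simp add: exact_stage_def h_def del: power_Suc of_nat_Suc)
    have "(\<Sum>k<n. (h ^ Suc k * stage_defect k \<tau>) *\<^sub>R c k)
        = h *\<^sub>R (\<Sum>k<n. (h ^ k * stage_op (\<lambda>\<sigma>. \<sigma> ^ k) \<tau>) *\<^sub>R c k) - ?Z"
      unfolding scaleR_sum_right sum_subtractf[symmetric]
      by (intro sum.cong refl)
        (simp add: stage_defect_def power_mult_distrib right_diff_distrib scaleR_diff_left mult_ac
          del: of_nat_Suc)
    then have "residual w \<tau> - (\<Sum>k<n. (h ^ Suc k * stage_defect k \<tau>) *\<^sub>R c k)
        = h *\<^sub>R (stage_op (exact_rhs w) \<tau> - stage_op ?P \<tau>) - (exact_stage w \<tau> - z0 - ?Z)"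
      unfolding stage_op_power_sum(2)[OF \<tau>] residual_def h_def[symmetric]
      by (simp add: scaleR_diff_right)
    also have "stage_op (exact_rhs w) \<tau> - stage_op ?P \<tau> = stage_op (\<lambda>\<sigma>. exact_rhs w \<sigma> - ?P \<sigma>) \<tau>"
      by (rule stage_op_diff[symmetric, OF exact_rhs_integrable(2)[OF w \<tau>] stage_op_power_sum(1)[OF \<tau>]])
    finally have "norm (residual w \<tau> - (\<Sum>k<n. (h ^ Suc k * stage_defect k \<tau>) *\<^sub>R c k))
        \<le> \<bar>K\<bar> * M * h ^ Suc n + \<bar>K\<bar> * h ^ Suc n"
      using order_trans[OF norm_triangle_ineq4 add_mono[OF 1 2]] by simp
    then show "norm (residual w \<tau> - (\<Sum>k<n. (fst w ^ Suc k * stage_defect k \<tau>) *\<^sub>R c k))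
        \<le> (\<bar>K\<bar> * M + \<bar>K\<bar>) * fst w ^ Suc n"
      unfolding h_def distrib_right .
  qed
  then show ?thesis by blast
qed

lemma bigO_h_const: "bigO_h 0 (\<lambda>w \<tau>. c)"
  by (rule bigO_hI[where K = "norm c"]) simp

lemma defect_0_bigO: "bigO_h k (\<lambda>w \<tau>. (fst w ^ j * stage_defect 0 \<tau>) *\<^sub>R (c :: 'a))"
proof (rule bigO_hI[where K = 0])
  show "AE \<tau> in unit_lebesgue. norm ((fst w ^ j * stage_defect 0 \<tau>) *\<^sub>R c) \<le> 0 * fst w ^ k" for w
    using stage_defect_0 by eventually_elim simp
qed

text \<open>The k = 0 term vanishes almost everywhere and is dropped, which shifts the coefficients:
  \<open>c k\<close> belongs to \<open>stage_defect (Suc k)\<close>.\<close>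

lemma residual_expansion:
  assumes "Suc n \<le> p"
  shows "\<exists>c. bigO_h (Suc (Suc n)) (\<lambda>w \<tau>. residual w \<tau>
    - (\<Sum>k<n. (fst w ^ Suc (Suc k) * stage_defect (Suc k) \<tau>) *\<^sub>R c k))"
proof -
  obtain c where c: "bigO_h (Suc (Suc n)) (\<lambda>w \<tau>. residual w \<tau>
    - (\<Sum>k<Suc n. (fst w ^ Suc k * stage_defect k \<tau>) *\<^sub>R c k))"
    using residual_expansion_all[OF assms] by blast
  have "bigO_h (Suc (Suc n)) (\<lambda>w \<tau>. residual w \<tau>
    - (\<Sum>k<n. (fst w ^ Suc (Suc k) * stage_defect (Suc k) \<tau>) *\<^sub>R c (Suc k)))"
    by (rule bigO_h_cong[OF bigO_h_add[OF c defect_0_bigO[of _ 1 "c 0"]]])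
      (simp add: sum.lessThan_Suc_shift del: sum.lessThan_Suc)
  then show ?thesis by (intro exI[of _ "\<lambda>k. c (Suc k)"])
qed

text \<open>The derivative of \<open>f\<close> in the fixed direction (0, v) is itself a function on
  \<open>U\<close>, to which the expansion along solutions applies; taking it uses up one degree of
  smoothness.\<close>

lemma jacobian_expansion:
  assumes "Suc n \<le> p"
  shows "\<exists>j. bigO_h n (\<lambda>w \<tau>. jacobian w \<tau> v - (\<Sum>k<n. (\<tau> * fst w) ^ k *\<^sub>R j k))"
proof -
  have "Ck_on n (\<lambda>x. frechet_derivative (\<lambda>x. f (fst x) (snd x)) (at x) (0, v)) U"
    by (rule Ck_on_directional[OF Ck_on_mono[OF Ck assms]])
  moreover have "Ck_on n (\<lambda>x. f (fst x) (snd x)) U" by (rule Ck_on_mono[OF Ck]) (use assms in simp)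
  ultimately obtain j K where "\<forall>t\<in>{t0..t0 + h0}.
      norm (frechet_derivative (\<lambda>x. f (fst x) (snd x)) (at (t, z t)) (0, v)
        - (\<Sum>k<n. (t - t0) ^ k *\<^sub>R j k)) \<le> K * (t - t0) ^ n"
    using ivp_power_expansion[OF U _ _ sol_h0, of n
        "\<lambda>x. frechet_derivative (\<lambda>x. f (fst x) (snd x)) (at x) (0, v)"] by auto
  note jK = this[rule_format]
  have "bigO_h n (\<lambda>w \<tau>. jacobian w \<tau> v - (\<Sum>k<n. (\<tau> * fst w) ^ k *\<^sub>R j k))"
  proof (rule bigO_hI[where K = "\<bar>K\<bar>"], intro AE_I2)
    fix w \<tau> assume w: "w \<in> steps" and "\<tau> \<in> space unit_lebesgue"
    then have \<tau>: "\<tau> \<in> {0..1}" by simp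
    have "norm (jacobian w \<tau> v - (\<Sum>k<n. (\<tau> * fst w) ^ k *\<^sub>R j k)) \<le> K * (\<tau> * fst w) ^ n"
      using jK[OF stepsD(8)[OF w \<tau>]] by (simp add: jacobian_def exact_stage_def)
    also have "\<dots> \<le> \<bar>K\<bar> * fst w ^ n"
    proof -
      have h: "0 < fst w" using stepsD(1)[OF w] .
      have "(\<tau> * fst w) ^ n \<le> fst w ^ n"
        using \<tau> h mult_right_mono[of \<tau> 1 "fst w"] by (intro power_mono) auto
      moreover have "0 \<le> (\<tau> * fst w) ^ n" using \<tau> h by simp
      ultimately show ?thesis by (intro mult_mono) auto
    qed
    finally show "norm (jacobian w \<tau> v - (\<Sum>k<n. (\<tau> * fst w) ^ k *\<^sub>R j k)) \<le> \<bar>K\<bar> * fst w ^ n" .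
  qed
  then show ?thesis by blast
qed

lemma stage_error_eq:
  assumes "w \<in> steps" "\<tau> \<in> {0..1}"
  shows "stage_error w \<tau> = fst w *\<^sub>R stage_op (rhs_error w) \<tau> + residual w \<tau>"
proof -
  have "stage_op (rhs_error w) \<tau> = stage_op (num_rhs w) \<tau> - stage_op (exact_rhs w) \<tau>"
    unfolding rhs_error_def
    by (rule stage_op_diff[OF stepsD(5)[OF assms] exact_rhs_integrable(2)[OF assms]])
  then show ?thesis
    unfolding stage_error_def residual_def stepsD(6)[OF assms] by (simp add: scaleR_diff_right)
qed

text \<open>The crude start of the bootstrap: both right-hand sides are bounded by \<open>m\<close>
  in the box, the factor h does the rest, and the residual expansion without any terms is
  O(h).\<close>

lemma stage_error_bigO_1: "bigO_h 1 stage_error"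
proof -
  have "bigO_h 1 (\<lambda>w \<tau>. fst w *\<^sub>R stage_op (rhs_error w) \<tau>)"
  proof (rule bigO_hI[where K = "2 * m * M"], intro AE_I2)
    fix w \<tau> assume w: "w \<in> steps" and "\<tau> \<in> space unit_lebesgue"
    then have \<tau>: "\<tau> \<in> {0..1}" by simp
    have "norm (stage_op (rhs_error w) \<tau>) \<le> (2 * m) * M"
    proof (intro norm_stage_op_le AE_I2 \<tau>)
      fix \<sigma> assume "\<sigma> \<in> space unit_lebesgue"
      then have \<sigma>: "\<sigma> \<in> {0..1}" by simp
      show "norm (rhs_error w \<sigma>) \<le> 2 * m"
        using norm_triangle_ineq4[of "num_rhs w \<sigma>" "exact_rhs w \<sigma>"] num_rhs_bounded[OF w \<sigma>]
          exact_rhs_bounded[OF w \<sigma>] unfolding rhs_error_def by linarith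
    qed (use mL in auto)
    then show "norm (fst w *\<^sub>R stage_op (rhs_error w) \<tau>) \<le> 2 * m * M * fst w ^ 1"
      using stepsD(1)[OF w] by (simp add: mult_left_mono mult.commute)
  qed
  moreover have "bigO_h 1 residual"
    using residual_expansion_all[of 0] by simp
  ultimately show ?thesis
    by (rule bigO_h_cong[OF bigO_h_add]) (rule stage_error_eq)
qed

lemma rhs_differentiable:
  assumes "w \<in> steps" "\<tau> \<in> {0..1}"
  shows "((\<lambda>x. f (fst x) (snd x)) has_derivative
    frechet_derivative (\<lambda>x. f (fst x) (snd x)) (at (t0 + \<tau> * fst w, exact_stage w \<tau>)))
    (at (t0 + \<tau> * fst w, exact_stage w \<tau>))"
proof (rule Ck_on_has_derivative)
  show "Ck_on (Suc 0) (\<lambda>x. f (fst x) (snd x)) U" by (rule Ck_on_mono[OF Ck]) (use p in simp)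
  show "(t0 + \<tau> * fst w, exact_stage w \<tau>) \<in> U"
    unfolding exact_stage_def by (rule sol_at[OF stepsD(8)[OF assms]])
qed

sublocale csRK_error A M steps fst stage_error rhs_error residual jacobian L Q
proof (rule csRK_error.intro[OF _ csRK_error_axioms.intro])
  show "csRK_family A M steps fst" by unfold_locales
next
  fix w assume w: "w \<in> steps"
  show "rhs_error w \<in> borel_measurable unit_lebesgue"
    unfolding rhs_error_def
    by (intro borel_measurable_diff borel_measurable_integrable[OF stepsD(7)[OF w]] exact_rhs_measurable w)
  have "norm (rhs_error w \<tau>) \<le> 2 * m" if "\<tau> \<in> {0..1}" for \<tau>
    using norm_triangle_ineq4[of "num_rhs w \<tau>" "exact_rhs w \<tau>"] num_rhs_bounded[OF w that]
      exact_rhs_bounded[OF w that] unfolding rhs_error_def by linarith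
  then show "\<exists>c. \<forall>\<tau>\<in>{0..1}. norm (rhs_error w \<tau>) \<le> c" by blast
next
  fix w and \<tau> :: real assume w: "w \<in> steps" and \<tau>: "\<tau> \<in> {0..1}"
  note in_box = stepsD(8)[OF w \<tau>] stepsD(9)[OF w \<tau>] stepsD(4)[OF w \<tau>]
  show "stage_error w \<tau> = fst w *\<^sub>R stage_op (rhs_error w) \<tau> + residual w \<tau>"
    by (rule stage_error_eq[OF w \<tau>])
  have "linear (\<lambda>v :: 'a. (0 :: real, v))" by (rule linearI) auto
  from linear_compose[OF this has_derivative_linear[OF rhs_differentiable[OF w \<tau>]]]
  show "linear (jacobian w \<tau>)" by (simp add: jacobian_def[abs_def] comp_def)
  show "norm (rhs_error w \<tau>) \<le> L * norm (stage_error w \<tau>)"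
    unfolding rhs_error_def stage_error_def num_rhs_def exact_rhs_def
    by (rule f_Lipschitz[OF in_box(1) in_box(3) in_box(2)])
  show "norm (rhs_error w \<tau> - jacobian w \<tau> (stage_error w \<tau>)) \<le> Q * (norm (stage_error w \<tau>))\<^sup>2"
    unfolding rhs_error_def stage_error_def num_rhs_def exact_rhs_def jacobian_def
    by (rule f_remainder[OF in_box])
next
  fix w and \<tau> :: real and v :: 'a assume w: "w \<in> steps" and \<tau>: "\<tau> \<in> {0..1}"
  show "norm (jacobian w \<tau> v) \<le> L * norm v"
    using f_deriv_bound[OF stepsD(8)[OF w \<tau>] stepsD(9)[OF w \<tau>], of "(0, v)"]
    by (simp add: jacobian_def norm_Pair)
next
  show "bigO_h 1 stage_error" by (rule stage_error_bigO_1)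
  show "bigO_h 2 residual" using residual_expansion[of 0] p by (simp add: numeral_2_eq_2)
qed

text \<open>Supplies the abstract order lemmas with the residual and Jacobian expansions, each cut
  off where the order requires.\<close>

lemma rhs_error_order:
  assumes "p \<le> 4"
    and "3 \<le> p \<Longrightarrow> \<alpha> (0, 1) = - sqrt 3 / 6"
    and "4 \<le> p \<Longrightarrow> \<alpha> (1, 1) = 0" "4 \<le> p \<Longrightarrow> \<alpha> (0, 2) = 0"
    and "4 \<le> p \<Longrightarrow> ((\<lambda>i. \<alpha> (0, i) * \<alpha> (i, 1)) has_sum 0) {3..}"
  shows "\<exists>K. \<forall>w\<in>steps. norm (LINT \<tau>|unit_lebesgue. rhs_error w \<tau>) \<le> K * fst w ^ p"
proof -
  note d = stage_defect_measurable stage_defect_bounded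
  consider "p = 2" | "p = 3" | "p = 4" using p assms(1) by linarith
  then show ?thesis
  proof cases
    case 1
    then show ?thesis using order_2 by simp
  next
    case 2
    obtain c where "bigO_h (Suc (Suc 1)) (\<lambda>w \<tau>. residual w \<tau>
        - (\<Sum>k<1. (fst w ^ Suc (Suc k) * stage_defect (Suc k) \<tau>) *\<^sub>R c k))"
      using residual_expansion[of 1] 2 by auto
    then have R3: "bigO_h 3 (\<lambda>w \<tau>. residual w \<tau> - (fst w ^ 2 * stage_defect 1 \<tau>) *\<^sub>R c 0)"
      by (simp add: numeral_3_eq_3 numeral_2_eq_2)
    obtain j where "bigO_h 1 (\<lambda>w \<tau>. jacobian w \<tau> (c 0) - (\<Sum>k<1. (\<tau> * fst w) ^ k *\<^sub>R j k))"
      using jacobian_expansion[of 1 "c 0"] 2 by auto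
    then have J: "bigO_h 1 (\<lambda>w \<tau>. jacobian w \<tau> (c 0) - j 0)" by simp
    have "(LINT \<tau>|unit_lebesgue. stage_defect 1 \<tau>) = 0" by (rule integral_defect_1) (use 2 assms in simp)
    from order_3[OF d this R3 J] show ?thesis using 2 by simp
  next
    case 3
    obtain c where "bigO_h (Suc (Suc 2)) (\<lambda>w \<tau>. residual w \<tau>
        - (\<Sum>k<2. (fst w ^ Suc (Suc k) * stage_defect (Suc k) \<tau>) *\<^sub>R c k))"
      using residual_expansion[of 2] 3 by auto
    then have R4: "bigO_h 4 (\<lambda>w \<tau>. residual w \<tau> - (fst w ^ 2 * stage_defect 1 \<tau>) *\<^sub>R c 0
        - (fst w ^ 3 * stage_defect 2 \<tau>) *\<^sub>R c 1)"
      by (simp add: eval_nat_numeral diff_diff_eq)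
    \<comment> \<open>\<open>order_4\<close> also asks for the expansions used at order 3; they
      follow by absorbing the next term into the remainder.\<close>
    have R3: "bigO_h 3 (\<lambda>w \<tau>. residual w \<tau> - (fst w ^ 2 * stage_defect 1 \<tau>) *\<^sub>R c 0)"
    proof (rule bigO_h_cong)
      show "bigO_h 3 (\<lambda>w \<tau>. (residual w \<tau> - (fst w ^ 2 * stage_defect 1 \<tau>) *\<^sub>R c 0
        - (fst w ^ 3 * stage_defect 2 \<tau>) *\<^sub>R c 1) + (fst w ^ 3 * stage_defect 2 \<tau>) *\<^sub>R c 1)"
        by (intro bigO_h_add bigO_h_mono[OF R4] weight_bigO[OF bigO_h_const d(2)]) auto
    qed simp
    obtain j where "bigO_h 2 (\<lambda>w \<tau>. jacobian w \<tau> (c 0) - (\<Sum>k<2. (\<tau> * fst w) ^ k *\<^sub>R j k))"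
      using jacobian_expansion[of 2 "c 0"] 3 by auto
    then have J11: "bigO_h 2 (\<lambda>w \<tau>. jacobian w \<tau> (c 0) - j 0 - (fst w * \<tau>) *\<^sub>R j 1)"
      by (simp add: eval_nat_numeral diff_diff_eq mult.commute)
    have J10: "bigO_h 1 (\<lambda>w \<tau>. jacobian w \<tau> (c 0) - j 0)"
    proof (rule bigO_h_cong)
      show "bigO_h 1 (\<lambda>w \<tau>. (jacobian w \<tau> (c 0) - j 0 - (fst w * \<tau>) *\<^sub>R j 1) + (fst w ^ 1 * \<tau>) *\<^sub>R j 1)"
        by (intro bigO_h_add bigO_h_mono[OF J11] weight_bigO[OF bigO_h_const, of _ 1]) auto
    qed simp
    have J_const: "\<exists>j. bigO_h 1 (\<lambda>w \<tau>. jacobian w \<tau> v - j)" for v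
      using jacobian_expansion[of 1 v] 3 by auto
    obtain j20 where J20: "bigO_h 1 (\<lambda>w \<tau>. jacobian w \<tau> (c 1) - j20)" using J_const by blast
    obtain j100 where J100: "bigO_h 1 (\<lambda>w \<tau>. jacobian w \<tau> (j 0) - j100)" using J_const by blast
    have a: "\<alpha> (0, 1) = - sqrt 3 / 6" "\<alpha> (1, 1) = 0" "\<alpha> (0, 2) = 0"
      "((\<lambda>i. \<alpha> (0, i) * \<alpha> (i, 1)) has_sum 0) {3..}"
      using assms 3 by simp_all
    from order_4[OF d integral_defect_1[OF a(1)] R3 J10 d integral_defect_2[OF a(1,3)]
        integral_id_defect_1[OF a(1,2)] integral_stage_op_defect_1[OF a] R4 J11 J20 J100]
    show ?thesis using 3 by simp
  qed
qed

text \<open>The fundamental theorem of calculus for z after the substitution t = t0 + \<tau>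
  h.\<close>

lemma quadrature_exact:
  assumes w: "w \<in> steps"
  shows "fst w *\<^sub>R (LINT \<tau>|unit_lebesgue. exact_rhs w \<tau>) = z (t0 + fst w) - z0"
proof -
  let ?s = "\<lambda>\<tau>. t0 + \<tau> * fst w"
  have "((\<lambda>\<tau>. fst w *\<^sub>R exact_rhs w \<tau>) has_integral ((z \<circ> ?s) 1 - (z \<circ> ?s) 0)) {0..1}"
  proof (rule fundamental_theorem_of_calculus)
    fix \<tau> :: real assume \<tau>: "\<tau> \<in> {0..1}"
    have s: "(?s has_vector_derivative fst w) (at \<tau> within {0..1})"
      by (auto intro!: derivative_eq_intros simp flip: has_real_derivative_iff_has_vector_derivative)
    have "?s ` {0..1} \<subseteq> {t0..t0 + h0}" using stepsD(8)[OF w] by blast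
    then have "(z has_vector_derivative exact_rhs w \<tau>) (at (?s \<tau>) within ?s ` {0..1})"
      unfolding exact_rhs_def exact_stage_def
      by (rule has_vector_derivative_within_subset[OF sol_at(2)[OF stepsD(8)[OF w \<tau>]]])
    from vector_diff_chain_within[OF s this]
    show "((z \<circ> ?s) has_vector_derivative fst w *\<^sub>R exact_rhs w \<tau>) (at \<tau> within {0..1})" .
  qed simp
  from integral_unique[OF this]
  have "fst w *\<^sub>R integral {0..1} (exact_rhs w) = z (t0 + fst w) - z0"
    by (simp add: z_t0)
  moreover have "integral {0..1} (exact_rhs w) = (LINT \<tau>|unit_lebesgue. exact_rhs w \<tau>)"
    by (rule lebesgue_integral_eq_integral[symmetric, OF exact_rhs_integrable(1)[OF w]]) simp
  ultimately show ?thesis by simp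
qed

lemma step_error:
  assumes w: "w \<in> steps"
  shows "z0 + fst w *\<^sub>R (LINT \<tau>|unit_lebesgue. num_rhs w \<tau>) - z (t0 + fst w)
    = fst w *\<^sub>R (LINT \<tau>|unit_lebesgue. rhs_error w \<tau>)"
proof -
  have "(LINT \<tau>|unit_lebesgue. rhs_error w \<tau>)
      = (LINT \<tau>|unit_lebesgue. num_rhs w \<tau>) - (LINT \<tau>|unit_lebesgue. exact_rhs w \<tau>)"
    unfolding rhs_error_def
    by (rule Bochner_Integration.integral_diff[OF stepsD(7)[OF w] exact_rhs_integrable(1)[OF w]])
  then show ?thesis using quadrature_exact[OF w] by (simp add: scaleR_diff_right)
qed

text \<open>\<open>B\<close> and \<open>C\<close> are prescribed only on [0,1], which is all that
  the integrals see; \<open>steps\<close> is \<open>csRK_step\<close> rid of them and of the result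
  \<open>z1\<close>.\<close>

lemma csRK_step_iff:
  assumes B: "\<And>\<tau>. \<tau> \<in> {0..1} \<Longrightarrow> B \<tau> = 1" and C: "\<And>\<tau>. \<tau> \<in> {0..1} \<Longrightarrow> C \<tau> = \<tau>"
    and h: "0 < h" "h < h0" and Z: "\<forall>\<tau>\<in>{0..1}. Z \<tau> \<in> ball z0 r"
  shows "csRK_step A B C f t0 z0 h Z z1 \<longleftrightarrow>
    (h, Z) \<in> steps \<and> z1 = z0 + h *\<^sub>R (LINT \<tau>|unit_lebesgue. num_rhs (h, Z) \<tau>)"
proof -
  have i: "set_integrable lebesgue {0..1} (\<lambda>\<sigma>. a \<sigma> *\<^sub>R f (t0 + C \<sigma> * h) (Z \<sigma>))
      \<longleftrightarrow> integrable unit_lebesgue (\<lambda>\<sigma>. b \<sigma> *\<^sub>R f (t0 + \<sigma> * h) (Z \<sigma>))"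
    "(LINT \<sigma>:{0..1}|lebesgue. a \<sigma> *\<^sub>R f (t0 + C \<sigma> * h) (Z \<sigma>))
      = (LINT \<sigma>|unit_lebesgue. b \<sigma> *\<^sub>R f (t0 + \<sigma> * h) (Z \<sigma>))"
    if "\<And>\<sigma>. \<sigma> \<in> {0..1} \<Longrightarrow> a \<sigma> = b \<sigma>" for a b :: "real \<Rightarrow> real"
  proof -
    have "indicator {0..1} \<sigma> *\<^sub>R a \<sigma> *\<^sub>R f (t0 + C \<sigma> * h) (Z \<sigma>)
        = indicator {0..1} \<sigma> *\<^sub>R b \<sigma> *\<^sub>R f (t0 + \<sigma> * h) (Z \<sigma>)" for \<sigma>
      using that[of \<sigma>] C[of \<sigma>] by (cases "\<sigma> \<in> {0..1}") auto
    then show "set_integrable lebesgue {0..1} (\<lambda>\<sigma>. a \<sigma> *\<^sub>R f (t0 + C \<sigma> * h) (Z \<sigma>))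
      \<longleftrightarrow> integrable unit_lebesgue (\<lambda>\<sigma>. b \<sigma> *\<^sub>R f (t0 + \<sigma> * h) (Z \<sigma>))"
      "(LINT \<sigma>:{0..1}|lebesgue. a \<sigma> *\<^sub>R f (t0 + C \<sigma> * h) (Z \<sigma>))
      = (LINT \<sigma>|unit_lebesgue. b \<sigma> *\<^sub>R f (t0 + \<sigma> * h) (Z \<sigma>))"
      by (simp_all add: set_integrable_def set_lebesgue_integral_def integrable_restrict_space
          integral_restrict_space)
  qed
  note iA = i[of "A \<tau>" "A \<tau>" for \<tau>, OF refl] and iB = i[of B "\<lambda>_. 1", OF B, simplified]
  show ?thesis
    unfolding csRK_step_def iA iB steps_def num_rhs_def stage_op_def fst_conv snd_conv
    using h Z by auto
qed

text \<open>The fixed point is sought in the closed ball of radius r/2, where the iteration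
  converges, and so lies in the open ball of radius r.\<close>

lemma step_exists:
  assumes h: "0 < h" "h < h0"
  shows "\<exists>Z. (\<forall>\<tau>\<in>{0..1}. Z \<tau> \<in> ball z0 r) \<and> (h, Z) \<in> steps"
proof -
  define \<Phi> where "\<Phi> = (\<lambda>\<sigma>. f (t0 + \<sigma> * h))"
  have half: "cball z0 (r / 2) \<subseteq> cball z0 r" "cball z0 (r / 2) \<subseteq> ball z0 r" using r by auto
  have cont: "continuous_on ({0..1} \<times> cball z0 (r / 2)) (\<lambda>p. \<Phi> (fst p) (snd p))"
  proof -
    have "continuous_on ({0..1} \<times> cball z0 (r / 2)) (\<lambda>p. (t0 + fst p * h, snd p))"
      by (intro continuous_intros)
    moreover have "(\<lambda>p. (t0 + fst p * h, snd p)) ` ({0..1} \<times> cball z0 (r / 2)) \<subseteq> U"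
      using box half(1) time_in[OF h] by fastforce
    ultimately have "continuous_on ({0..1} \<times> cball z0 (r / 2))
        (\<lambda>p. f (fst (t0 + fst p * h, snd p)) (snd (t0 + fst p * h, snd p)))"
      by (rule continuous_on_compose2[OF continuous_on_f])
    then show ?thesis by (simp add: \<Phi>_def)
  qed
  have le: "h * m * M \<le> r / 2" "h * L * M \<le> 1 / 2"
  proof -
    have "h * (m * M) \<le> h0 * (m * M)" "h * (L * M) \<le> h0 * (L * M)"
      using h mL M_nonneg by (auto intro!: mult_right_mono)
    then show "h * m * M \<le> r / 2" "h * L * M \<le> 1 / 2" using small by (simp_all add: mult.assoc)
  qed
  have b: "norm (\<Phi> \<sigma> y) \<le> m" if "\<sigma> \<in> {0..1}" "y \<in> cball z0 (r / 2)" for \<sigma> y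
    unfolding \<Phi>_def using f_bound[OF time_in[OF h that(1)]] half(1) that(2) by blast
  have l: "norm (\<Phi> \<sigma> y - \<Phi> \<sigma> y') \<le> L * norm (y - y')"
    if "\<sigma> \<in> {0..1}" "y \<in> cball z0 (r / 2)" "y' \<in> cball z0 (r / 2)" for \<sigma> y y'
    unfolding \<Phi>_def using f_Lipschitz[OF time_in[OF h that(1)]] half(1) that(2,3) by blast
  obtain Z where Zm: "Z \<in> borel_measurable unit_lebesgue"
    and Zr: "\<And>\<tau>. \<tau> \<in> {0..1} \<Longrightarrow> Z \<tau> \<in> cball z0 (r / 2)"
    and Z: "\<And>\<tau>. \<tau> \<in> {0..1} \<Longrightarrow> Z \<tau> = z0 + h *\<^sub>R stage_op (\<lambda>\<sigma>. \<Phi> \<sigma> (Z \<sigma>)) \<tau>"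
    using stage_equation_exists[OF cont b l h(1) le mL] by blast
  have m: "(\<lambda>\<sigma>. \<Phi> \<sigma> (Z \<sigma>)) \<in> borel_measurable unit_lebesgue"
    by (rule measurable_compose_stage[OF cont Zm Zr])
  have ae: "AE \<sigma> in unit_lebesgue. norm (\<Phi> \<sigma> (Z \<sigma>)) \<le> m"
    by (rule AE_I2) (use b Zr in simp)
  have "\<forall>\<tau>\<in>{0..1}. Z \<tau> \<in> ball z0 r" using Zr half(2) by blast
  moreover have "(h, Z) \<in> steps"
    using h calculation Z stage_integrable[OF m ae] integrable_unit_lebesgue_bounded[OF m ae]
    unfolding steps_def \<Phi>_def by simp
  ultimately show ?thesis by blast
qed

lemma step_unique:
  assumes Z: "(h, Z) \<in> steps" and Z': "(h, Z') \<in> steps" and \<tau>: "\<tau> \<in> {0..1}"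
  shows "Z \<tau> = Z' \<tau>"
proof (rule stage_equation_unique[OF _ _ _ mL(2) _ _ _ _ _ _ \<tau>, where h = h
      and \<Phi> = "\<lambda>\<sigma>. f (t0 + \<sigma> * h)" and r = r and ?z0.0 = z0])
  show h: "0 < h" using stepsD(1)[OF Z] by simp
  have h': "h < h0" using stepsD(2)[OF Z] by simp
  have "h * (L * M) \<le> h0 * (L * M)"
    using h' mL M_nonneg by (auto intro!: mult_right_mono)
  then show "h * L * M \<le> 1 / 2" using small by (simp add: mult.assoc)
  show "norm (f (t0 + \<sigma> * h) y - f (t0 + \<sigma> * h) y') \<le> L * norm (y - y')"
    if "\<sigma> \<in> {0..1}" "y \<in> cball z0 r" "y' \<in> cball z0 r" for \<sigma> y y'
    by (rule f_Lipschitz[OF time_in[OF h h' that(1)] that(2,3)])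
qed (use stepsD(4-6)[OF Z] stepsD(4-6)[OF Z'] in \<open>simp_all add: num_rhs_def[abs_def]\<close>)

lemma csRK_convergence:
  assumes B: "\<And>\<tau>. \<tau> \<in> {0..1} \<Longrightarrow> B \<tau> = 1" and C: "\<And>\<tau>. \<tau> \<in> {0..1} \<Longrightarrow> C \<tau> = \<tau>"
    and K: "\<forall>w\<in>steps. norm (LINT \<tau>|unit_lebesgue. rhs_error w \<tau>) \<le> K * fst w ^ p"
    and h: "0 < h" "h < h0"
  shows "\<exists>!z1. \<exists>Z. (\<forall>\<tau>\<in>{0..1}. Z \<tau> \<in> ball z0 r) \<and> csRK_step A B C f t0 z0 h Z z1"
    and "(\<forall>\<tau>\<in>{0..1}. Z \<tau> \<in> ball z0 r) \<Longrightarrow> csRK_step A B C f t0 z0 h Z z1 \<Longrightarrow>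
      norm (z1 - z (t0 + h)) \<le> K * h ^ (p + 1)"
proof -
  note iff = csRK_step_iff[of B C h, OF B C h]
  show "\<exists>!z1. \<exists>Z. (\<forall>\<tau>\<in>{0..1}. Z \<tau> \<in> ball z0 r) \<and> csRK_step A B C f t0 z0 h Z z1"
  proof (rule ex_ex1I)
    show "\<exists>z1 Z. (\<forall>\<tau>\<in>{0..1}. Z \<tau> \<in> ball z0 r) \<and> csRK_step A B C f t0 z0 h Z z1"
      using step_exists[OF h] iff by blast
    fix z1 z1'
    assume "\<exists>Z. (\<forall>\<tau>\<in>{0..1}. Z \<tau> \<in> ball z0 r) \<and> csRK_step A B C f t0 z0 h Z z1"
      and "\<exists>Z. (\<forall>\<tau>\<in>{0..1}. Z \<tau> \<in> ball z0 r) \<and> csRK_step A B C f t0 z0 h Z z1'"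
    then obtain Z Z' where *: "(h, Z) \<in> steps" "z1 = z0 + h *\<^sub>R (LINT \<tau>|unit_lebesgue. num_rhs (h, Z) \<tau>)"
      "(h, Z') \<in> steps" "z1' = z0 + h *\<^sub>R (LINT \<tau>|unit_lebesgue. num_rhs (h, Z') \<tau>)"
      using iff by blast
    have "(LINT \<tau>|unit_lebesgue. num_rhs (h, Z) \<tau>) = (LINT \<tau>|unit_lebesgue. num_rhs (h, Z') \<tau>)"
      by (rule Bochner_Integration.integral_cong[OF refl])
        (simp add: num_rhs_def step_unique[OF *(1,3)])
    then show "z1 = z1'" using * by simp
  qed
  assume "\<forall>\<tau>\<in>{0..1}. Z \<tau> \<in> ball z0 r" and "csRK_step A B C f t0 z0 h Z z1"
  then have w: "(h, Z) \<in> steps" and z1: "z1 = z0 + h *\<^sub>R (LINT \<tau>|unit_lebesgue. num_rhs (h, Z) \<tau>)"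
    using iff by blast+
  \<comment> \<open>The outer factor h raises the power from p to p + 1.\<close>
  have "z1 - z (t0 + h) = h *\<^sub>R (LINT \<tau>|unit_lebesgue. rhs_error (h, Z) \<tau>)"
    using step_error[OF w] z1 by simp
  moreover have "h * norm (LINT \<tau>|unit_lebesgue. rhs_error (h, Z) \<tau>) \<le> h * (K * h ^ p)"
    using K w h(1) by (intro mult_left_mono) auto
  ultimately show "norm (z1 - z (t0 + h)) \<le> K * h ^ (p + 1)"
    using h(1) by (simp add: mult.left_commute)
qed

end

section \<open>Choice of the neighbourhood and of the step size bound\<close>

context csRK_method
begin

lemma csRK_orderI:
  assumes B: "\<And>\<tau>. \<tau> \<in> {0..1} \<Longrightarrow> B \<tau> = 1" and C: "\<And>\<tau>. \<tau> \<in> {0..1} \<Longrightarrow> C \<tau> = \<tau>"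
    and p2: "2 \<le> p" and p4: "p \<le> 4"
    and conds: "3 \<le> p \<Longrightarrow> \<alpha> (0, 1) = - sqrt 3 / 6"
      "4 \<le> p \<Longrightarrow> \<alpha> (1, 1) = 0" "4 \<le> p \<Longrightarrow> \<alpha> (0, 2) = 0"
      "4 \<le> p \<Longrightarrow> ((\<lambda>i. \<alpha> (0, i) * \<alpha> (i, 1)) has_sum 0) {3..}"
  shows "csRK_order TYPE('a::euclidean_space) A B C p"
  unfolding csRK_order_def
proof (intro allI impI)
  fix f :: "real \<Rightarrow> 'a \<Rightarrow> 'a" and U t0 z0 T z
  assume U: "open U" "(t0, z0) \<in> U" and Ck: "Ck_on p (\<lambda>x. f (fst x) (snd x)) U"
    and T: "0 < T" and sol: "ivp_solution f U t0 z0 T z"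
  let ?F = "\<lambda>x. f (fst x) (snd x)"
  obtain e where e: "e > 0" "cball (t0, z0) e \<subseteq> U" using U open_contains_cball by blast
  \<comment> \<open>Half of \<open>e\<close>, so that an interval times a ball of this size fits
    into the ball of radius \<open>e\<close>; a product is needed in order to vary the state at
    fixed time.\<close>
  define r where "r = e / 2"
  have r: "0 < r" using e by (simp add: r_def)
  define K where "K = {t0..t0 + r} \<times> cball z0 r"
  have "K \<subseteq> cball (t0, z0) e"
  proof
    fix x assume "x \<in> K"
    then have "\<bar>t0 - fst x\<bar> \<le> r" "dist z0 (snd x) \<le> r" by (auto simp: K_def)
    moreover have "dist (t0, z0) x \<le> \<bar>t0 - fst x\<bar> + dist z0 (snd x)"
      using norm_Pair_le[of "t0 - fst x" "z0 - snd x"] by (cases x) (simp add: dist_norm)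
    ultimately show "x \<in> cball (t0, z0) e" by (simp add: r_def)
  qed
  then have KU: "K \<subseteq> U" using e by blast
  have K: "compact K" "convex K"
    by (auto simp: K_def intro!: compact_Times convex_Times)
  have "bounded (?F ` K)"
    using continuous_on_subset[OF Ck_on_imp_continuous_on[OF Ck] KU] K(1)
      compact_continuous_image compact_imp_bounded by blast
  then obtain m0 where m0: "\<And>x. x \<in> K \<Longrightarrow> norm (?F x) \<le> m0" unfolding bounded_iff by blast
  define m where "m = \<bar>m0\<bar>"
  have m: "0 \<le> m" "\<And>x. x \<in> K \<Longrightarrow> norm (?F x) \<le> m"
    using m0 unfolding m_def by (simp, meson abs_ge_self order_trans)
  have Ck1: "Ck_on (Suc 0) ?F U" and Ck2: "Ck_on (Suc (Suc 0)) ?F U"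
    by (rule Ck_on_mono[OF Ck], use p2 in simp)+
  obtain L1 where L1: "L1 \<ge> 0" "\<forall>x\<in>K. \<forall>y\<in>K. norm (?F x - ?F y) \<le> L1 * norm (x - y)"
    using Ck_on_Lipschitz[OF Ck1 K KU] by blast
  obtain L2 where L2: "L2 \<ge> 0" "\<forall>x\<in>K. \<forall>v. norm (frechet_derivative ?F (at x) v) \<le> L2 * norm v"
    using frechet_derivative_bounded_on_compact[OF Ck1 K(1) KU] by blast
  obtain Q where Q: "\<forall>x\<in>K. \<forall>y\<in>K.
      norm (?F y - ?F x - frechet_derivative ?F (at x) (y - x)) \<le> Q * (norm (y - x))\<^sup>2"
    using Ck_on_quadratic_remainder[OF Ck2 K KU] by blast
  define L where "L = L1 + L2"
  have L: "0 \<le> L" "L1 * norm x \<le> L * norm x" "L2 * norm y \<le> L * norm y" for x :: 'a and y :: "real \<times> 'a"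
    using L1(1) L2(1) by (auto simp: L_def distrib_right)
  have cont: "continuous_on {t0..t0 + T} z"
    by (rule continuous_on_vector_derivative[where f' = "\<lambda>t. f t (z t)"])
      (use sol in \<open>simp add: ivp_solution_def\<close>)
  have "t0 \<in> {t0..t0 + T}" using T by simp
  then obtain d where d: "0 < d" "\<forall>t\<in>{t0..t0 + T}. dist t t0 < d \<longrightarrow> dist (z t) (z t0) < r"
    using cont[unfolded continuous_on_iff, rule_format, OF _ r] by blast
  \<comment> \<open>Adding 1 keeps the denominators positive even if \<open>m * M\<close> or
    \<open>L * M\<close> is 0.\<close>
  define h1 h2 where "h1 = r / (2 * (m * M + 1))" and "h2 = 1 / (2 * (L * M + 1))"
  define h0 where "h0 = min (min (min T 1) (min r (d / 2))) (min h1 h2)"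
  have mM: "0 \<le> m * M" and LM: "0 \<le> L * M" using m(1) L(1) M_nonneg by simp_all
  then have "0 < h1" "0 < h2" using r by (simp_all add: h1_def h2_def add_nonneg_pos)
  then have h0: "0 < h0" "h0 \<le> T" "h0 \<le> 1" "h0 \<le> r" "h0 < d" "h0 \<le> h1" "h0 \<le> h2"
    using T r d(1) unfolding h0_def by linarith+
  have "h0 * (m * M + 1) \<le> h1 * (m * M + 1)" using h0(6) mM by (intro mult_right_mono) auto
  also have "\<dots> = r / 2" using mM by (simp add: h1_def field_simps add_nonneg_eq_0_iff)
  finally have s1: "h0 * m * M \<le> r / 2" using h0(1) by (simp add: distrib_left mult.assoc)
  have "h0 * (L * M + 1) \<le> h2 * (L * M + 1)" using h0(7) LM by (intro mult_right_mono) auto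
  also have "\<dots> = 1 / 2" using LM by (simp add: h2_def field_simps add_nonneg_eq_0_iff)
  finally have s2: "h0 * L * M \<le> 1 / 2" using h0(1) by (simp add: distrib_left mult.assoc)
  have inK: "(t, y) \<in> K" if "t \<in> {t0..t0 + h0}" "y \<in> cball z0 r" for t y
    using that h0(4) by (auto simp: K_def)
  interpret csRK_ivp A \<alpha> g M f U t0 z0 T z p r h0 m L Q
  proof
    show "{t0..t0 + h0} \<times> cball z0 r \<subseteq> U" using inK KU by blast
    fix t assume t: "t \<in> {t0..t0 + h0}"
    have "dist (z t) (z t0) < r" using d(2) t h0 by (simp add: dist_real_def)
    then show "z t \<in> cball z0 r" using sol by (simp add: ivp_solution_def dist_commute)
    fix y assume y: "y \<in> cball z0 r"
    note ty = inK[OF t y]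
    show "norm (f t y) \<le> m" using m(2)[OF ty] by simp
    show "norm (frechet_derivative ?F (at (t, y)) v) \<le> L * norm v" for v
      using L2(2)[rule_format, OF ty, of v] L(3)[of v] by linarith
    fix y' assume y': "y' \<in> cball z0 r"
    note ty' = inK[OF t y']
    show "norm (f t y - f t y') \<le> L * norm (y - y')"
      using L1(2)[rule_format, OF ty ty'] L(2)[of "y - y'"] by (simp add: norm_Pair)
    show "norm (f t y' - f t y - frechet_derivative ?F (at (t, y)) (0, y' - y)) \<le> Q * (norm (y' - y))\<^sup>2"
      using Q[rule_format, OF ty ty'] by (simp add: norm_Pair)
  qed (fact U(1) Ck p2 sol h0(1-3) r m(1) L(1) s1 s2)+
  obtain K where "\<forall>w\<in>steps. norm (LINT \<tau>|unit_lebesgue. rhs_error w \<tau>) \<le> K * fst w ^ p"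
    using rhs_error_order[OF p4 conds] by blast
  note conv = csRK_convergence[of B C, OF B C this]
  show "\<exists>r>0. \<exists>h0>0. \<exists>K. h0 \<le> T \<and>
     (\<forall>h. 0 < h \<longrightarrow> h < h0 \<longrightarrow>
        (\<exists>!z1. \<exists>Z. (\<forall>\<tau>\<in>{0..1}. Z \<tau> \<in> ball z0 r) \<and> csRK_step A B C f t0 z0 h Z z1) \<and>
        (\<forall>z1 Z. (\<forall>\<tau>\<in>{0..1}. Z \<tau> \<in> ball z0 r) \<longrightarrow> csRK_step A B C f t0 z0 h Z z1 \<longrightarrow>
           norm (z1 - z (t0 + h)) \<le> K * h ^ (p + 1)))"
    by (rule exI[of _ r], rule conjI[OF r], rule exI[of _ h0], rule conjI[OF h0(1)], rule exI[of _ K],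
        rule conjI[OF h0(2)]) (intro allI impI conjI conv)
qed

end

theorem theorem2p3:
  fixes A :: "real \<Rightarrow> real \<Rightarrow> real"
    and B C :: "real \<Rightarrow> real"
    and \<alpha> :: "nat \<times> nat \<Rightarrow> real"
  assumes "\<And>\<tau>. \<tau> \<in> {0..1} \<Longrightarrow> B \<tau> = 1"
    and "\<And>\<tau>. \<tau> \<in> {0..1} \<Longrightarrow> C \<tau> = \<tau>"
    and "L2_square A"
    and "bounded_row_integrals A"
    and "has_L2_sum (\<lambda>(i, j) \<tau> \<sigma>. \<alpha> (i, j) * legendre i \<tau> * legendre j \<sigma>)
           (\<lambda>\<tau> \<sigma>. A \<tau> \<sigma> - (1 / 2 + sqrt 3 / 6 * legendre 1 \<tau>)) (UNIV \<times> {1..})"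
  shows "csRK_order TYPE('a::euclidean_space) A B C 2 \<and>
    (\<alpha> (0, 1) = - sqrt 3 / 6 \<longrightarrow> csRK_order TYPE('a) A B C 3) \<and>
    (\<alpha> (0, 1) = - sqrt 3 / 6 \<and> \<alpha> (1, 1) = 0 \<and> \<alpha> (0, 2) = 0 \<and>
       ((\<lambda>i. \<alpha> (0, i) * \<alpha> (i, 1)) has_sum 0) {3..}
      \<longrightarrow> csRK_order TYPE('a) A B C 4)"
proof -
  obtain g where g: "square_integrable unit_square g"
    and A_eq: "AE p in unit_square. A (fst p) (snd p) = g p"
    using L2_square_borel_version[OF assms(3)] by blast
  interpret csRK_coefficients A \<alpha> g by unfold_locales (fact g A_eq assms(5))+
  obtain M where "csRK_kernel A M" using kernel[OF assms(4)] by blast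
  then interpret csRK_kernel A M .
  interpret csRK_method A \<alpha> g M ..
  \<comment> \<open>For p = 2, 3, 4 the premises guarded by \<open>3 \<le> p\<close> and
    \<open>4 \<le> p\<close> reduce to the hypotheses of the respective claim.\<close>
  show ?thesis
    using csRK_orderI[where ?'a = 'a and B = B and C = C and p = 2, OF assms(1,2)] csRK_orderI[where ?'a = 'a and B = B and C = C and p = 3, OF assms(1,2)]
      csRK_orderI[where ?'a = 'a and B = B and C = C and p = 4, OF assms(1,2)] by simp
qed

end
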